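(* Let $M$ be a cactus configuration on $[d]$, and let $Q_M$ be the set of points of $M$ lying on at least three lines. Then every irreducible component of the circuit variety $V_{\mathcal{C}(M)}$ is of the form $V_{M(J)}$ for some $J\subseteq Q_M$. In particular, $V_{\mathcal{C}(M)}$ has at most $2^{|Q_M|}$ irreducible components.
   Context: For a matroid $N$ on $[d]$ of rank at most three: - A family $(\gamma_1,\dots,\gamma_d)\subset\mathbb{C}^3$ is a realization if $S\subseteq[d]$ is dependent in $N$ exactly when $\{\gamma_i:i\in S\}$ is linearly dependent. - $V_N$ is the Zariski closure in $\mathbb{C}^{3d}$ of the set of realizations. - The circuit variety $V_{\mathcal{C}(N)}$ is the set of $\gamma\in\mathbb{C}^{3d}$ such that every dependent set $S$ of $N$ gives a linearly dependent family $\{\gamma_i:i\in S\}$. - For $J\subseteq[d]$, $N(J)$ is the matroid on $[d]$ whose independent sets are the independent sets of $N$ disjoint from $J$; that is, the elements of $J$ are made loops. For a simple rank-three matroid: - A line is a maximal subset with at least three elements all of whose $3$-subsets are dependent. - $\mathcal{L}_p$ is the set of lines through $p$. Cactus configurations: - A line matroid is $U_{2,n}$. - A cycle is a simple matroid with $n$ lines admitting points $p_1,\dots,p_n$ and an ordering $l_1,\dots,l_n$ of the lines with $\mathcal{L}_{p_i}=\{l_i,l_{i+1}\}$ (indices mod $n$), all other points lying on exactly one line. - The free gluing of two such matroids at points $p,q$ identifies $p$ and $q$ into one point, keeps all lines of both, and adds no other dependencies. - A connected cactus configuration is a simple rank-three matroid obtained from a line matroid or cycle by successively freely gluing with line matroids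 or cycles. - A cactus configuration is one whose connected components (with respect to lying on a common line) are connected cactus configurations. *)

theory Defs
  imports "HOL-Analysis.Analysis"
begin

section \<open>Matroids\<close>

record 'a set_system =
  ground :: "'a set"
  indeps :: "'a set set"

definition matroid :: "'a set_system \<Rightarrow> bool" where
  "matroid M \<longleftrightarrow>
     finite (ground M) \<and> indeps M \<subseteq> Pow (ground M) \<and> {} \<in> indeps M \<and>
     (\<forall>X Y. Y \<in> indeps M \<and> X \<subseteq> Y \<longrightarrow> X \<in> indeps M) \<and>
     (\<forall>X Y. X \<in> indeps M \<and> Y \<in> indeps M \<and> card X < card Y \<longrightarrow>
        (\<exists>y\<in>Y - X. insert y X \<in> indeps M))"

definition dependent_sets :: "'a set_system \<Rightarrow> 'a set set" where
  "dependent_sets M = Pow (ground M) - indeps M"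

definition matroid_rank :: "'a set_system \<Rightarrow> nat" where
  "matroid_rank M = Max (card ` indeps M)"

definition simple_matroid :: "'a set_system \<Rightarrow> bool" where
  "simple_matroid M \<longleftrightarrow> matroid M \<and> (\<forall>S\<subseteq>ground M. card S \<le> 2 \<longrightarrow> S \<in> indeps M)"

definition restriction :: "'a set_system \<Rightarrow> 'a set \<Rightarrow> 'a set_system" where
  "restriction M C = \<lparr>ground = C, indeps = indeps M \<inter> Pow C\<rparr>"

text \<open>The matroid $M(J)$: the ground set is unchanged, the elements of $J$ become loops.\<close>

definition make_loops :: "'a set_system \<Rightarrow> 'a set \<Rightarrow> 'a set_system" where
  "make_loops M J = \<lparr>ground = ground M, indeps = {S \<in> indeps M. S \<inter> J = {}}\<rparr>"

definition uniform_matroid :: "nat \<Rightarrow> 'a set \<Rightarrow> 'a set_system" where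
  "uniform_matroid r E = \<lparr>ground = E, indeps = {S. S \<subseteq> E \<and> card S \<le> r}\<rparr>"


section \<open>Lines\<close>

definition triples_dependent :: "'a set_system \<Rightarrow> 'a set \<Rightarrow> bool" where
  "triples_dependent M L \<longleftrightarrow>
     L \<subseteq> ground M \<and> 3 \<le> card L \<and> (\<forall>T\<subseteq>L. card T = 3 \<longrightarrow> T \<in> dependent_sets M)"

definition lines :: "'a set_system \<Rightarrow> 'a set set" where
  "lines M = {L. triples_dependent M L \<and> (\<forall>L'. triples_dependent M L' \<and> L \<subseteq> L' \<longrightarrow> L' = L)}"

definition lines_through :: "'a set_system \<Rightarrow> 'a \<Rightarrow> 'a set set" where
  "lines_through M p = {L \<in> lines M. p \<in> L}"

definition multiple_points :: "'a set_system \<Rightarrow> 'a set" where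
  "multiple_points M = {p \<in> ground M. 3 \<le> card (lines_through M p)}"

definition collinear_rel :: "'a set_system \<Rightarrow> 'a rel" where
  "collinear_rel M = {(x, y). \<exists>L\<in>lines M. x \<in> L \<and> y \<in> L}"

definition connected_components_of_matroid :: "'a set_system \<Rightarrow> 'a set set" where
  "connected_components_of_matroid M = (\<lambda>x. (collinear_rel M)\<^sup>* `` {x}) ` ground M"


section \<open>Cactus configurations\<close>

text \<open>
  A line has at least three points, so line matroids are $U_{2,n}$ with $n \ge 3$.
\<close>

definition line_matroid :: "'a set_system \<Rightarrow> bool" where
  "line_matroid N \<longleftrightarrow>
     (\<exists>E. finite E \<and> 3 \<le> card E \<and> N = uniform_matroid 2 E)"

text \<open>
  Indices are \<open>0, \<dots>, n - 1\<close>. As \<open>n \<ge> 3\<close> and the lines \<open>l i\<close> are distinct, the points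
  \<open>p i\<close> are automatically distinct.
\<close>

definition cycle_matroid :: "'a set_system \<Rightarrow> bool" where
  "cycle_matroid N \<longleftrightarrow>
     simple_matroid N \<and> matroid_rank N = 3 \<and>
     (\<exists>(n::nat) (l :: nat \<Rightarrow> 'a set) (p :: nat \<Rightarrow> 'a).
        3 \<le> n \<and> bij_betw l {..<n} (lines N) \<and>
        (\<forall>i<n. p i \<in> ground N \<and> lines_through N (p i) = {l i, l (Suc i mod n)}) \<and>
        (\<forall>x\<in>ground N - p ` {..<n}. card (lines_through N x) = 1))"

text \<open>
  The free gluing of \<open>M\<close> and \<open>N\<close> at \<open>p\<close> and \<open>q\<close>, for \<open>M\<close> and \<open>N\<close> on disjoint ground sets:
  \<open>q\<close> is renamed to \<open>p\<close>. The result is the simple matroid of rank three whose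
  dependent sets are the collinear triples and the sets with at least four elements.
\<close>

definition glue_map :: "'a \<Rightarrow> 'a \<Rightarrow> 'a \<Rightarrow> 'a" where
  "glue_map p q = id(q := p)"

definition glued_lines :: "'a set_system \<Rightarrow> 'a \<Rightarrow> 'a set_system \<Rightarrow> 'a \<Rightarrow> 'a set set" where
  "glued_lines M p N q = lines M \<union> (\<lambda>L. glue_map p q ` L) ` lines N"

definition free_gluing :: "'a set_system \<Rightarrow> 'a \<Rightarrow> 'a set_system \<Rightarrow> 'a \<Rightarrow> 'a set_system" where
  "free_gluing M p N q =
     (let E = ground M \<union> glue_map p q ` ground N
      in \<lparr>ground = E,
          indeps = {S. S \<subseteq> E \<and> card S \<le> 3 \<and>
                       \<not> (card S = 3 \<and> (\<exists>L\<in>glued_lines M p N q. S \<subseteq> L))}\<rparr>)"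

text \<open>
  Since every finite set of labels leaves fresh ones, disjointness of the ground sets is no
  restriction: line matroids and cycles can be relabelled freely.
  Everything obtained here is simple of rank three, except for a line matroid to which nothing
  has been glued. That one has rank two, and it is kept so that it can be a connected component
  of a cactus configuration; rank three is required there of the whole matroid.
\<close>

inductive connected_cactus :: "nat set_system \<Rightarrow> bool" where
  line: "line_matroid N \<Longrightarrow> connected_cactus N"
| cycle: "cycle_matroid N \<Longrightarrow> connected_cactus N"
| glue: "\<lbrakk>connected_cactus M; line_matroid N \<or> cycle_matroid N; ground M \<inter> ground N = {};
          p \<in> ground M; q \<in> ground N\<rbrakk> \<Longrightarrow> connected_cactus (free_gluing M p N q)"

definition cactus_configuration :: "nat set_system \<Rightarrow> bool" where
  "cactus_configuration M \<longleftrightarrow>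
     simple_matroid M \<and> matroid_rank M = 3 \<and>
     (\<forall>C\<in>connected_components_of_matroid M. connected_cactus (restriction M C))"


section \<open>Zariski topology on families of vectors\<close>

text \<open>
  The affine space $\mathbb{C}^{3d}$ consists of the families of vectors in $\mathbb{C}^3$
  indexed by \<open>E\<close>, where \<open>E\<close> has \<open>d\<close> elements. Outside \<open>E\<close> the families are \<open>undefined\<close>.
\<close>

definition config_space :: "'a set \<Rightarrow> ('a \<Rightarrow> complex ^ 3) set" where
  "config_space E = E \<rightarrow>\<^sub>E UNIV"

inductive_set poly_functions :: "'a set \<Rightarrow> (('a \<Rightarrow> complex ^ 3) \<Rightarrow> complex) set"
  for E :: "'a set" where
  const: "(\<lambda>\<gamma>. c) \<in> poly_functions E"
| coord: "i \<in> E \<Longrightarrow> (\<lambda>\<gamma>. \<gamma> i $ k) \<in> poly_functions E"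
| add: "\<lbrakk>f \<in> poly_functions E; g \<in> poly_functions E\<rbrakk> \<Longrightarrow> (\<lambda>\<gamma>. f \<gamma> + g \<gamma>) \<in> poly_functions E"
| mult: "\<lbrakk>f \<in> poly_functions E; g \<in> poly_functions E\<rbrakk> \<Longrightarrow> (\<lambda>\<gamma>. f \<gamma> * g \<gamma>) \<in> poly_functions E"

definition zariski_closed :: "'a set \<Rightarrow> ('a \<Rightarrow> complex ^ 3) set \<Rightarrow> bool" where
  "zariski_closed E Z \<longleftrightarrow>
     (\<exists>F\<subseteq>poly_functions E. Z = {\<gamma> \<in> config_space E. \<forall>f\<in>F. f \<gamma> = 0})"

definition zariski_closure :: "'a set \<Rightarrow> ('a \<Rightarrow> complex ^ 3) set \<Rightarrow> ('a \<Rightarrow> complex ^ 3) set" where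
  "zariski_closure E A = zariski_closed E hull A"

definition zariski_irreducible :: "'a set \<Rightarrow> ('a \<Rightarrow> complex ^ 3) set \<Rightarrow> bool" where
  "zariski_irreducible E Z \<longleftrightarrow>
     Z \<noteq> {} \<and> Z \<subseteq> config_space E \<and>
     (\<forall>A B. zariski_closed E A \<and> zariski_closed E B \<and> Z \<subseteq> A \<union> B \<longrightarrow> Z \<subseteq> A \<or> Z \<subseteq> B)"

definition irreducible_components ::
  "'a set \<Rightarrow> ('a \<Rightarrow> complex ^ 3) set \<Rightarrow> ('a \<Rightarrow> complex ^ 3) set set" where
  "irreducible_components E V =
     {Z. Z \<subseteq> V \<and> zariski_irreducible E Z \<and>
         (\<forall>Z'. Z' \<subseteq> V \<and> zariski_irreducible E Z' \<and> Z \<subseteq> Z' \<longrightarrow> Z' = Z)}"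


section \<open>Matroid varieties and circuit varieties\<close>

text \<open>
  Linear dependence over \<open>\<complex>\<close> of the family indexed by \<open>S\<close>, not of its set of values: a family
  with a repeated vector is dependent.
\<close>

definition family_dependent :: "('a \<Rightarrow> complex ^ 3) \<Rightarrow> 'a set \<Rightarrow> bool" where
  "family_dependent \<gamma> S \<longleftrightarrow> \<not> (inj_on \<gamma> S \<and> vec.independent (\<gamma> ` S))"

definition realizations :: "'a set_system \<Rightarrow> ('a \<Rightarrow> complex ^ 3) set" where
  "realizations N =
     {\<gamma> \<in> config_space (ground N).
        \<forall>S\<subseteq>ground N. S \<in> dependent_sets N \<longleftrightarrow> family_dependent \<gamma> S}"

definition matroid_variety :: "'a set_system \<Rightarrow> ('a \<Rightarrow> complex ^ 3) set" where
  "matroid_variety N = zariski_closure (ground N) (realizations N)"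

definition circuit_variety :: "'a set_system \<Rightarrow> ('a \<Rightarrow> complex ^ 3) set" where
  "circuit_variety N =
     {\<gamma> \<in> config_space (ground N). \<forall>S\<in>dependent_sets N. family_dependent \<gamma> S}"

end

theory Submission
  imports Defs "HOL-Computational_Algebra.Polynomial"
begin

text \<open>
  Encode points and lines as vertices of the incidence graph and attach to every vertex a nonzero
  vector of $\mathbb{C}^3$, the vector of a line being a normal of a plane containing its points.
  Incidence becomes orthogonality for the bilinear dot product, which is symmetric in points and
  lines. The incidence graph of a cactus configuration is a cactus graph without short cycles, and
  the orthogonal assignments on such a graph form an irreducible set: attaching a leaf is a bundle
  with linear fibres, and when a cycle is closed the assignments are covered, up to closure, by two
  intersecting irreducible open sets. The same induction produces assignments without accidental
  dependencies.

  Deleting vertices leaves a cactus graph, so for every set \<open>J\<close> of points the members of the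
  circuit variety that vanish exactly on \<open>J\<close> form an irreducible set, in which the
  realizations of $M(J)$ are a nonempty open subset. A vector that vanishes at a point on at most
  two lines can be moved off zero inside the circuit variety. Hence the closures of these
  sets for \<open>J\<close> contained in the multiple points already cover the circuit variety.
\<close>

section \<open>Vectors in complex three-space\<close>

text \<open>The obstacle is that fibre dimensions jump. Two independent neighbours determine a
  vector up to scale, two dependent ones leave a plane of choices, and over that degenerate locus a
  new component could appear. A vertex that closes a cycle can therefore not simply be added over an
  irreducible base. What helps is that a cycle offers two adjacent vertices of degree two: where the
  fibre of one jumps, the other may still lie over the good part of its base, and where both jump,
  one of them has enough freedom to move out of the bad locus.

  Four-cycles must be absent from the graph: two points on two common lines have dependent vectors
  or dependent normals, so no generic assignment could exist.

  The dot product is bilinear and not Hermitian in order to keep all conditions polynomial; the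
  price is isotropic vectors. Normals are required to be nonzero because a zero normal would impose
  no condition on the points of its line. They need not be unique: forgetting them is a polynomial
  map, and the image of an irreducible set is irreducible.\<close>

definition cdot :: "complex ^ 3 \<Rightarrow> complex ^ 3 \<Rightarrow> complex" where
  "cdot x y = x $ 1 * y $ 1 + x $ 2 * y $ 2 + x $ 3 * y $ 3"

definition ccross :: "complex ^ 3 \<Rightarrow> complex ^ 3 \<Rightarrow> complex ^ 3" where
  "ccross x y = vector [x $ 2 * y $ 3 - x $ 3 * y $ 2,
                        x $ 3 * y $ 1 - x $ 1 * y $ 3,
                        x $ 1 * y $ 2 - x $ 2 * y $ 1]"

definition det3 :: "complex ^ 3 \<Rightarrow> complex ^ 3 \<Rightarrow> complex ^ 3 \<Rightarrow> complex" where
  "det3 x y z = cdot x (ccross y z)"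

lemmas vec3_simps = cdot_def ccross_def det3_def vec_eq_iff forall_3

lemma cdot_commute: "cdot x y = cdot y x"
  by (simp add: cdot_def algebra_simps)

lemma cdot_zero [simp]: "cdot 0 y = 0" "cdot y 0 = 0"
  by (simp_all add: cdot_def)

lemma cdot_add: "cdot (x + y) z = cdot x z + cdot y z"
  by (simp add: cdot_def algebra_simps)

lemma cdot_scale: "cdot (c *s x) y = c * cdot x y" "cdot x (c *s y) = c * cdot x y"
  by (simp_all add: cdot_def algebra_simps)

lemma ccross_zero [simp]: "ccross 0 y = 0" "ccross y 0 = 0" "ccross x x = 0"
  by (simp_all add: vec3_simps)

lemma ccross_add: "ccross (x + y) z = ccross x z + ccross y z"
  by (simp add: vec3_simps algebra_simps)

lemma ccross_scale: "ccross (c *s x) y = c *s ccross x y" "ccross x (c *s y) = c *s ccross x y"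
  by (simp_all add: vec3_simps algebra_simps)

lemma ccross_skew: "ccross y x = - ccross x y"
  by (simp add: vec3_simps algebra_simps)

lemma ccross_eq_0_commute: "ccross y x = 0 \<longleftrightarrow> ccross x y = 0"
  by (simp add: ccross_skew[of y x])

lemma cdot_ccross [simp]:
  "cdot x (ccross x y) = 0" "cdot y (ccross x y) = 0"
  "cdot (ccross x y) x = 0" "cdot (ccross x y) y = 0"
  by (simp_all add: vec3_simps algebra_simps)

lemma ccross_ccross: "ccross x (ccross y z) = cdot x z *s y - cdot x y *s z"
  by (simp add: vec3_simps algebra_simps)

lemma det3_rotate: "det3 y z x = det3 x y z"
  by (simp add: vec3_simps algebra_simps)

lemma det3_zero [simp]: "det3 0 y z = 0" "det3 x 0 z = 0" "det3 x y 0 = 0"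
  "det3 x x z = 0" "det3 x y y = 0" "det3 x y x = 0"
  by (simp_all add: vec3_simps algebra_simps)

text \<open>Cramer's rule as a polynomial identity among four vectors; a nonzero coefficient on the
  left expresses \<open>z\<close> in the basis \<open>x\<close>, \<open>y\<close>,
  \<open>u\<close>.\<close>

lemma cramer:
  "det3 x y u *s z = det3 z y u *s x + det3 x z u *s y + det3 x y z *s u"
  by (simp add: vec3_simps algebra_simps)

lemma cdot_nondegenerate:
  assumes "x \<noteq> 0"
  obtains u where "cdot u x = 1"
proof -
  obtain k where k: "x $ k \<noteq> 0"
    using assms by (auto simp: vec_eq_iff)
  \<comment> \<open>\<open>x\<close> may be isotropic, so a multiple of \<open>x\<close> itself need
    not work; a scaled coordinate vector does.\<close>
  have "cdot (axis k (1 / x $ k)) x = 1"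
    using k exhaust_3[of k] by (auto simp: cdot_def axis_def)
  then show ?thesis using that by blast
qed

text \<open>A dual vector \<open>u\<close> with \<open>cdot u x = 1\<close> turns the triple product
  identity into the scalar \<open>cdot u y\<close>.\<close>

lemma parallel_scale:
  assumes "ccross x y = 0" "x \<noteq> 0"
  obtains c where "y = c *s x"
proof -
  obtain u where u: "cdot u x = 1" using cdot_nondegenerate[OF assms(2)] by blast
  have "ccross u (ccross x y) = cdot u y *s x - cdot u x *s y"
    by (rule ccross_ccross)
  then have "y = cdot u y *s x" using u assms(1) by simp
  then show ?thesis using that by blast
qed

text \<open>A cross product stays orthogonal to its first factor when that factor varies and the
  other one is fixed. This form therefore gives a polynomial section through any orthogonal
  vector.\<close>

lemma orthogonal_ccross:
  assumes "y \<noteq> 0" "cdot x y = 0"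
  obtains w where "x = ccross y w"
proof -
  obtain u where u: "cdot u y = 1" using cdot_nondegenerate[OF assms(1)] by blast
  have "ccross y (ccross x u) = cdot y u *s x - cdot y x *s u"
    by (rule ccross_ccross)
  then have "x = ccross y (ccross x u)" using u assms(2) by (simp add: cdot_commute)
  then show ?thesis using that by blast
qed

lemma orthogonal_both_scale:
  assumes "ccross a b \<noteq> 0" "cdot x a = 0" "cdot x b = 0"
  obtains c where "x = c *s ccross a b"
proof -
  have "ccross x (ccross a b) = 0"
    using assms(2,3) by (simp add: ccross_ccross)
  then have "ccross (ccross a b) x = 0" by (simp add: ccross_eq_0_commute)
  then show ?thesis using parallel_scale[OF _ assms(1)] that by blast
qed

lemma orthogonal_not_orthogonal:
  assumes "ccross y n \<noteq> 0"
  obtains s where "cdot s y = 0" "cdot s n \<noteq> 0"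
proof -
  obtain u where u: "cdot u (ccross y n) = 1" using cdot_nondegenerate[OF assms] by blast
  have "cdot (ccross y u) n = - cdot u (ccross y n)"
    by (simp add: vec3_simps algebra_simps)
  then show ?thesis using that[of "ccross y u"] u by simp
qed

lemma det3_nondegenerate:
  assumes "y \<noteq> 0"
  obtains v w where "det3 y v w \<noteq> 0"
proof -
  have "\<exists>v w. det3 y v w \<noteq> 0"
  proof (rule ccontr)
    assume "\<not> ?thesis"
    then have "det3 y v w = 0" for v w by blast
    from this[of "axis 1 1" "axis 2 1"] this[of "axis 2 1" "axis 3 1"] this[of "axis 3 1" "axis 1 1"]
    show False using assms by (auto simp: vec3_simps axis_def)
  qed
  then show ?thesis using that by blast
qed

text \<open>The orthogonal complement of \<open>y\<close> has dimension at least two, so the line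
  spanned by \<open>a\<close> cannot contain it.\<close>

lemma orthogonal_not_parallel:
  assumes "a \<noteq> 0"
  obtains s where "cdot s y = 0" "ccross s a \<noteq> 0"
proof -
  obtain s t where st: "cdot s y = 0" "cdot t y = 0" "ccross s t \<noteq> 0"
  proof (cases "y = 0")
    case True
    obtain v w where "det3 a v w \<noteq> 0" using det3_nondegenerate[OF assms] by blast
    then have "ccross v w \<noteq> 0" by (auto simp: det3_def)
    then show ?thesis using that[of v w] True by simp
  next
    case False
    obtain v w where vw: "det3 y v w \<noteq> 0" using det3_nondegenerate[OF False] by blast
    have "ccross (ccross y v) (ccross y w) = det3 y v w *s y"
      by (simp add: vec3_simps algebra_simps)
    then show ?thesis using that[of "ccross y v" "ccross y w"] vw False by simp
  qed
  show ?thesis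
  proof (rule ccontr)
    assume "\<not> ?thesis"
    then have "ccross a s = 0" "ccross a t = 0"
      using that st ccross_eq_0_commute by metis+
    then obtain c d where "s = c *s a" "t = d *s a"
      using parallel_scale[OF _ assms] by metis
    then show False using st(3) by (simp add: ccross_scale)
  qed
qed

text \<open>Two linear conditions on three coordinates. The cross product solves them unless it is
  zero, hence the cases.\<close>

lemma exists_orthogonal_both: "\<exists>s. s \<noteq> 0 \<and> cdot s a = 0 \<and> cdot s b = 0"
proof (cases "a = 0")
  case True
  obtain s where "cdot s b = 0" "ccross s (axis 1 1) \<noteq> 0"
    by (rule orthogonal_not_parallel[of "axis 1 1" b]) (auto simp: vec_eq_iff axis_def)
  then show ?thesis using True by (auto intro!: exI[of _ s])
next
  case a: False
  show ?thesis
  proof (cases "ccross a b = 0")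
    case True
    then obtain c where c: "b = c *s a" using parallel_scale a by blast
    obtain s where "cdot s a = 0" "ccross s a \<noteq> 0" using orthogonal_not_parallel[OF a] by blast
    then show ?thesis using c by (auto simp: cdot_scale intro!: exI[of _ s])
  next
    case False
    then show ?thesis by (intro exI[of _ "ccross a b"]) simp
  qed
qed

text \<open>Vanishing determinants bound the rank of \<open>A\<close> by two. The cases are rank
  two, where a cross product is a normal, then rank one and rank zero.\<close>

lemma exists_normal:
  assumes "\<And>x y z. x \<in> A \<Longrightarrow> y \<in> A \<Longrightarrow> z \<in> A \<Longrightarrow> det3 x y z = 0"
  obtains n where "n \<noteq> 0" "\<And>x. x \<in> A \<Longrightarrow> cdot x n = 0"
proof (cases "\<exists>x\<in>A. \<exists>y\<in>A. ccross x y \<noteq> 0")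
  case True
  then obtain x y where xy: "x \<in> A" "y \<in> A" "ccross x y \<noteq> 0" by blast
  have "cdot z (ccross x y) = 0" if "z \<in> A" for z
    using assms[OF that xy(1,2)] by (simp add: det3_def)
  then show ?thesis using that xy by blast
next
  case par: False
  show ?thesis
  proof (cases "\<exists>x\<in>A. x \<noteq> 0")
    case True
    then obtain x where x: "x \<in> A" "x \<noteq> 0" by blast
    obtain n where n: "n \<noteq> 0" "cdot n x = 0" using exists_orthogonal_both by blast
    have "cdot z n = 0" if "z \<in> A" for z
    proof -
      have "ccross x z = 0" using par x(1) that by blast
      then obtain c where "z = c *s x" using parallel_scale x(2) by blast
      then show ?thesis using n by (simp add: cdot_scale cdot_commute)
    qed
    then show ?thesis using that n by blast
  next
    case False
    obtain n where n: "n \<noteq> 0" "cdot n 0 = 0" using exists_orthogonal_both by blast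
    then show ?thesis using that[of n] False by fastforce
  qed
qed

text \<open>If \<open>y\<close> and \<open>z\<close> are independent, \<open>n\<close> is a nonzero
  multiple of their cross product, so orthogonality of \<open>x\<close> to \<open>n\<close> is the
  vanishing of the determinant.\<close>

lemma det3_eq_0_if_orthogonal:
  assumes "n \<noteq> 0" "cdot x n = 0" "cdot y n = 0" "cdot z n = 0"
  shows "det3 x y z = 0"
proof (cases "ccross y z = 0")
  case True
  then show ?thesis by (simp add: det3_def)
next
  case False
  obtain c where c: "n = c *s ccross y z"
    using orthogonal_both_scale[OF False, of n] assms by (auto simp: cdot_commute)
  then show ?thesis using assms(1,2) by (auto simp: det3_def cdot_scale)
qed


section \<open>Dependent families of at most three vectors\<close>

text \<open>Coefficients are indexed by \<open>S\<close> and not by values, so that a repeated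
  vector gives the relation with coefficients 1 and -1.\<close>

lemma family_dependent_iff:
  assumes "finite S"
  shows "family_dependent \<gamma> S \<longleftrightarrow> (\<exists>u. (\<Sum>i\<in>S. u i *s \<gamma> i) = 0 \<and> (\<exists>i\<in>S. u i \<noteq> 0))"
proof
  assume *: "family_dependent \<gamma> S"
  show "\<exists>u. (\<Sum>i\<in>S. u i *s \<gamma> i) = 0 \<and> (\<exists>i\<in>S. u i \<noteq> 0)"
  proof (cases "inj_on \<gamma> S")
    case True
    then have "vec.dependent (\<gamma> ` S)" using * by (simp add: family_dependent_def)
    then obtain c where c: "(\<Sum>v\<in>\<gamma> ` S. c v *s v) = 0" "\<exists>v\<in>\<gamma> ` S. c v \<noteq> 0"
      using vec.dependent_finite[of "\<gamma> ` S"] assms by auto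
    have "(\<Sum>i\<in>S. c (\<gamma> i) *s \<gamma> i) = 0"
      using c(1) by (simp add: sum.reindex[OF True])
    then show ?thesis using c(2) by (intro exI[of _ "\<lambda>i. c (\<gamma> i)"]) auto
  next
    case False
    then obtain i j where ij: "i \<in> S" "j \<in> S" "i \<noteq> j" "\<gamma> i = \<gamma> j" by (auto simp: inj_on_def)
    define u :: "_ \<Rightarrow> complex" where "u = (\<lambda>k. if k = i then 1 else if k = j then - 1 else 0)"
    have "(\<Sum>k\<in>S. u k *s \<gamma> k) = (\<Sum>k\<in>{i,j}. u k *s \<gamma> k)"
      using ij assms by (intro sum.mono_neutral_right) (auto simp: u_def)
    also have "\<dots> = 0" using ij by (simp add: u_def)
    finally show ?thesis using ij by (intro exI[of _ u]) (auto simp: u_def)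
  qed
next
  assume "\<exists>u. (\<Sum>i\<in>S. u i *s \<gamma> i) = 0 \<and> (\<exists>i\<in>S. u i \<noteq> 0)"
  then obtain u where u: "(\<Sum>i\<in>S. u i *s \<gamma> i) = 0" "\<exists>i\<in>S. u i \<noteq> 0" by blast
  have "vec.dependent (\<gamma> ` S)" if inj: "inj_on \<gamma> S"
  proof -
    define c where "c = (\<lambda>v. u (the_inv_into S \<gamma> v))"
    have "(\<Sum>v\<in>\<gamma> ` S. c v *s v) = (\<Sum>i\<in>S. u i *s \<gamma> i)"
      by (simp add: sum.reindex[OF inj] c_def the_inv_into_f_f[OF inj])
    moreover have "\<exists>v\<in>\<gamma> ` S. c v \<noteq> 0"
      using u(2) by (auto simp: c_def the_inv_into_f_f[OF inj])
    ultimately show ?thesis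
      using vec.dependent_finite[of "\<gamma> ` S"] assms u(1) by auto
  qed
  then show "family_dependent \<gamma> S" by (auto simp: family_dependent_def)
qed

lemma family_dependent_mono:
  assumes "family_dependent \<gamma> S" "S \<subseteq> T"
  shows "family_dependent \<gamma> T"
  using assms vec.dependent_mono[of "\<gamma> ` S" "\<gamma> ` T"] inj_on_subset[of \<gamma> T S]
  by (auto simp: family_dependent_def)

lemma family_dependent_empty [simp]: "\<not> family_dependent \<gamma> {}"
  by (simp add: family_dependent_iff)

lemma family_dependent_singleton: "family_dependent \<gamma> {a} \<longleftrightarrow> \<gamma> a = 0"
  by (simp add: family_dependent_def)

lemma family_dependent_triple:
  assumes "a \<noteq> b" "a \<noteq> c" "b \<noteq> c"
  shows "family_dependent \<gamma> {a, b, c} \<longleftrightarrow> det3 (\<gamma> a) (\<gamma> b) (\<gamma> c) = 0"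
proof
  assume "family_dependent \<gamma> {a, b, c}"
  then obtain u where u: "u a *s \<gamma> a + u b *s \<gamma> b + u c *s \<gamma> c = 0" "u a \<noteq> 0 \<or> u b \<noteq> 0 \<or> u c \<noteq> 0"
  proof -
    obtain u where "(\<Sum>i\<in>{a, b, c}. u i *s \<gamma> i) = 0" "\<exists>i\<in>{a, b, c}. u i \<noteq> 0"
      using \<open>family_dependent \<gamma> {a, b, c}\<close> family_dependent_iff[of "{a, b, c}" \<gamma>] by auto
    then show ?thesis using assms that by (auto simp: add.assoc)
  qed
  let ?d = "det3 (\<gamma> a) (\<gamma> b) (\<gamma> c)"
  \<comment> \<open>Pairing a relation with the cross product of two of the vectors leaves the third
    coefficient times the determinant.\<close>
  have "u a * ?d = cdot (u a *s \<gamma> a + u b *s \<gamma> b + u c *s \<gamma> c) (ccross (\<gamma> b) (\<gamma> c))"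
    by (simp add: cdot_add cdot_scale det3_def)
  moreover have "u b * ?d = cdot (u a *s \<gamma> a + u b *s \<gamma> b + u c *s \<gamma> c) (ccross (\<gamma> c) (\<gamma> a))"
    by (simp add: cdot_add cdot_scale) (simp add: vec3_simps algebra_simps)
  moreover have "u c * ?d = cdot (u a *s \<gamma> a + u b *s \<gamma> b + u c *s \<gamma> c) (ccross (\<gamma> a) (\<gamma> b))"
    by (simp add: cdot_add cdot_scale) (simp add: vec3_simps algebra_simps)
  ultimately show "?d = 0" using u by auto
next
  assume d: "det3 (\<gamma> a) (\<gamma> b) (\<gamma> c) = 0"
  have dep: "family_dependent \<gamma> {a, b, c}"
    if "r *s \<gamma> a + s *s \<gamma> b + t *s \<gamma> c = 0" "r \<noteq> 0 \<or> s \<noteq> 0 \<or> t \<noteq> 0" for r s t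
  proof -
    define u where "u = (\<lambda>i. if i = a then r else if i = b then s else t)"
    have "u a = r" "u b = s" "u c = t" using assms by (auto simp: u_def)
    then have "(\<Sum>i\<in>{a, b, c}. u i *s \<gamma> i) = 0" "\<exists>i\<in>{a, b, c}. u i \<noteq> 0"
      using assms that by (simp_all add: add.assoc)
    then show ?thesis by (subst family_dependent_iff) auto
  qed
  show "family_dependent \<gamma> {a, b, c}"
  proof (cases "ccross (\<gamma> a) (\<gamma> b) = 0")
    case True
    show ?thesis
    proof (cases "\<gamma> a = 0")
      case True
      then show ?thesis by (intro dep[of 1 0 0]) auto
    next
      case False
      then obtain k where "\<gamma> b = k *s \<gamma> a" using parallel_scale True by blast
      then show ?thesis by (intro dep[of "- k" 1 0]) auto
    qed
  next
    case False
    \<comment> \<open>With this scaling of \<open>u\<close>, Cramer's identity has coefficient 1 at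
      \<open>\<gamma> c\<close>, and its coefficient at \<open>u\<close> is the vanishing
      determinant.\<close>
    then obtain u where "cdot u (ccross (\<gamma> a) (\<gamma> b)) = 1" using cdot_nondegenerate by blast
    then have "det3 (\<gamma> a) (\<gamma> b) u = 1" by (metis det3_def det3_rotate)
    then have "\<gamma> c = det3 (\<gamma> c) (\<gamma> b) u *s \<gamma> a + det3 (\<gamma> a) (\<gamma> c) u *s \<gamma> b"
      using cramer[of "\<gamma> a" "\<gamma> b" u "\<gamma> c"] d by simp
    then show ?thesis
      by (intro dep[of "det3 (\<gamma> c) (\<gamma> b) u" "det3 (\<gamma> a) (\<gamma> c) u" "- 1"]) auto
  qed
qed

lemma family_dependent_pair:
  assumes "a \<noteq> b"
  shows "family_dependent \<gamma> {a, b} \<longleftrightarrow> ccross (\<gamma> a) (\<gamma> b) = 0"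
proof
  assume "family_dependent \<gamma> {a, b}"
  then obtain u where u: "u a *s \<gamma> a + u b *s \<gamma> b = 0" "u a \<noteq> 0 \<or> u b \<noteq> 0"
    using assms by (auto simp: family_dependent_iff)
  have "u a *s ccross (\<gamma> a) (\<gamma> b) = ccross (u a *s \<gamma> a + u b *s \<gamma> b) (\<gamma> b)"
    by (simp add: ccross_add ccross_scale)
  moreover have "u b *s ccross (\<gamma> b) (\<gamma> a) = ccross (u a *s \<gamma> a + u b *s \<gamma> b) (\<gamma> a)"
    by (simp add: ccross_add ccross_scale)
  ultimately show "ccross (\<gamma> a) (\<gamma> b) = 0" using u by (auto simp: ccross_eq_0_commute)
next
  assume cross: "ccross (\<gamma> a) (\<gamma> b) = 0"
  show "family_dependent \<gamma> {a, b}"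
  proof (cases "\<gamma> a = 0")
    case True
    then show ?thesis
      using family_dependent_mono[of \<gamma> "{a}" "{a, b}"] by (simp add: family_dependent_singleton)
  next
    case False
    then obtain k where k: "\<gamma> b = k *s \<gamma> a" using parallel_scale cross by blast
    define u where "u = (\<lambda>i. if i = a then - k else 1)"
    have "(\<Sum>i\<in>{a, b}. u i *s \<gamma> i) = 0" "\<exists>i\<in>{a, b}. u i \<noteq> 0"
      using assms k by (simp_all add: u_def)
    then show ?thesis by (subst family_dependent_iff) auto
  qed
qed

lemma family_dependent_card_gt_3:
  assumes "finite S" "3 < card S"
  shows "family_dependent \<gamma> S"
proof (rule ccontr)
  assume "\<not> ?thesis"
  then have inj: "inj_on \<gamma> S" and ind: "vec.independent (\<gamma> ` S)"
    by (auto simp: family_dependent_def)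
  have "card (\<gamma> ` S) \<le> vec.dim (UNIV :: (complex ^ 3) set)"
    using vec.independent_card_le_dim[OF subset_UNIV ind] .
  then show False using assms card_image[OF inj] by (simp add: card_cart_basis)
qed

section \<open>Irreducible sets of families\<close>

lemma poly_functions_diff:
  assumes "f \<in> poly_functions E" "g \<in> poly_functions E"
  shows "(\<lambda>v. f v - g v) \<in> poly_functions E"
  using poly_functions.add[OF assms(1) poly_functions.mult[OF poly_functions.const[of "- 1"] assms(2)]]
  by simp

lemma poly_functions_subst:
  assumes "f \<in> poly_functions E'"
    and "\<And>i k. i \<in> E' \<Longrightarrow> (\<lambda>v. \<phi> v i $ k) \<in> poly_functions E"
  shows "(\<lambda>v. f (\<phi> v)) \<in> poly_functions E"
  using assms(1) by induction (use assms(2) in \<open>auto intro: poly_functions.intros\<close>)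

text \<open>Restriction to a line reduces statements in many variables to the roots of one
  polynomial in \<open>t\<close>.\<close>

lemma poly_functions_line:
  assumes "f \<in> poly_functions E"
  obtains p where "\<And>t. f (\<lambda>i. v i + t *s u i) = poly p t"
proof -
  have "\<exists>p. \<forall>t. f (\<lambda>i. v i + t *s u i) = poly p t"
    using assms
  proof induction
    case (const c)
    show ?case by (intro exI[of _ "[:c:]"]) simp
  next
    case (coord i k)
    show ?case by (intro exI[of _ "[:v i $ k, u i $ k:]"]) simp
  next
    case (add f g)
    then obtain p q where "\<forall>t. f (\<lambda>i. v i + t *s u i) = poly p t" "\<forall>t. g (\<lambda>i. v i + t *s u i) = poly q t"
      by blast
    then show ?case by (intro exI[of _ "p + q"]) simp
  next
    case (mult f g)
    then obtain p q where "\<forall>t. f (\<lambda>i. v i + t *s u i) = poly p t" "\<forall>t. g (\<lambda>i. v i + t *s u i) = poly q t"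
      by blast
    then show ?case by (intro exI[of _ "p * q"]) simp
  qed
  then show ?thesis using that by blast
qed

lemma poly_cofinite_nonzero:
  fixes p :: "complex poly"
  assumes "poly p a \<noteq> 0" "finite B"
  obtains t where "t \<notin> B" "poly p t \<noteq> 0"
proof -
  have "p \<noteq> 0" using assms(1) by auto
  then have "finite {t. poly p t = 0}" by (rule poly_roots_finite)
  then have "finite (B \<union> {t. poly p t = 0})" using assms(2) by simp
  then have "B \<union> {t. poly p t = 0} \<noteq> UNIV" using infinite_UNIV_char_0 by metis
  then show ?thesis using that by blast
qed

text \<open>Irreducibility as primality of the vanishing ideal, in contrapositive form.\<close>

definition irred :: "'a set \<Rightarrow> ('a \<Rightarrow> complex ^ 3) set \<Rightarrow> bool" where
  "irred E A \<longleftrightarrow> A \<noteq> {} \<and>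
     (\<forall>f\<in>poly_functions E. \<forall>g\<in>poly_functions E.
        (\<exists>v\<in>A. f v \<noteq> 0) \<and> (\<exists>v\<in>A. g v \<noteq> 0) \<longrightarrow> (\<exists>v\<in>A. f v \<noteq> 0 \<and> g v \<noteq> 0))"

text \<open>A Zariski closure taken among all functions, not only those in
  \<open>config_space E\<close>. Polynomial functions on \<open>E\<close> do not see values outside
  \<open>E\<close>, so families need not be extensional here.\<close>

definition zero_locus_hull :: "'a set \<Rightarrow> ('a \<Rightarrow> complex ^ 3) set \<Rightarrow> ('a \<Rightarrow> complex ^ 3) set" where
  "zero_locus_hull E A = {v. \<forall>f\<in>poly_functions E. (\<forall>a\<in>A. f a = 0) \<longrightarrow> f v = 0}"

text \<open>A set \<open>H\<close> of functions is allowed because a vector is nonzero as soon as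
  one coordinate is, which gives a union of principal open sets.\<close>

definition poly_open :: "'a set \<Rightarrow> (('a \<Rightarrow> complex ^ 3) \<Rightarrow> bool) \<Rightarrow> bool" where
  "poly_open E P \<longleftrightarrow> (\<exists>H\<subseteq>poly_functions E. \<forall>v. P v \<longleftrightarrow> (\<exists>h\<in>H. h v \<noteq> 0))"

lemma poly_openI: "h \<in> poly_functions E \<Longrightarrow> poly_open E (\<lambda>v. h v \<noteq> 0)"
  unfolding poly_open_def by (intro exI[of _ "{h}"]) auto

lemma poly_open_vec:
  assumes "\<And>k. (\<lambda>v. \<sigma> v $ k) \<in> poly_functions E"
  shows "poly_open E (\<lambda>v. \<sigma> v \<noteq> 0)"
  unfolding poly_open_def
  by (intro exI[of _ "range (\<lambda>k v. \<sigma> v $ k)"]) (use assms in \<open>auto simp: vec_eq_iff\<close>)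

lemma irred_nonempty: "irred E A \<Longrightarrow> A \<noteq> {}"
  by (simp add: irred_def)

lemma irredD:
  assumes "irred E A" "f \<in> poly_functions E" "g \<in> poly_functions E"
    "v \<in> A" "f v \<noteq> 0" "w \<in> A" "g w \<noteq> 0"
  obtains u where "u \<in> A" "f u \<noteq> 0" "g u \<noteq> 0"
  using assms unfolding irred_def by blast

lemma subset_zero_locus_hull: "A \<subseteq> zero_locus_hull E A"
  by (auto simp: zero_locus_hull_def)

lemma zero_locus_hull_minimal: "A \<subseteq> zero_locus_hull E B \<Longrightarrow> zero_locus_hull E A \<subseteq> zero_locus_hull E B"
  unfolding zero_locus_hull_def by blast

text \<open>A polynomial that vanishes at every nonzero \<open>t\<close> vanishes at 0 as well. This
  is the algebraic form of passing to a limit in the degeneration arguments.\<close>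

lemma zero_locus_hull_line:
  assumes "\<And>t. t \<noteq> 0 \<Longrightarrow> (\<lambda>i. v i + t *s u i) \<in> zero_locus_hull E A"
  shows "v \<in> zero_locus_hull E A"
  unfolding zero_locus_hull_def
proof safe
  fix f assume f: "f \<in> poly_functions E" "\<forall>a\<in>A. f a = 0"
  obtain p where p: "\<And>t. f (\<lambda>i. v i + t *s u i) = poly p t"
    using poly_functions_line[OF f(1)] by blast
  have "poly p t = 0" if "t \<noteq> 0" for t
    using assms[OF that] f p[of t] by (auto simp: zero_locus_hull_def)
  then have "poly p 0 = 0"
    using poly_cofinite_nonzero[of p 0 "{0}"] by (metis finite.emptyI finite_insert singletonI)
  then show "f v = 0" using p[of 0] by simp
qed

lemma irred_dense:
  assumes "irred E A" "A \<subseteq> B" "B \<subseteq> zero_locus_hull E A"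
  shows "irred E B"
  unfolding irred_def
proof (intro conjI ballI impI)
  show "B \<noteq> {}" using assms(2) irred_nonempty[OF assms(1)] by auto
next
  fix f g assume fg: "f \<in> poly_functions E" "g \<in> poly_functions E"
    and "(\<exists>v\<in>B. f v \<noteq> 0) \<and> (\<exists>v\<in>B. g v \<noteq> 0)"
  then have "\<exists>v\<in>A. f v \<noteq> 0" "\<exists>v\<in>A. g v \<noteq> 0"
    using assms(3) unfolding zero_locus_hull_def by blast+
  then have "\<exists>v\<in>A. f v \<noteq> 0 \<and> g v \<noteq> 0" using assms(1) fg unfolding irred_def by blast
  then show "\<exists>v\<in>B. f v \<noteq> 0 \<and> g v \<noteq> 0" using assms(2) by blast
qed

lemma open_dense:
  assumes "irred E A" "poly_open E P" "\<exists>v\<in>A. P v"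
  shows "A \<subseteq> zero_locus_hull E {v \<in> A. P v}"
proof
  fix v assume v: "v \<in> A"
  obtain H where H: "H \<subseteq> poly_functions E" "\<And>v. P v \<longleftrightarrow> (\<exists>h\<in>H. h v \<noteq> 0)"
    using assms(2) unfolding poly_open_def by blast
  obtain h w where h: "h \<in> H" "w \<in> A" "h w \<noteq> 0" using H(2) assms(3) by blast
  show "v \<in> zero_locus_hull E {v \<in> A. P v}"
    unfolding zero_locus_hull_def
  proof safe
    fix f assume f: "f \<in> poly_functions E" "\<forall>a\<in>{v \<in> A. P v}. f a = 0"
    show "f v = 0"
    proof (rule ccontr)
      assume "f v \<noteq> 0"
      then obtain u where "u \<in> A" "f u \<noteq> 0" "h u \<noteq> 0"
        using irredD[OF assms(1) f(1), of h v w] v h H(1) by blast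
      then show False using f(2) H(2) h(1) by blast
    qed
  qed
qed

lemma irred_open:
  assumes "irred E A" "poly_open E P" "\<exists>v\<in>A. P v"
  shows "irred E {v \<in> A. P v}"
  unfolding irred_def
proof (intro conjI ballI impI)
  show "{v \<in> A. P v} \<noteq> {}" using assms(3) by blast
next
  fix f g assume fg: "f \<in> poly_functions E" "g \<in> poly_functions E"
    and *: "(\<exists>v\<in>{v \<in> A. P v}. f v \<noteq> 0) \<and> (\<exists>v\<in>{v \<in> A. P v}. g v \<noteq> 0)"
  obtain H where H: "H \<subseteq> poly_functions E" "\<And>v. P v \<longleftrightarrow> (\<exists>h\<in>H. h v \<noteq> 0)"
    using assms(2) unfolding poly_open_def by blast
  obtain h w where h: "h \<in> H" "w \<in> A" "h w \<noteq> 0" using H(2) assms(3) by blast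
  then have hp: "h \<in> poly_functions E" using H(1) by blast
  obtain u where u: "u \<in> A" "f u \<noteq> 0" "g u \<noteq> 0" using irredD[OF assms(1) fg] * by blast
  \<comment> \<open>The product \<open>f * g\<close> counts as one function, so the form of
    irreducibility for two functions also handles the third.\<close>
  obtain x where "x \<in> A" "f x * g x \<noteq> 0" "h x \<noteq> 0"
    using irredD[OF assms(1) poly_functions.mult[OF fg] hp u(1) _ h(2,3)] u by auto
  then show "\<exists>v\<in>{v \<in> A. P v}. f v \<noteq> 0 \<and> g v \<noteq> 0" using H(2) h(1) by auto
qed

text \<open>Each condition needs only a witness of its own; irreducibility supplies a common one. In
  the induction, density of the part where \<open>Q\<close> holds keeps the remaining conditions
  satisfiable there.\<close>

lemma irred_finite_open:
  assumes "finite \<P>" "irred E A" "\<And>P. P \<in> \<P> \<Longrightarrow> poly_open E P \<and> (\<exists>v\<in>A. P v)"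
  shows "\<exists>v\<in>A. \<forall>P\<in>\<P>. P v"
  using assms
proof (induction \<P> arbitrary: A rule: finite_induct)
  case empty
  then show ?case using irred_nonempty by blast
next
  case (insert Q \<P>)
  have Q: "poly_open E Q" "\<exists>v\<in>A. Q v" using insert.prems by auto
  have irr: "irred E {v \<in> A. Q v}" using irred_open insert.prems(1) Q .
  have "\<exists>v\<in>{v \<in> A. Q v}. P v" if P: "P \<in> \<P>" for P
  proof -
    have PP: "poly_open E P" "\<exists>v\<in>A. P v" using insert.prems P by auto
    obtain H where H: "H \<subseteq> poly_functions E" "\<And>v. P v \<longleftrightarrow> (\<exists>h\<in>H. h v \<noteq> 0)"
      using PP(1) unfolding poly_open_def by blast
    then obtain h w where h: "h \<in> H" "w \<in> A" "h w \<noteq> 0" using PP(2) by blast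
    show ?thesis
    proof (rule ccontr)
      assume "\<not> ?thesis"
      then have "\<forall>v\<in>{v \<in> A. Q v}. h v = 0" using H(2) h(1) by blast
      then have "h w = 0"
        using open_dense[OF insert.prems(1) Q] h H(1) unfolding zero_locus_hull_def by blast
      then show False using h by simp
    qed
  qed
  then have "\<exists>v\<in>{v \<in> A. Q v}. \<forall>P\<in>\<P>. P v" using insert.IH[OF irr] insert.prems(2) by blast
  then show ?case by auto
qed

lemma open_dense_finite:
  assumes "irred E A" "finite \<P>" "\<And>P. P \<in> \<P> \<Longrightarrow> poly_open E P" "w \<in> A" "\<And>P. P \<in> \<P> \<Longrightarrow> P w"
  shows "A \<subseteq> zero_locus_hull E {v \<in> A. \<forall>P\<in>\<P>. P v}"
proof
  fix v assume v: "v \<in> A"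
  show "v \<in> zero_locus_hull E {v \<in> A. \<forall>P\<in>\<P>. P v}"
    unfolding zero_locus_hull_def
  proof safe
    fix f assume f: "f \<in> poly_functions E" "\<forall>a\<in>{v \<in> A. \<forall>P\<in>\<P>. P v}. f a = 0"
    show "f v = 0"
    proof (rule ccontr)
      assume nz: "f v \<noteq> 0"
      \<comment> \<open>Nonvanishing of \<open>f\<close> joins the given open conditions:
        \<open>v\<close> witnesses the former and \<open>w\<close> the latter.\<close>
      have "\<exists>u\<in>A. \<forall>P\<in>insert (\<lambda>u. f u \<noteq> 0) \<P>. P u"
      proof (rule irred_finite_open[OF _ assms(1)])
        show "finite (insert (\<lambda>u. f u \<noteq> 0) \<P>)" using assms(2) by simp
        fix P assume "P \<in> insert (\<lambda>u. f u \<noteq> 0) \<P>"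
        then consider "P = (\<lambda>u. f u \<noteq> 0)" | "P \<in> \<P>" by blast
        then show "poly_open E P \<and> (\<exists>v\<in>A. P v)"
        proof cases
          case 1
          then show ?thesis using poly_openI[OF f(1)] v nz by blast
        next
          case 2
          then show ?thesis using assms(3-5) by blast
        qed
      qed
      then obtain u where "u \<in> A" "\<forall>P\<in>\<P>. P u" "f u \<noteq> 0" by auto
      then show False using f(2) by blast
    qed
  qed
qed

lemma irred_image:
  assumes "irred E A" "\<And>i k. i \<in> E' \<Longrightarrow> (\<lambda>v. \<phi> v i $ k) \<in> poly_functions E"
  shows "irred E' (\<phi> ` A)"
  unfolding irred_def
proof (intro conjI ballI impI)
  show "\<phi> ` A \<noteq> {}" using irred_nonempty[OF assms(1)] by simp
next
  fix f g assume fg: "f \<in> poly_functions E'" "g \<in> poly_functions E'"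
    and *: "(\<exists>v\<in>\<phi> ` A. f v \<noteq> 0) \<and> (\<exists>v\<in>\<phi> ` A. g v \<noteq> 0)"
  have "(\<lambda>v. f (\<phi> v)) \<in> poly_functions E" "(\<lambda>v. g (\<phi> v)) \<in> poly_functions E"
    using poly_functions_subst assms(2) fg by blast+
  moreover obtain v w where "v \<in> A" "f (\<phi> v) \<noteq> 0" "w \<in> A" "g (\<phi> w) \<noteq> 0" using * by blast
  ultimately obtain u where "u \<in> A" "f (\<phi> u) \<noteq> 0" "g (\<phi> u) \<noteq> 0"
    using irredD[OF assms(1), of "\<lambda>v. f (\<phi> v)" "\<lambda>v. g (\<phi> v)" v w] by blast
  then show "\<exists>v\<in>\<phi> ` A. f v \<noteq> 0 \<and> g v \<noteq> 0" by blast
qed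

text \<open>
  A family of linear spaces over an irreducible base has irreducible total space, provided every
  point of every fibre lies on a polynomial section: two nonvanishing conditions are met
  simultaneously over some base point, and there on the line joining the two sections.
\<close>

lemma irred_extend:
  fixes S :: "('a \<Rightarrow> complex ^ 3) \<Rightarrow> (complex ^ 3) set"
  assumes irr: "irred V A" and x: "x \<notin> V"
    and ne: "\<And>v. v \<in> A \<Longrightarrow> S v \<noteq> {}"
    and lin: "\<And>v s s' t. v \<in> A \<Longrightarrow> s \<in> S v \<Longrightarrow> s' \<in> S v \<Longrightarrow> s + t *s (s' - s) \<in> S v"
    and sect: "\<And>v s. v \<in> A \<Longrightarrow> s \<in> S v \<Longrightarrow>
       \<exists>\<sigma>. \<sigma> v = s \<and> (\<forall>w\<in>A. \<sigma> w \<in> S w) \<and> (\<forall>k. (\<lambda>w. \<sigma> w $ k) \<in> poly_functions V)"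
  shows "irred (insert x V) {v(x := s) | v s. v \<in> A \<and> s \<in> S v}"
  unfolding irred_def
proof (intro conjI ballI impI)
  show "{v(x := s) | v s. v \<in> A \<and> s \<in> S v} \<noteq> {}"
    using irred_nonempty[OF irr] ne by fast
next
  fix f g assume fg: "f \<in> poly_functions (insert x V)" "g \<in> poly_functions (insert x V)"
    and *: "(\<exists>v\<in>{v(x := s) | v s. v \<in> A \<and> s \<in> S v}. f v \<noteq> 0) \<and>
            (\<exists>v\<in>{v(x := s) | v s. v \<in> A \<and> s \<in> S v}. g v \<noteq> 0)"
  obtain v1 s1 where 1: "v1 \<in> A" "s1 \<in> S v1" "f (v1(x := s1)) \<noteq> 0" using * by blast
  obtain v2 s2 where 2: "v2 \<in> A" "s2 \<in> S v2" "g (v2(x := s2)) \<noteq> 0" using * by blast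
  obtain \<sigma> where \<sigma>: "\<sigma> v1 = s1" "\<forall>w\<in>A. \<sigma> w \<in> S w" "\<And>k. (\<lambda>w. \<sigma> w $ k) \<in> poly_functions V"
    using sect[OF 1(1,2)] by blast
  obtain \<tau> where \<tau>: "\<tau> v2 = s2" "\<forall>w\<in>A. \<tau> w \<in> S w" "\<And>k. (\<lambda>w. \<tau> w $ k) \<in> poly_functions V"
    using sect[OF 2(1,2)] by blast
  have sub: "(\<lambda>v. h (v(x := \<rho> v))) \<in> poly_functions V"
    if "h \<in> poly_functions (insert x V)" "\<And>k. (\<lambda>w. \<rho> w $ k) \<in> poly_functions V" for h \<rho>
  proof (rule poly_functions_subst[OF that(1)])
    fix i k assume "i \<in> insert x V"
    then show "(\<lambda>v. (v(x := \<rho> v)) i $ k) \<in> poly_functions V"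
      using that(2) by (cases "i = x") (auto intro: poly_functions.coord)
  qed
  have a: "f (v1(x := \<sigma> v1)) \<noteq> 0" "g (v2(x := \<tau> v2)) \<noteq> 0" using 1 2 \<sigma>(1) \<tau>(1) by auto
  obtain v where v: "v \<in> A" "f (v(x := \<sigma> v)) \<noteq> 0" "g (v(x := \<tau> v)) \<noteq> 0"
    using irredD[OF irr sub[OF fg(1) \<sigma>(3)] sub[OF fg(2) \<tau>(3)], of v1 v2] 1(1) 2(1) a by blast
  define l where "l t = v(x := \<sigma> v + t *s (\<tau> v - \<sigma> v))" for t
  have l: "l t = (\<lambda>i. (v(x := \<sigma> v)) i + t *s (if i = x then \<tau> v - \<sigma> v else 0))" for t
    by (auto simp: l_def)
  obtain p q where p: "\<And>t. f (l t) = poly p t" and q: "\<And>t. g (l t) = poly q t"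
  proof -
    obtain p where "\<And>t. f (l t) = poly p t"
      unfolding l using poly_functions_line[OF fg(1), of "v(x := \<sigma> v)" "\<lambda>i. if i = x then \<tau> v - \<sigma> v else 0"] by blast
    moreover obtain q where "\<And>t. g (l t) = poly q t"
      unfolding l using poly_functions_line[OF fg(2), of "v(x := \<sigma> v)" "\<lambda>i. if i = x then \<tau> v - \<sigma> v else 0"] by blast
    ultimately show ?thesis using that by blast
  qed
  \<comment> \<open>The end points of the segment show that neither \<open>p\<close> nor
    \<open>q\<close> is the zero polynomial, so their product has a nonroot.\<close>
  have "l 0 = v(x := \<sigma> v)" "l 1 = v(x := \<tau> v)" by (auto simp: l_def)
  then have "p \<noteq> 0" "q \<noteq> 0" using v p[of 0] q[of 1] by auto
  then have "p * q \<noteq> 0" by simp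
  then obtain t where "poly (p * q) t \<noteq> 0" using poly_all_0_iff_0 by blast
  then have "f (l t) \<noteq> 0" "g (l t) \<noteq> 0" using p q by auto
  moreover have "l t \<in> {v(x := s) | v s. v \<in> A \<and> s \<in> S v}"
    using lin[OF v(1), of "\<sigma> v" "\<tau> v" t] \<sigma>(2) \<tau>(2) v(1) unfolding l_def by blast
  ultimately show "\<exists>v\<in>{v(x := s) | v s. v \<in> A \<and> s \<in> S v}. f v \<noteq> 0 \<and> g v \<noteq> 0" by blast
qed

lemma poly_functions_cdot:
  assumes "\<And>k. (\<lambda>v. \<sigma> v $ k) \<in> poly_functions E" "\<And>k. (\<lambda>v. \<tau> v $ k) \<in> poly_functions E"
  shows "(\<lambda>v. cdot (\<sigma> v) (\<tau> v)) \<in> poly_functions E"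
  unfolding cdot_def by (intro poly_functions.add poly_functions.mult assms)

lemma poly_functions_ccross:
  assumes "\<And>k. (\<lambda>v. \<sigma> v $ k) \<in> poly_functions E" "\<And>k. (\<lambda>v. \<tau> v $ k) \<in> poly_functions E"
  shows "(\<lambda>v. ccross (\<sigma> v) (\<tau> v) $ k) \<in> poly_functions E"
  using exhaust_3[of k]
  by (auto simp: ccross_def intro!: poly_functions_diff poly_functions.mult assms)

lemma poly_functions_det3:
  assumes "\<And>k. (\<lambda>v. \<rho> v $ k) \<in> poly_functions E" "\<And>k. (\<lambda>v. \<sigma> v $ k) \<in> poly_functions E"
    "\<And>k. (\<lambda>v. \<tau> v $ k) \<in> poly_functions E"
  shows "(\<lambda>v. det3 (\<rho> v) (\<sigma> v) (\<tau> v)) \<in> poly_functions E"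
  unfolding det3_def by (intro poly_functions_cdot poly_functions_ccross assms)

section \<open>Zariski closures, their irreducibility and finite closed covers\<close>

lemma zariski_closure_eq:
  assumes "A \<subseteq> config_space E"
  shows "zariski_closure E A = zero_locus_hull E A \<inter> config_space E"
  unfolding zariski_closure_def
proof (rule hull_unique)
  show "A \<subseteq> zero_locus_hull E A \<inter> config_space E"
    using assms subset_zero_locus_hull by blast
  show "zariski_closed E (zero_locus_hull E A \<inter> config_space E)"
    unfolding zariski_closed_def zero_locus_hull_def
    by (intro exI[of _ "{f \<in> poly_functions E. \<forall>a\<in>A. f a = 0}"]) auto
next
  fix Z assume "A \<subseteq> Z" "zariski_closed E Z"
  then obtain F where F: "F \<subseteq> poly_functions E" "Z = {\<gamma> \<in> config_space E. \<forall>f\<in>F. f \<gamma> = 0}"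
    by (elim conjE zariski_closed_def[THEN iffD1, THEN exE]) auto
  then have "\<forall>f\<in>F. \<forall>a\<in>A. f a = 0" using \<open>A \<subseteq> Z\<close> by blast
  then show "zero_locus_hull E A \<inter> config_space E \<subseteq> Z"
    using F unfolding zero_locus_hull_def by blast
qed

lemma zariski_closed_closure:
  assumes "A \<subseteq> config_space E"
  shows "zariski_closed E (zariski_closure E A)"
  unfolding zariski_closure_eq[OF assms] zariski_closed_def zero_locus_hull_def
  by (intro exI[of _ "{f \<in> poly_functions E. \<forall>a\<in>A. f a = 0}"]) auto

lemma zariski_irreducible_closure:
  assumes "irred E A" "A \<subseteq> config_space E"
  shows "zariski_irreducible E (zariski_closure E A)"
  unfolding zariski_irreducible_def
proof (intro conjI allI impI)
  let ?Z = "zariski_closure E A"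
  have AZ: "A \<subseteq> ?Z" "?Z \<subseteq> config_space E" "?Z \<subseteq> zero_locus_hull E A"
    using zariski_closure_eq[OF assms(2)] subset_zero_locus_hull[of A E] assms(2) by auto
  then show "?Z \<noteq> {}" "?Z \<subseteq> config_space E" using irred_nonempty[OF assms(1)] by auto
  have irr: "irred E ?Z" using irred_dense[OF assms(1) AZ(1,3)] .
  fix B C assume *: "zariski_closed E B \<and> zariski_closed E C \<and> ?Z \<subseteq> B \<union> C"
  then obtain F G where F: "F \<subseteq> poly_functions E" "B = {\<gamma> \<in> config_space E. \<forall>f\<in>F. f \<gamma> = 0}"
    and G: "G \<subseteq> poly_functions E" "C = {\<gamma> \<in> config_space E. \<forall>f\<in>G. f \<gamma> = 0}"
    by (elim conjE zariski_closed_def[THEN iffD1, THEN exE]) auto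
  show "?Z \<subseteq> B \<or> ?Z \<subseteq> C"
  proof (rule ccontr)
    assume "\<not> ?thesis"
    then obtain v w where vw: "v \<in> ?Z" "v \<notin> B" "w \<in> ?Z" "w \<notin> C" by blast
    then obtain f g where "f \<in> F" "f v \<noteq> 0" "g \<in> G" "g w \<noteq> 0"
      using F G AZ by blast
    then obtain u where "u \<in> ?Z" "f u \<noteq> 0" "g u \<noteq> 0"
      using irredD[OF irr, of f g v w] vw F(1) G(1) by blast
    then show False using * F(2) G(2) \<open>f \<in> F\<close> \<open>g \<in> G\<close> by blast
  qed
qed

lemma zariski_closed_Union:
  assumes "finite \<V>" "\<And>C. C \<in> \<V> \<Longrightarrow> zariski_closed E C"
  shows "zariski_closed E (\<Union>\<V>)"
  using assms
proof (induction rule: finite_induct)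
  case empty
  show ?case unfolding zariski_closed_def
    by (intro exI[of _ "{\<lambda>_. 1}"]) (auto intro: poly_functions.const)
next
  case (insert C \<V>)
  have "zariski_closed E C" "zariski_closed E (\<Union>\<V>)" using insert by auto
  then obtain F G where F: "F \<subseteq> poly_functions E" "C = {\<gamma> \<in> config_space E. \<forall>f\<in>F. f \<gamma> = 0}"
    and G: "G \<subseteq> poly_functions E" "\<Union>\<V> = {\<gamma> \<in> config_space E. \<forall>f\<in>G. f \<gamma> = 0}"
    by (elim zariski_closed_def[THEN iffD1, THEN exE]) auto
  let ?H = "(\<lambda>(f, g) v. f v * g v) ` (F \<times> G)"
  have "\<Union>(insert C \<V>) = {\<gamma> \<in> config_space E. \<forall>f\<in>?H. f \<gamma> = 0}"
  proof -
    have "\<Union>(insert C \<V>) = C \<union> \<Union>\<V>" by simp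
    also have "\<dots> = {\<gamma> \<in> config_space E. \<forall>f\<in>?H. f \<gamma> = 0}"
    proof (intro set_eqI iffI)
      fix \<gamma> assume "\<gamma> \<in> C \<union> \<Union>\<V>"
      then show "\<gamma> \<in> {\<gamma> \<in> config_space E. \<forall>f\<in>?H. f \<gamma> = 0}"
        unfolding F(2) G(2) by auto
    next
      fix \<gamma> assume \<gamma>: "\<gamma> \<in> {\<gamma> \<in> config_space E. \<forall>f\<in>?H. f \<gamma> = 0}"
      then have "f \<gamma> * g \<gamma> = 0" if "f \<in> F" "g \<in> G" for f g
        using that by fastforce
      then have "(\<forall>f\<in>F. f \<gamma> = 0) \<or> (\<forall>g\<in>G. g \<gamma> = 0)" by auto
      then show "\<gamma> \<in> C \<union> \<Union>\<V>" using \<gamma> unfolding F(2) G(2) by blast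
    qed
    finally show ?thesis .
  qed
  moreover have "?H \<subseteq> poly_functions E"
    using F(1) G(1) by (auto intro: poly_functions.mult)
  ultimately show ?case unfolding zariski_closed_def by blast
qed

lemma zariski_irreducible_finite_cover:
  assumes "finite \<V>" "zariski_irreducible E Z" "\<And>C. C \<in> \<V> \<Longrightarrow> zariski_closed E C" "Z \<subseteq> \<Union>\<V>"
  shows "\<exists>C\<in>\<V>. Z \<subseteq> C"
  using assms
proof (induction rule: finite_induct)
  case empty
  then show ?case unfolding zariski_irreducible_def by auto
next
  case (insert C \<V>)
  have "zariski_closed E C" "zariski_closed E (\<Union>\<V>)" "Z \<subseteq> C \<union> \<Union>\<V>"
    using insert zariski_closed_Union[of \<V>] by auto
  then have "Z \<subseteq> C \<or> Z \<subseteq> \<Union>\<V>"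
    using insert.prems(1) unfolding zariski_irreducible_def by blast
  then show ?case using insert by auto
qed

section \<open>Orthogonal assignments on bipartite cactus graphs\<close>

locale bipartite_graph =
  fixes adj :: "'v \<Rightarrow> 'v \<Rightarrow> bool" and pt :: "'v \<Rightarrow> bool"
  assumes adj_sym: "adj x y \<Longrightarrow> adj y x"
    and adj_pt: "adj x y \<Longrightarrow> pt x \<noteq> pt y"
begin

lemma adj_irrefl [simp]: "\<not> adj x x"
  using adj_pt by blast

text \<open>Values outside \<open>V\<close> are unconstrained: adding a vertex is a function update,
  and forgetting one needs no restriction.\<close>

definition ortho :: "'v set \<Rightarrow> ('v \<Rightarrow> complex ^ 3) set" where
  "ortho V = {v. (\<forall>x\<in>V. v x \<noteq> 0) \<and> (\<forall>x\<in>V. \<forall>y\<in>V. adj x y \<longrightarrow> cdot (v x) (v y) = 0)}"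

text \<open>Triples are tested for points only, since the independent triples of the matroid consist
  of points. This breaks the symmetry between points and lines, and \<open>generic_close\<close>
  accordingly restores a line and never a point.\<close>

definition generic :: "'v set \<Rightarrow> ('v \<Rightarrow> complex ^ 3) set" where
  "generic V = {v \<in> ortho V.
     (\<forall>x\<in>V. \<forall>y\<in>V. x \<noteq> y \<and> pt x = pt y \<longrightarrow> ccross (v x) (v y) \<noteq> 0) \<and>
     (\<forall>x\<in>V. \<forall>y\<in>V. pt x \<noteq> pt y \<and> \<not> adj x y \<longrightarrow> cdot (v x) (v y) \<noteq> 0) \<and>
     (\<forall>x\<in>V. \<forall>y\<in>V. \<forall>z\<in>V. pt x \<and> pt y \<and> pt z \<and> x \<noteq> y \<and> x \<noteq> z \<and> y \<noteq> z \<and>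
        \<not> (\<exists>l\<in>V. adj l x \<and> adj l y \<and> adj l z) \<longrightarrow> det3 (v x) (v y) (v z) \<noteq> 0)}"

text \<open>
  Cactus graphs without short cycles, built vertex by vertex. In \<open>close\<close>, the adjacent
  vertices \<open>a\<close> and \<open>b\<close> have degree two; removing either of them opens their cycle.
\<close>

inductive cactus :: "'v set \<Rightarrow> bool" where
  empty: "cactus {}"
| leaf: "\<lbrakk>cactus V; x \<notin> V; \<And>y z. y \<in> V \<Longrightarrow> z \<in> V \<Longrightarrow> adj x y \<Longrightarrow> adj x z \<Longrightarrow> y = z\<rbrakk>
    \<Longrightarrow> cactus (insert x V)"
| close: "\<lbrakk>cactus (W - {a}); cactus (W - {b}); a \<in> W; b \<in> W; adj a b; b \<noteq> c; a \<noteq> d; \<not> adj c d;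
    {y \<in> W. adj a y} = {b, c}; {y \<in> W. adj b y} = {a, d}\<rbrakk> \<Longrightarrow> cactus W"

section \<open>Building, cutting and joining cactus graphs\<close>

lemma cactus_finite: "cactus V \<Longrightarrow> finite V"
  by (induction rule: cactus.induct) auto

lemma cactus_leaf:
  assumes "cactus V" "\<And>y z. y \<in> V \<Longrightarrow> z \<in> V \<Longrightarrow> adj x y \<Longrightarrow> adj x z \<Longrightarrow> y = z"
  shows "cactus (insert x V)"
  using assms cactus.leaf[of V x] by (cases "x \<in> V") (auto simp: insert_absorb)

text \<open>Deleting \<open>a\<close> or \<open>b\<close> falls back on an induction hypothesis;
  deleting \<open>c\<close> or \<open>d\<close> leaves \<open>a\<close> or \<open>b\<close> with at
  most one neighbour, hence a leaf. Otherwise rule \<open>close\<close> applies again. Since that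
  rule does not assert that a cycle runs through \<open>a\<close> and \<open>b\<close>, it does not
  matter whether the deletion has broken the cycle elsewhere.\<close>

lemma cactus_diff: "cactus V \<Longrightarrow> cactus (V - J)"
proof (induction rule: cactus.induct)
  case empty
  show ?case by (simp add: cactus.empty)
next
  case (leaf V x)
  show ?case
  proof (cases "x \<in> J")
    case True
    then show ?thesis using leaf by simp
  next
    case False
    then have "insert x V - J = insert x (V - J)" by auto
    then show ?thesis using cactus_leaf[OF leaf.IH, of x] leaf.hyps by auto
  qed
next
  case (close W a b c d)
  have nba: "y = b \<or> y = c" if "y \<in> W" "adj a y" for y using close.hyps(9) that by auto
  have nbb: "y = a \<or> y = d" if "y \<in> W" "adj b y" for y using close.hyps(10) that by auto
  have eq: "W - J = insert z (W - {z} - J)" if "z \<in> W" "z \<notin> J" for z using that by auto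
  consider "a \<in> J" | "b \<in> J" | "a \<notin> J" "b \<notin> J" "c \<in> J" | "a \<notin> J" "b \<notin> J" "d \<in> J"
    | "a \<notin> J" "b \<notin> J" "c \<notin> J" "d \<notin> J" by blast
  then show ?case
  proof cases
    case 1
    then have "W - J = W - {a} - J" by auto
    then show ?thesis using close.IH by simp
  next
    case 2
    then have "W - J = W - {b} - J" by auto
    then show ?thesis using close.IH by simp
  next
    case 3
    have "cactus (insert a (W - {a} - J))"
      by (rule cactus_leaf[OF close.IH(1)]) (use 3 nba in blast)
    then show ?thesis using eq[of a] 3 close.hyps by simp
  next
    case 4
    have "cactus (insert b (W - {b} - J))"
      by (rule cactus_leaf[OF close.IH(2)]) (use 4 nbb in blast)
    then show ?thesis using eq[of b] 4 close.hyps by simp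
  next
    case 5
    have "W - J - {a} = W - {a} - J" "W - J - {b} = W - {b} - J" by auto
    then have "cactus (W - J - {a})" "cactus (W - J - {b})" using close.IH by simp_all
    then show ?thesis
      by (rule cactus.close[of _ a b c d]) (use 5 close.hyps in auto)
  qed
qed

lemma cactus_disjoint_union:
  assumes "cactus U" "cactus V" "U \<inter> V = {}" "\<And>x y. x \<in> U \<Longrightarrow> y \<in> V \<Longrightarrow> \<not> adj x y"
  shows "cactus (U \<union> V)"
  using assms(2-4)
proof (induction rule: cactus.induct)
  case empty
  show ?case using assms(1) by simp
next
  case (leaf V x)
  have "cactus (insert x (U \<union> V))"
  proof (rule cactus_leaf)
    show "cactus (U \<union> V)" using leaf by auto
    show "y = z" if "y \<in> U \<union> V" "z \<in> U \<union> V" "adj x y" "adj x z" for y z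
      using that leaf adj_sym by blast
  qed
  then show ?case by simp
next
  case (close W a b c d)
  have "U \<union> W - {a} = U \<union> (W - {a})" "U \<union> W - {b} = U \<union> (W - {b})"
    using close.hyps close.prems by auto
  moreover have "cactus (U \<union> (W - {a}))" "cactus (U \<union> (W - {b}))"
    using close.IH close.prems by blast+
  ultimately have "cactus (U \<union> W - {a})" "cactus (U \<union> W - {b})" by simp_all
  moreover have "{y \<in> U \<union> W. adj a y} = {y \<in> W. adj a y}" "{y \<in> U \<union> W. adj b y} = {y \<in> W. adj b y}"
    using close.prems(2) close.hyps(3,4) adj_sym by blast+
  ultimately show ?case
    using cactus.close[of "U \<union> W" a b c d] close.hyps by simp
qed

lemma cactus_leaves:
  assumes "finite X" "cactus V"
    and "\<And>x y z. x \<in> X \<Longrightarrow> y \<in> V \<Longrightarrow> z \<in> V \<Longrightarrow> adj x y \<Longrightarrow> adj x z \<Longrightarrow> y = z"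
    and "\<And>x y. x \<in> X \<Longrightarrow> y \<in> X \<Longrightarrow> \<not> adj x y"
  shows "cactus (V \<union> X)"
  using assms
proof (induction X rule: finite_induct)
  case empty
  then show ?case by simp
next
  case (insert x X)
  have "cactus (insert x (V \<union> X))"
  proof (rule cactus_leaf)
    show "cactus (V \<union> X)"
      by (rule insert.IH) (use insert.prems in auto)
    fix y z assume yz: "y \<in> V \<union> X" "z \<in> V \<union> X" "adj x y" "adj x z"
    then have "y \<in> V" "z \<in> V" using insert.prems(3)[of x] by auto
    then show "y = z" using insert.prems(2)[of x y z] yz by simp
  qed
  then show ?case by simp
qed

text \<open>A cycle is hung onto \<open>V\<close> at \<open>c 0\<close>; it is closed at the
  adjacent vertices \<open>c 1\<close> and \<open>c 2\<close>, whose other neighbours are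
  \<open>c 0\<close> and \<open>c 3\<close>. The bound on \<open>m\<close> keeps these two
  nonadjacent, which fails for a four-cycle.\<close>

lemma cactus_cycle:
  fixes c :: "nat \<Rightarrow> 'v"
  assumes V: "cactus V" and m: "5 \<le> m" and inj: "inj_on c {..<m}"
    and c0: "c 0 \<in> V" and new: "\<And>i. 0 < i \<Longrightarrow> i < m \<Longrightarrow> c i \<notin> V"
    and adj: "\<And>i j. i < j \<Longrightarrow> j < m \<Longrightarrow> adj (c i) (c j) \<longleftrightarrow> j = Suc i \<or> (i = 0 \<and> Suc j = m)"
    and old: "\<And>i y. 0 < i \<Longrightarrow> i < m \<Longrightarrow> y \<in> V \<Longrightarrow> adj (c i) y \<Longrightarrow> y = c 0"
  shows "cactus (V \<union> c ` {..<m})"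
proof -
  have adj': "adj (c i) (c j) \<longleftrightarrow> j = Suc i \<or> i = Suc j \<or> (i = 0 \<and> Suc j = m) \<or> (j = 0 \<and> Suc i = m)"
    if "i < m" "j < m" for i j
  proof (cases i j rule: linorder_cases)
    case less
    then show ?thesis using adj[OF less that(2)] that m by auto
  next
    case equal
    then show ?thesis using m by auto
  next
    case greater
    have "adj (c i) (c j) \<longleftrightarrow> adj (c j) (c i)" using adj_sym by blast
    then show ?thesis using adj[OF greater that(1)] greater that m by auto
  qed
  have ceq: "c i = c j \<longleftrightarrow> i = j" if "i < m" "j < m" for i j
    using inj that by (auto simp: inj_on_def)
  \<comment> \<open>The path grows from its far end: \<open>c (m - 1)\<close> hangs from
    \<open>c 0\<close>, and every earlier vertex from its successor.\<close>
  have path: "cactus (V \<union> c ` {k..<m})" if "2 \<le> k" "k \<le> m" for k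
    using that(2,1)
  proof (induction k rule: inc_induct)
    case base
    then show ?case using V by simp
  next
    case (step k)
    have k: "0 < k" "k < m" using step by auto
    have "cactus (insert (c k) (V \<union> c ` {Suc k..<m}))"
    proof (rule cactus_leaf)
      show "cactus (V \<union> c ` {Suc k..<m})" using step by simp
      have *: "(y = c 0 \<and> Suc k = m) \<or> (y = c (Suc k) \<and> Suc k < m)" if y: "y \<in> V \<union> c ` {Suc k..<m}" "adj (c k) y" for y
      proof (cases "y \<in> V")
        case True
        then have "y = c 0" using old[OF k] y by blast
        then show ?thesis using adj'[of k 0] y(2) k step.prems by auto
      next
        case False
        then obtain j where j: "Suc k \<le> j" "j < m" "y = c j" using y by auto
        then show ?thesis using adj'[of k j] y(2) k by auto
      qed
      show "y = z" if "y \<in> V \<union> c ` {Suc k..<m}" "z \<in> V \<union> c ` {Suc k..<m}" "adj (c k) y" "adj (c k) z" for y z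
        using *[OF that(1,3)] *[OF that(2,4)] by auto
    qed
    moreover have "{k..<m} = insert k {Suc k..<m}" using k by auto
    ultimately show ?case by simp
  qed
  let ?W = "V \<union> c ` {..<m}"
  have out: "c i \<notin> V \<union> c ` {k..<m}" if "0 < i" "i < k" "i < m" for i k
    using new[of i] ceq that by auto
  have W1: "?W - {c 1} = V \<union> c ` {2..<m}"
  proof -
    have "{..<m} = insert 0 (insert 1 {2..<m})" using m by auto
    then have "?W = insert (c 1) (V \<union> c ` {2..<m})" using c0 by auto
    then show ?thesis using out[of 1 2] m by auto
  qed
  \<comment> \<open>Without \<open>c 2\<close> the cycle opens into two arms at \<open>c 0\<close>,
    one of which is the single leaf \<open>c 1\<close>.\<close>
  have W2: "?W - {c 2} = insert (c 1) (V \<union> c ` {3..<m})"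
  proof -
    have "{..<m} = insert 0 (insert 1 (insert 2 {3..<m}))" using m by auto
    then have "?W = insert (c 2) (insert (c 1) (V \<union> c ` {3..<m}))" using c0 by auto
    moreover have "c 2 \<noteq> c 1" using ceq[of 2 1] m by simp
    ultimately show ?thesis using out[of 2 3] m by auto
  qed
  have nb: "{y \<in> ?W. adj (c i) y} = {c (i - 1), c (Suc i)}" if i: "0 < i" "Suc i < m" for i
  proof (intro set_eqI iffI)
    fix y assume y: "y \<in> {y \<in> ?W. adj (c i) y}"
    then have "y \<in> c ` {..<m}" using old[of i y] i c0 m by auto
    then obtain j where "j < m" "y = c j" by auto
    then show "y \<in> {c (i - 1), c (Suc i)}" using adj'[of i j] y i by auto
  next
    fix y assume "y \<in> {c (i - 1), c (Suc i)}"
    then show "y \<in> {y \<in> ?W. adj (c i) y}" using adj'[of i "i - 1"] adj'[of i "Suc i"] i by auto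
  qed
  show ?thesis
  proof (rule cactus.close[of _ "c 1" "c 2" "c 0" "c 3"])
    show "cactus (?W - {c 1})" unfolding W1 using path[of 2] m by simp
    show "cactus (?W - {c 2})" unfolding W2
    proof (rule cactus_leaf)
      show "cactus (V \<union> c ` {3..<m})" using path[of 3] m by simp
      have *: "y = c 0" if y: "y \<in> V \<union> c ` {3..<m}" "adj (c 1) y" for y
      proof (cases "y \<in> V")
        case True
        then show ?thesis using old[of 1] y m by auto
      next
        case False
        then obtain j where j: "3 \<le> j" "j < m" "y = c j" using y by auto
        then show ?thesis using adj'[of 1 j] y(2) m by auto
      qed
      show "y = z" if "y \<in> V \<union> c ` {3..<m}" "z \<in> V \<union> c ` {3..<m}" "adj (c 1) y" "adj (c 1) z" for y z
        using *[OF that(1,3)] *[OF that(2,4)] by simp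
    qed
    show "adj (c 1) (c 2)" "\<not> adj (c 0) (c 3)" using adj'[of 1 2] adj'[of 0 3] m by auto
    show "c 2 \<noteq> c 0" "c 1 \<noteq> c 3" using ceq m by auto
    show "{y \<in> ?W. adj (c 1) y} = {c 2, c 0}" using nb[of 1] m
      by (simp add: numeral_2_eq_2 insert_commute)
    show "{y \<in> ?W. adj (c 2) y} = {c 1, c 3}" using nb[of 2] m
      by (simp add: numeral_3_eq_3 numeral_2_eq_2)
  qed (use m in auto)
qed

section \<open>Irreducibility when a vertex is attached\<close>

lemma orthoD:
  "v \<in> ortho V \<Longrightarrow> x \<in> V \<Longrightarrow> v x \<noteq> 0"
  "v \<in> ortho V \<Longrightarrow> x \<in> V \<Longrightarrow> y \<in> V \<Longrightarrow> adj x y \<Longrightarrow> cdot (v x) (v y) = 0"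
  by (auto simp: ortho_def)

lemma generic_ortho: "v \<in> generic V \<Longrightarrow> v \<in> ortho V"
  by (simp add: generic_def)

lemma genericD:
  assumes "v \<in> generic V" "x \<in> V" "y \<in> V"
  shows "x \<noteq> y \<Longrightarrow> pt x = pt y \<Longrightarrow> ccross (v x) (v y) \<noteq> 0"
    and "pt x \<noteq> pt y \<Longrightarrow> \<not> adj x y \<Longrightarrow> cdot (v x) (v y) \<noteq> 0"
    and "z \<in> V \<Longrightarrow> pt x \<Longrightarrow> pt y \<Longrightarrow> pt z \<Longrightarrow> x \<noteq> y \<Longrightarrow> x \<noteq> z \<Longrightarrow> y \<noteq> z \<Longrightarrow>
      (\<And>l. l \<in> V \<Longrightarrow> adj l x \<Longrightarrow> adj l y \<Longrightarrow> adj l z \<Longrightarrow> False) \<Longrightarrow> det3 (v x) (v y) (v z) \<noteq> 0"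
  using assms unfolding generic_def by blast+

lemma ortho_cong: "(\<And>x. x \<in> V \<Longrightarrow> v x = w x) \<Longrightarrow> v \<in> ortho V \<longleftrightarrow> w \<in> ortho V"
  unfolding ortho_def by simp

lemma ortho_insert:
  assumes "x \<notin> V"
  shows "v \<in> ortho (insert x V) \<longleftrightarrow>
    v \<in> ortho V \<and> v x \<noteq> 0 \<and> (\<forall>y\<in>V. adj x y \<longrightarrow> cdot (v x) (v y) = 0)"
  unfolding ortho_def using adj_sym by (auto simp: cdot_commute)

lemma ortho_fun_upd:
  assumes "x \<notin> V" "v \<in> ortho V" "s \<noteq> 0" "\<And>y. y \<in> V \<Longrightarrow> adj x y \<Longrightarrow> cdot s (v y) = 0"
  shows "v(x := s) \<in> ortho (insert x V)"
proof -
  have "(v(x := s)) y = v y" if "y \<in> V" for y using that assms(1) by auto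
  then have "v(x := s) \<in> ortho V" using ortho_cong[of V "v(x := s)" v] assms(2) by blast
  then show ?thesis using assms by (auto simp: ortho_insert)
qed

lemma poly_open_ccross: "x \<in> V \<Longrightarrow> y \<in> V \<Longrightarrow> poly_open V (\<lambda>v. ccross (v x) (v y) \<noteq> 0)"
  by (intro poly_open_vec poly_functions_ccross poly_functions.coord)

text \<open>
  Both ways of attaching a vertex are bundles over the assignments on the old vertices; the
  predicate \<open>P\<close> selects the open part of the base where the fibre has its generic dimension.
\<close>

lemma irred_attach:
  assumes irr: "irred V (ortho V)" and x: "x \<notin> V"
    and P: "poly_open V P" "\<exists>v\<in>ortho V. P v"
    and ext: "\<And>v s. P (v(x := s)) \<longleftrightarrow> P v"
    and ne: "\<And>v. v \<in> ortho V \<Longrightarrow> P v \<Longrightarrow> \<exists>s. s \<noteq> 0 \<and> (\<forall>y\<in>V. adj x y \<longrightarrow> cdot s (v y) = 0)"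
    and sect: "\<And>v s. v \<in> ortho V \<Longrightarrow> P v \<Longrightarrow> (\<forall>y\<in>V. adj x y \<longrightarrow> cdot s (v y) = 0) \<Longrightarrow>
       \<exists>\<sigma>. \<sigma> v = s \<and> (\<forall>w\<in>ortho V. \<forall>y\<in>V. adj x y \<longrightarrow> cdot (\<sigma> w) (w y) = 0) \<and>
           (\<forall>k. (\<lambda>w. \<sigma> w $ k) \<in> poly_functions V)"
  shows "irred (insert x V) {v \<in> ortho (insert x V). P v}"
proof -
  define S where "S v = {s. \<forall>y\<in>V. adj x y \<longrightarrow> cdot s (v y) = 0}" for v :: "'v \<Rightarrow> complex ^ 3"
  let ?A = "{v \<in> ortho V. P v}"
  let ?B = "{v(x := s) | v s. v \<in> ?A \<and> s \<in> S v}"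
  have "irred V ?A" by (rule irred_open[OF irr P])
  then have B: "irred (insert x V) ?B"
  proof (rule irred_extend[OF _ x])
    show "S v \<noteq> {}" if "v \<in> ?A" for v using ne[of v] that by (auto simp: S_def)
    show "s + t *s (s' - s) \<in> S v" if "v \<in> ?A" "s \<in> S v" "s' \<in> S v" for v s s' t
    proof -
      have "cdot (s + t *s (s' - s)) z = (1 - t) * cdot s z + t * cdot s' z" for z
        by (simp add: cdot_def algebra_simps)
      then show ?thesis using that by (simp add: S_def)
    qed
    show "\<exists>\<sigma>. \<sigma> v = s \<and> (\<forall>w\<in>?A. \<sigma> w \<in> S w) \<and> (\<forall>k. (\<lambda>w. \<sigma> w $ k) \<in> poly_functions V)"
      if vs: "v \<in> ?A" "s \<in> S v" for v s
      using sect[of v s] vs by (auto simp: S_def)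
  qed
  have "{v \<in> ortho (insert x V). P v} = {v \<in> ?B. v x \<noteq> 0}"
  proof (intro set_eqI iffI)
    fix v assume v: "v \<in> {v \<in> ortho (insert x V). P v}"
    then have "v \<in> ?A" "v x \<in> S v" "v x \<noteq> 0" by (auto simp: ortho_insert[OF x] S_def)
    moreover have "v = v(x := v x)" by simp
    ultimately show "v \<in> {v \<in> ?B. v x \<noteq> 0}" by blast
  next
    fix u assume "u \<in> {v \<in> ?B. v x \<noteq> 0}"
    then obtain v s where "u = v(x := s)" "v \<in> ortho V" "P v" "s \<in> S v" "s \<noteq> 0" by auto
    then show "u \<in> {v \<in> ortho (insert x V). P v}"
      using ortho_fun_upd[OF x, of v s] ext by (simp add: S_def)
  qed
  moreover have "irred (insert x V) {v \<in> ?B. v x \<noteq> 0}"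
  proof (rule irred_open[OF B])
    show "poly_open (insert x V) (\<lambda>v. v x \<noteq> 0)" by (intro poly_open_vec poly_functions.coord) simp
    obtain v where v: "v \<in> ?A" using P(2) by blast
    then obtain s where "s \<noteq> 0" "s \<in> S v" using ne[of v] by (auto simp: S_def)
    then show "\<exists>v\<in>?B. v x \<noteq> 0" using v by (intro bexI[of _ "v(x := s)"]) auto
  qed
  ultimately show ?thesis by simp
qed

lemma irred_leaf:
  assumes irr: "irred V (ortho V)" and x: "x \<notin> V"
    and uniq: "\<And>y z. y \<in> V \<Longrightarrow> z \<in> V \<Longrightarrow> adj x y \<Longrightarrow> adj x z \<Longrightarrow> y = z"
  shows "irred (insert x V) (ortho (insert x V))"
proof -
  have "irred (insert x V) {v \<in> ortho (insert x V). True}"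
  proof (rule irred_attach[OF irr x])
    show "poly_open V (\<lambda>_. True)"
      using poly_openI[OF poly_functions.const[of 1]] by simp
    show "\<exists>v\<in>ortho V. True" using irred_nonempty[OF irr] by blast
    fix v assume v: "v \<in> ortho V"
    show "\<exists>s. s \<noteq> 0 \<and> (\<forall>y\<in>V. adj x y \<longrightarrow> cdot s (v y) = 0)"
    proof (cases "\<exists>y\<in>V. adj x y")
      case True
      then obtain y where y: "y \<in> V" "adj x y" by blast
      obtain s where "s \<noteq> 0" "cdot s (v y) = 0" using exists_orthogonal_both by blast
      then show ?thesis using uniq[OF y(1) _ y(2)] by (intro exI[of _ s]) blast
    next
      case False
      obtain s :: "complex ^ 3" where "s \<noteq> 0" "cdot s 0 = 0" using exists_orthogonal_both by blast
      then show ?thesis using False by blast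
    qed
    fix s assume s: "\<forall>y\<in>V. adj x y \<longrightarrow> cdot s (v y) = 0"
    show "\<exists>\<sigma>. \<sigma> v = s \<and> (\<forall>w\<in>ortho V. \<forall>y\<in>V. adj x y \<longrightarrow> cdot (\<sigma> w) (w y) = 0) \<and>
           (\<forall>k. (\<lambda>w. \<sigma> w $ k) \<in> poly_functions V)"
    proof (cases "\<exists>y\<in>V. adj x y")
      case True
      then obtain y where y: "y \<in> V" "adj x y" by blast
      \<comment> \<open>Fixing \<open>z\<close> and letting the vector at the only neighbour
        \<open>y\<close> vary gives the section through \<open>s\<close>.\<close>
      obtain z where z: "s = ccross (v y) z"
        using orthogonal_ccross[of "v y" s] orthoD(1)[OF v y(1)] s y by blast
      have "cdot (ccross (w y) z) (w y') = 0" if "y' \<in> V" "adj x y'" for w y'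
        using uniq[OF y(1) that(1) y(2) that(2)] by simp
      moreover have "(\<lambda>w. ccross (w y) z $ k) \<in> poly_functions V" for k
        by (intro poly_functions_ccross poly_functions.coord poly_functions.const y)
      ultimately show ?thesis using z by (intro exI[of _ "\<lambda>w. ccross (w y) z"]) blast
    next
      case False
      then show ?thesis by (intro exI[of _ "\<lambda>_. s"]) (auto intro: poly_functions.const)
    qed
  qed simp
  then show ?thesis by simp
qed

text \<open>Over independent \<open>v p\<close>, \<open>v q\<close> the admissible vectors form the
  line of their cross product, and one scalar \<open>c\<close> defines a section over the whole
  base. Over dependent ones they fill a plane while the cross product vanishes, which is why that
  locus is excluded.\<close>

lemma irred_between:
  assumes irr: "irred V (ortho V)" and x: "x \<notin> V"
    and nb: "{y \<in> V. adj x y} = {p, q}"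
    and ex: "\<exists>v\<in>ortho V. ccross (v p) (v q) \<noteq> 0"
  shows "irred (insert x V) {v \<in> ortho (insert x V). ccross (v p) (v q) \<noteq> 0}"
proof (rule irred_attach[OF irr x])
  have pq: "p \<in> V" "q \<in> V" using nb by auto
  then have neq: "p \<noteq> x" "q \<noteq> x" using x by auto
  have nb': "(\<forall>y\<in>V. adj x y \<longrightarrow> Q y) \<longleftrightarrow> Q p \<and> Q q" for Q
  proof -
    have "(\<forall>y\<in>V. adj x y \<longrightarrow> Q y) \<longleftrightarrow> (\<forall>y\<in>{y \<in> V. adj x y}. Q y)" by blast
    then show ?thesis unfolding nb by simp
  qed
  show "poly_open V (\<lambda>v. ccross (v p) (v q) \<noteq> 0)" using pq by (rule poly_open_ccross)
  show "\<exists>v\<in>ortho V. ccross (v p) (v q) \<noteq> 0" by (rule ex)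
  show "ccross ((v(x := s)) p) ((v(x := s)) q) \<noteq> 0 \<longleftrightarrow> ccross (v p) (v q) \<noteq> 0" for v s
    using neq by simp
  show "\<exists>s. s \<noteq> 0 \<and> (\<forall>y\<in>V. adj x y \<longrightarrow> cdot s (v y) = 0)" for v
    unfolding nb' by (rule exists_orthogonal_both)
  show "\<exists>\<sigma>. \<sigma> v = s \<and> (\<forall>w\<in>ortho V. \<forall>y\<in>V. adj x y \<longrightarrow> cdot (\<sigma> w) (w y) = 0) \<and>
           (\<forall>k. (\<lambda>w. \<sigma> w $ k) \<in> poly_functions V)"
    if v: "ccross (v p) (v q) \<noteq> 0" and s: "\<forall>y\<in>V. adj x y \<longrightarrow> cdot s (v y) = 0" for v s
  proof -
    have "cdot s (v p) = 0" "cdot s (v q) = 0" using s unfolding nb' by auto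
    then obtain c where c: "s = c *s ccross (v p) (v q)"
      using orthogonal_both_scale[OF v] by blast
    have "(\<lambda>w. (c *s ccross (w p) (w q)) $ k) \<in> poly_functions V" for k
      using poly_functions.mult[OF poly_functions.const[of c] poly_functions_ccross[OF poly_functions.coord poly_functions.coord], OF pq]
      by simp
    then show ?thesis
      using c unfolding nb' by (intro exI[of _ "\<lambda>w. c *s ccross (w p) (w q)"]) (auto simp: cdot_scale)
  qed
qed

section \<open>Existence of generic assignments\<close>

lemma ortho_mono: "v \<in> ortho W \<Longrightarrow> V \<subseteq> W \<Longrightarrow> v \<in> ortho V"
  unfolding ortho_def by blast

text \<open>The new normal is forced up to scale, so genericity cannot be arranged and has to follow
  from that of \<open>u\<close>. If the normal were parallel to that of another line, this line
  would pass through \<open>b\<close> and \<open>c\<close>; if it were orthogonal to a further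
  point, the determinant condition would put that point on an old line with \<open>b\<close> and
  \<open>c\<close>. The hypothesis that no old line joins \<open>b\<close> and \<open>c\<close>
  excludes both.\<close>

lemma generic_close:
  assumes a: "a \<in> W" "\<not> pt a" and nb: "{y \<in> W. adj a y} = {b, c}" and bc: "b \<noteq> c"
    and uniq: "\<And>l. l \<in> W - {a} \<Longrightarrow> adj l b \<Longrightarrow> adj l c \<Longrightarrow> False"
    and u: "u \<in> generic (W - {a})"
  shows "u(a := ccross (u b) (u c)) \<in> generic W"
proof -
  define n where "n = ccross (u b) (u c)"
  define w where "w = u(a := n)"
  have nbD: "y = b \<or> y = c" if "y \<in> W" "adj a y" for y using nb that by auto
  have b: "b \<in> W" "adj a b" "b \<noteq> a" "pt b" and c: "c \<in> W" "adj a c" "c \<noteq> a" "pt c"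
    using nb adj_pt a(2) by (fastforce)+
  have n: "n \<noteq> 0" unfolding n_def using genericD(1)[OF u, of b c] b c bc by simp
  have W: "insert a (W - {a}) = W" using a by auto
  have wa: "w a = n" by (simp add: w_def)
  have wo: "w y = u y" if "y \<noteq> a" for y using that by (simp add: w_def)
  have "u(a := n) \<in> ortho (insert a (W - {a}))"
  proof (rule ortho_fun_upd)
    show "cdot n (u y) = 0" if "y \<in> W - {a}" "adj a y" for y
      using nbD[of y] that by (auto simp: n_def)
  qed (use generic_ortho[OF u] n in auto)
  then have ow: "w \<in> ortho W" unfolding W w_def .
  have par: "ccross n (u y) \<noteq> 0" if y: "y \<in> W" "y \<noteq> a" "\<not> pt y" for y
  proof
    assume "ccross n (u y) = 0"
    then obtain k where "u y = k *s n" using parallel_scale n by blast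
    then have "cdot (u y) (u b) = 0" "cdot (u y) (u c) = 0" by (auto simp: n_def cdot_scale)
    then have "adj y b" "adj y c"
      using genericD(2)[OF u, of y b] genericD(2)[OF u, of y c] y b c by auto
    then show False using uniq y by blast
  qed
  have inc: "cdot n (u y) \<noteq> 0" if y: "y \<in> W" "pt y" "\<not> adj a y" for y
  proof -
    have "y \<noteq> a" "y \<noteq> b" "y \<noteq> c" using y a b c by auto
    then have "det3 (u y) (u b) (u c) \<noteq> 0"
      using genericD(3)[OF u, of y b c] y b c bc uniq by blast
    then show ?thesis by (simp add: det3_def n_def cdot_commute)
  qed
  have "w \<in> generic W"
    unfolding generic_def
  proof (intro CollectI conjI ballI impI)
    show "w \<in> ortho W" by (rule ow)
    show "ccross (w x) (w y) \<noteq> 0" if "x \<in> W" "y \<in> W" "x \<noteq> y \<and> pt x = pt y" for x y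
    proof -
      consider "x = a" | "y = a" "x \<noteq> a" | "x \<noteq> a" "y \<noteq> a" by blast
      then show ?thesis
      proof cases
        case 1
        then show ?thesis using par[of y] that a wa wo[of y] by auto
      next
        case 2
        then show ?thesis using par[of x] that a wa wo[of x] ccross_eq_0_commute[of n "u x"] by auto
      next
        case 3
        then show ?thesis using genericD(1)[OF u, of x y] that wo by simp
      qed
    qed
    show "cdot (w x) (w y) \<noteq> 0" if "x \<in> W" "y \<in> W" "pt x \<noteq> pt y \<and> \<not> adj x y" for x y
    proof -
      consider "x = a" | "y = a" "x \<noteq> a" | "x \<noteq> a" "y \<noteq> a" by blast
      then show ?thesis
      proof cases
        case 1
        then have "pt y" "y \<noteq> a" using that a by auto
        then show ?thesis using 1 inc[of y] that wa wo[of y] by auto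
      next
        case 2
        then have "pt x" using that a by auto
        then show ?thesis
          using 2 inc[of x] that wa wo[of x] adj_sym[of a x] cdot_commute[of n "u x"] by auto
      next
        case 3
        then show ?thesis using genericD(2)[OF u, of x y] that wo by simp
      qed
    qed
    show "det3 (w x) (w y) (w z) \<noteq> 0"
      if "x \<in> W" "y \<in> W" "z \<in> W" and *: "pt x \<and> pt y \<and> pt z \<and> x \<noteq> y \<and> x \<noteq> z \<and> y \<noteq> z \<and>
        \<not> (\<exists>l\<in>W. adj l x \<and> adj l y \<and> adj l z)" for x y z
    proof -
      have neq: "x \<noteq> a" "y \<noteq> a" "z \<noteq> a" using * a by auto
      then have "det3 (u x) (u y) (u z) \<noteq> 0"
        using genericD(3)[OF u, of x y z] that by blast
      then show ?thesis using wo neq by simp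
    qed
  qed
  then show ?thesis by (simp add: w_def n_def)
qed

text \<open>The new vector ranges over a plane or the whole space, so each single condition can be
  met by varying it over the fixed \<open>u\<close>. Irreducibility then yields one assignment
  meeting all of them; its old vectors may differ from those of \<open>u\<close>.\<close>

lemma generic_leaf:
  assumes irr: "irred (insert x V) (ortho (insert x V))" and x: "x \<notin> V" and fin: "finite V"
    and uniq: "\<And>y z. y \<in> V \<Longrightarrow> z \<in> V \<Longrightarrow> adj x y \<Longrightarrow> adj x z \<Longrightarrow> y = z"
    and u: "u \<in> generic V"
  shows "generic (insert x V) \<noteq> {}"
proof -
  let ?W = "insert x V"
  define F where "F = {s. s \<noteq> 0 \<and> (\<forall>y\<in>V. adj x y \<longrightarrow> cdot s (u y) = 0)}"
  have upd: "u(x := s) \<in> ortho ?W" if "s \<in> F" for s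
    using ortho_fun_upd[OF x generic_ortho[OF u]] that by (auto simp: F_def)
  have u0: "u y \<noteq> 0" if "y \<in> V" for y using orthoD(1)[OF generic_ortho[OF u] that] .
  have F1: "\<exists>s\<in>F. ccross s n \<noteq> 0" if n: "n \<noteq> 0" for n
  proof (cases "\<exists>y\<in>V. adj x y")
    case True
    then obtain y where y: "y \<in> V" "adj x y" by blast
    obtain s where "cdot s (u y) = 0" "ccross s n \<noteq> 0" using orthogonal_not_parallel[OF n] by blast
    then show ?thesis using uniq[OF y(1) _ y(2)] by (intro bexI[of _ s]) (auto simp: F_def)
  next
    case False
    obtain s where "cdot s 0 = 0" "ccross s n \<noteq> 0" using orthogonal_not_parallel[OF n] by blast
    then show ?thesis using False by (intro bexI[of _ s]) (auto simp: F_def)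
  qed
  have F2: "\<exists>s\<in>F. cdot s n \<noteq> 0" if n: "n \<noteq> 0" "\<And>y. y \<in> V \<Longrightarrow> adj x y \<Longrightarrow> ccross (u y) n \<noteq> 0" for n
  proof (cases "\<exists>y\<in>V. adj x y")
    case True
    then obtain y where y: "y \<in> V" "adj x y" by blast
    obtain s where "cdot s (u y) = 0" "cdot s n \<noteq> 0" using orthogonal_not_orthogonal[OF n(2)[OF y]] by blast
    then show ?thesis using uniq[OF y(1) _ y(2)] by (intro bexI[of _ s]) (auto simp: F_def)
  next
    case False
    obtain s where "cdot s n = 1" using cdot_nondegenerate[OF n(1)] by blast
    then show ?thesis using False by (intro bexI[of _ s]) (auto simp: F_def)
  qed
  \<comment> \<open>Conditions that do not involve \<open>x\<close> are witnessed by
    \<open>u\<close> itself, with any admissible vector at \<open>x\<close>.\<close>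
  obtain s0 where s0: "s0 \<in> F" using F1[of "axis 1 1"] by (auto simp: axis_eq_0_iff)
  have old: "u(x := s0) \<in> ortho ?W" "\<And>y. y \<in> V \<Longrightarrow> (u(x := s0)) y = u y"
    using upd[OF s0] x by auto
  have C: "\<exists>s\<in>F. ccross s (u y) \<noteq> 0" if "y \<in> V" for y using F1 u0 that by blast
  have I: "\<exists>s\<in>F. cdot s (u y) \<noteq> 0" if y: "y \<in> V" "pt x \<noteq> pt y" "\<not> adj x y" for y
  proof (rule F2)
    show "u y \<noteq> 0" using u0 y by blast
    show "ccross (u z) (u y) \<noteq> 0" if "z \<in> V" "adj x z" for z
      using genericD(1)[OF u that(1) y(1)] y adj_pt[OF that(2)] that by auto
  qed
  have D: "\<exists>s\<in>F. det3 s (u y) (u z) \<noteq> 0"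
    if yz: "y \<in> V" "z \<in> V" "pt x" "pt y" "pt z" "y \<noteq> z"
      and nc: "\<not> (\<exists>l\<in>?W. adj l x \<and> adj l y \<and> adj l z)" for y z
  proof -
    define n where "n = ccross (u y) (u z)"
    have n: "n \<noteq> 0" unfolding n_def using genericD(1)[OF u, of y z] yz by simp
    \<comment> \<open>A line \<open>l\<close> through \<open>x\<close> with normal parallel to
      \<open>n\<close> would contain \<open>y\<close> and \<open>z\<close> by genericity of
      \<open>u\<close>, making the three points collinear.\<close>
    have "ccross (u l) n \<noteq> 0" if l: "l \<in> V" "adj x l" for l
    proof
      assume "ccross (u l) n = 0"
      then obtain k where k: "n = k *s u l" using parallel_scale u0 l(1) by blast
      then have "k \<noteq> 0" using n by auto
      moreover have "k * cdot (u l) (u y) = 0" "k * cdot (u l) (u z) = 0"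
        using k by (simp_all flip: cdot_scale(1)) (simp_all flip: k add: n_def)
      ultimately have "cdot (u l) (u y) = 0" "cdot (u l) (u z) = 0" by simp_all
      then have "adj l y" "adj l z"
        using genericD(2)[OF u l(1) yz(1)] genericD(2)[OF u l(1) yz(2)] adj_pt[OF l(2)] yz by auto
      then show False using nc l adj_sym by blast
    qed
    then show ?thesis using F2[OF n] by (simp add: det3_def n_def)
  qed
  \<comment> \<open>Named predicates make the three kinds of conditions elements of one finite set
    \<open>\<P>\<close>, to which \<open>irred_finite_open\<close> applies.\<close>
  define C' where "C' y z v \<longleftrightarrow> ccross (v y) (v z) \<noteq> 0" for y z and v :: "'v \<Rightarrow> complex ^ 3"
  define I' where "I' y z v \<longleftrightarrow> cdot (v y) (v z) \<noteq> 0" for y z and v :: "'v \<Rightarrow> complex ^ 3"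
  define D' where "D' y z t v \<longleftrightarrow> det3 (v y) (v z) (v t) \<noteq> 0" for y z t and v :: "'v \<Rightarrow> complex ^ 3"
  define \<P> where "\<P> =
    {C' y z | y z. y \<in> ?W \<and> z \<in> ?W \<and> y \<noteq> z \<and> pt y = pt z} \<union>
    {I' y z | y z. y \<in> ?W \<and> z \<in> ?W \<and> pt y \<noteq> pt z \<and> \<not> adj y z} \<union>
    {D' y z t | y z t. y \<in> ?W \<and> z \<in> ?W \<and> t \<in> ?W \<and> pt y \<and> pt z \<and> pt t \<and>
       y \<noteq> z \<and> y \<noteq> t \<and> z \<noteq> t \<and> \<not> (\<exists>l\<in>?W. adj l y \<and> adj l z \<and> adj l t)}"
  have "\<P> \<subseteq> (\<Union>y\<in>?W. \<Union>z\<in>?W. {C' y z, I' y z}) \<union> (\<Union>y\<in>?W. \<Union>z\<in>?W. \<Union>t\<in>?W. {D' y z t})"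
    unfolding \<P>_def by blast
  moreover have "finite ((\<Union>y\<in>?W. \<Union>z\<in>?W. {C' y z, I' y z}) \<union> (\<Union>y\<in>?W. \<Union>z\<in>?W. \<Union>t\<in>?W. {D' y z t}))"
    using fin by simp
  ultimately have finP: "finite \<P>" by (rule finite_subset)
  have "poly_open ?W P \<and> (\<exists>v\<in>ortho ?W. P v)" if P: "P \<in> \<P>" for P
  proof -
    consider (c) y z where "P = C' y z" "y \<in> ?W" "z \<in> ?W" "y \<noteq> z" "pt y = pt z"
      | (i) y z where "P = I' y z" "y \<in> ?W" "z \<in> ?W" "pt y \<noteq> pt z" "\<not> adj y z"
      | (d) y z t where "P = D' y z t" "y \<in> ?W" "z \<in> ?W" "t \<in> ?W"
        "pt y" "pt z" "pt t" "y \<noteq> z" "y \<noteq> t" "z \<noteq> t" "\<not> (\<exists>l\<in>?W. adj l y \<and> adj l z \<and> adj l t)"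
      using P unfolding \<P>_def by blast
    then show ?thesis
    proof cases
      case c
      have "\<exists>v\<in>ortho ?W. ccross (v y) (v z) \<noteq> 0"
      proof -
        consider "y = x" "z \<in> V" | "z = x" "y \<in> V" | "y \<in> V" "z \<in> V" using c by blast
        then show ?thesis
        proof cases
          case 1
          then obtain s where "s \<in> F" "ccross s (u z) \<noteq> 0" using C by blast
          then show ?thesis using 1 upd[of s] x by (intro bexI[of _ "u(x := s)"]) auto
        next
          case 2
          then obtain s where "s \<in> F" "ccross s (u y) \<noteq> 0" using C by blast
          then show ?thesis using 2 upd[of s] x ccross_eq_0_commute[of s "u y"]
            by (intro bexI[of _ "u(x := s)"]) auto
        next
          case 3
          then show ?thesis using genericD(1)[OF u 3] c old by (intro bexI[of _ "u(x := s0)"]) auto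
        qed
      qed
      moreover have "poly_open ?W (\<lambda>v. ccross (v y) (v z) \<noteq> 0)" using c by (intro poly_open_ccross)
      ultimately show ?thesis unfolding c(1) C'_def by blast
    next
      case i
      have "\<exists>v\<in>ortho ?W. cdot (v y) (v z) \<noteq> 0"
      proof -
        consider "y = x" "z \<in> V" | "z = x" "y \<in> V" | "y \<in> V" "z \<in> V" using i by blast
        then show ?thesis
        proof cases
          case 1
          then obtain s where "s \<in> F" "cdot s (u z) \<noteq> 0" using I i by blast
          then show ?thesis using 1 upd[of s] x by (intro bexI[of _ "u(x := s)"]) auto
        next
          case 2
          then obtain s where "s \<in> F" "cdot s (u y) \<noteq> 0" using I[of y] i adj_sym by blast
          then show ?thesis using 2 upd[of s] x cdot_commute[of s "u y"]
            by (intro bexI[of _ "u(x := s)"]) auto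
        next
          case 3
          then show ?thesis using genericD(2)[OF u 3] i old by (intro bexI[of _ "u(x := s0)"]) auto
        qed
      qed
      moreover have "poly_open ?W (\<lambda>v. cdot (v y) (v z) \<noteq> 0)"
        using i by (intro poly_openI poly_functions_cdot poly_functions.coord)
      ultimately show ?thesis unfolding i(1) I'_def by blast
    next
      case d
      have "\<exists>v\<in>ortho ?W. det3 (v y) (v z) (v t) \<noteq> 0"
      proof -
        consider "y = x" "z \<in> V" "t \<in> V" | "z = x" "y \<in> V" "t \<in> V" | "t = x" "y \<in> V" "z \<in> V"
          | "y \<in> V" "z \<in> V" "t \<in> V" using d by blast
        then show ?thesis
        proof cases
          case 1
          then obtain s where "s \<in> F" "det3 s (u z) (u t) \<noteq> 0" using D[of z t] d by blast
          then show ?thesis using 1 upd[of s] x by (intro bexI[of _ "u(x := s)"]) auto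
        next
          case 2
          then obtain s where "s \<in> F" "det3 s (u t) (u y) \<noteq> 0" using D[of t y] d by blast
          moreover from this have "det3 (u y) s (u t) \<noteq> 0" using det3_rotate by metis
          ultimately show ?thesis using 2 upd[of s] x by (intro bexI[of _ "u(x := s)"]) auto
        next
          case 3
          then obtain s where "s \<in> F" "det3 s (u y) (u z) \<noteq> 0" using D[of y z] d by blast
          moreover from this have "det3 (u y) (u z) s \<noteq> 0" using det3_rotate by metis
          ultimately show ?thesis using 3 upd[of s] x by (intro bexI[of _ "u(x := s)"]) auto
        next
          case 4
          have "det3 (u y) (u z) (u t) \<noteq> 0"
            using genericD(3)[OF u 4] d by blast
          then show ?thesis using 4 old by (intro bexI[of _ "u(x := s0)"]) auto
        qed
      qed
      moreover have "poly_open ?W (\<lambda>v. det3 (v y) (v z) (v t) \<noteq> 0)"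
        using d by (intro poly_openI poly_functions_det3 poly_functions.coord)
      ultimately show ?thesis unfolding d(1) D'_def by blast
    qed
  qed
  then obtain v where v: "v \<in> ortho ?W" "\<And>P. P \<in> \<P> \<Longrightarrow> P v"
    using irred_finite_open[OF finP irr] by blast
  have "v \<in> generic ?W"
    unfolding generic_def
  proof (intro CollectI conjI ballI impI v(1))
    fix y z assume yz: "y \<in> ?W" "z \<in> ?W"
    show "ccross (v y) (v z) \<noteq> 0" if *: "y \<noteq> z \<and> pt y = pt z"
    proof -
      have "C' y z \<in> \<P>"
        using yz * unfolding \<P>_def by blast
      from v(2)[OF this] show ?thesis by (simp add: C'_def)
    qed
    show "cdot (v y) (v z) \<noteq> 0" if *: "pt y \<noteq> pt z \<and> \<not> adj y z"
    proof -
      have "I' y z \<in> \<P>"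
        using yz * unfolding \<P>_def by blast
      from v(2)[OF this] show ?thesis by (simp add: I'_def)
    qed
    fix t assume t: "t \<in> ?W"
    show "det3 (v y) (v z) (v t) \<noteq> 0"
      if *: "pt y \<and> pt z \<and> pt t \<and> y \<noteq> z \<and> y \<noteq> t \<and> z \<noteq> t \<and> \<not> (\<exists>l\<in>?W. adj l y \<and> adj l z \<and> adj l t)"
    proof -
      have "D' y z t \<in> \<P>"
        using yz t * unfolding \<P>_def by blast
      from v(2)[OF this] show ?thesis by (simp add: D'_def)
    qed
  qed
  then show ?thesis by blast
qed

text \<open>
  The assignments with \<open>v b\<close>, \<open>v c\<close> independent and those with \<open>v a\<close>, \<open>v d\<close> independent are
  irreducible and meet. Where both pairs are dependent, \<open>v b\<close> may be moved freely in the plane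
  orthogonal to \<open>v a\<close>.
\<close>

lemma irred_close:
  assumes irr: "irred (W - {a}) (ortho (W - {a}))" "irred (W - {b}) (ortho (W - {b}))"
    and ab: "a \<in> W" "b \<in> W"
    and nb: "{y \<in> W. adj a y} = {b, c}" "{y \<in> W. adj b y} = {a, d}"
    and ex: "v \<in> ortho W" "ccross (v b) (v c) \<noteq> 0" "ccross (v a) (v d) \<noteq> 0"
  shows "irred W (ortho W)"
proof -
  have bc: "b \<in> W" "c \<in> W" "adj a b" "adj a c" and ad: "d \<in> W" "adj b a" "adj b d"
    using nb by auto
  have neq: "b \<noteq> a" "c \<noteq> a" "d \<noteq> b" using bc ad by auto
  have W: "insert a (W - {a}) = W" "insert b (W - {b}) = W" using ab by auto
  define P1 where "P1 w \<longleftrightarrow> ccross (w b) (w c) \<noteq> 0" for w :: "'v \<Rightarrow> complex ^ 3"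
  define P2 where "P2 w \<longleftrightarrow> ccross (w a) (w d) \<noteq> 0" for w :: "'v \<Rightarrow> complex ^ 3"
  have op: "poly_open W P1" "poly_open W P2"
    unfolding P1_def P2_def using bc ad ab by (auto intro: poly_open_ccross)
  have U1: "irred W {w \<in> ortho W. P1 w}"
  proof -
    have "{y \<in> W - {a}. adj a y} = {b, c}" using nb(1) neq by auto
    moreover have "v \<in> ortho (W - {a})" using ortho_mono[OF ex(1)] by blast
    ultimately show ?thesis
      using irred_between[OF irr(1), of a b c] ex(2) unfolding W P1_def by blast
  qed
  have U2: "irred W {w \<in> ortho W. P2 w}"
  proof -
    have "{y \<in> W - {b}. adj b y} = {a, d}" using nb(2) neq by auto
    moreover have "v \<in> ortho (W - {b})" using ortho_mono[OF ex(1)] by blast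
    ultimately show ?thesis
      using irred_between[OF irr(2), of b a d] ex(3) unfolding W P2_def by blast
  qed
  define D where "D = {w \<in> ortho W. P1 w \<and> P2 w}"
  have v: "v \<in> ortho W" "P1 v" "P2 v" using ex by (auto simp: P1_def P2_def)
  have D: "D = {w \<in> {w \<in> ortho W. P1 w}. P2 w}" "D = {w \<in> {w \<in> ortho W. P2 w}. P1 w}"
    by (auto simp: D_def)
  have irrD: "irred W D" unfolding D(1) by (rule irred_open[OF U1 op(2)]) (use v in blast)
  have hull1: "{w \<in> ortho W. P1 w} \<subseteq> zero_locus_hull W D"
    unfolding D(1) by (rule open_dense[OF U1 op(2)]) (use v in blast)
  have hull2: "{w \<in> ortho W. P2 w} \<subseteq> zero_locus_hull W D"
    unfolding D(2) by (rule open_dense[OF U2 op(1)]) (use v in blast)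
  have "ortho W \<subseteq> zero_locus_hull W D"
  proof
    fix w assume w: "w \<in> ortho W"
    show "w \<in> zero_locus_hull W D"
    proof (cases "P1 w \<or> P2 w")
      case True
      then show ?thesis using hull1 hull2 w by blast
    next
      case False
      then have par: "ccross (w b) (w c) = 0" "ccross (w a) (w d) = 0" by (auto simp: P1_def P2_def)
      obtain k where k: "w d = k *s w a" using parallel_scale[OF par(2)] orthoD(1)[OF w ab(1)] by blast
      \<comment> \<open>As \<open>w d\<close> is a multiple of \<open>w a\<close>, orthogonality to
        \<open>w a\<close> is the only condition at \<open>b\<close>. The direction \<open>s\<close>
        respects it and leads away from the line of \<open>w c\<close>.\<close>
      obtain s where s: "cdot s (w a) = 0" "ccross s (w c) \<noteq> 0"
        using orthogonal_not_parallel[OF orthoD(1)[OF w bc(2)]] by blast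
      define r where "r = (\<lambda>i. if i = b then s else 0)"
      show ?thesis
      proof (rule zero_locus_hull_line[of w r])
        fix t :: complex assume t: "t \<noteq> 0"
        let ?s = "w b + t *s s"
        have eq: "(\<lambda>i. w i + t *s r i) = w(b := ?s)" by (auto simp: r_def)
        \<comment> \<open>Because \<open>w b\<close> is parallel to \<open>w c\<close>, this cross
          product is \<open>t\<close> times that of \<open>s\<close> and \<open>w c\<close>.\<close>
        have cr: "ccross ?s (w c) \<noteq> 0" using par s t by (simp add: ccross_add ccross_scale)
        then have "?s \<noteq> 0" by auto
        moreover have "cdot ?s (w y) = 0" if y: "y \<in> W - {b}" "adj b y" for y
        proof -
          have "cdot ?s (w a) = 0"
            using orthoD(2)[OF w bc(1) ab(1) ad(2)] s by (simp add: cdot_add cdot_scale)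
          moreover have "y = a \<or> y = d" using nb(2) y by auto
          ultimately show ?thesis using k by (auto simp: cdot_scale)
        qed
        ultimately have "w(b := ?s) \<in> ortho (insert b (W - {b}))"
          using ortho_fun_upd[of b "W - {b}" w ?s] ortho_mono[OF w, of "W - {b}"] by blast
        moreover have "c \<noteq> b" using cr ex(2) by auto
        ultimately have "w(b := ?s) \<in> {w \<in> ortho W. P1 w}"
          using cr unfolding W by (simp add: P1_def)
        then show "(\<lambda>i. w i + t *s r i) \<in> zero_locus_hull W D" using hull1 eq by auto
      qed
    qed
  qed
  moreover have "D \<subseteq> ortho W" by (auto simp: D_def)
  ultimately show ?thesis using irred_dense[OF irrD] by blast
qed

text \<open>The two claims need each other: a generic assignment after adding a leaf comes from
  irreducibility, and irreducibility after closing a cycle needs a common point of the two open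
  sets, for which a generic assignment is taken.\<close>

theorem cactus_irred_generic:
  "cactus V \<Longrightarrow> irred V (ortho V) \<and> generic V \<noteq> {}"
proof (induction rule: cactus.induct)
  case empty
  have "ortho {} = UNIV" "generic {} = UNIV" by (auto simp: ortho_def generic_def)
  moreover have "irred {} (UNIV :: ('v \<Rightarrow> complex ^ 3) set)"
  proof -
    have const: "f v = f w" if "f \<in> poly_functions {}" for f and v w :: "'v \<Rightarrow> complex ^ 3"
      using that by induction auto
    show ?thesis unfolding irred_def
    proof (intro conjI ballI impI)
      fix f g :: "('v \<Rightarrow> complex ^ 3) \<Rightarrow> complex"
      assume "f \<in> poly_functions {}" "g \<in> poly_functions {}"
        "(\<exists>v\<in>UNIV. f v \<noteq> 0) \<and> (\<exists>v\<in>UNIV. g v \<noteq> 0)"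
      then show "\<exists>v\<in>UNIV. f v \<noteq> 0 \<and> g v \<noteq> 0" using const by (metis UNIV_I)
    qed simp
  qed
  ultimately show ?case by simp
next
  case (leaf V x)
  have "irred (insert x V) (ortho (insert x V))"
    by (rule irred_leaf) (use leaf in auto)
  moreover from this have "generic (insert x V) \<noteq> {}"
  proof -
    assume irr: "irred (insert x V) (ortho (insert x V))"
    obtain u where u: "u \<in> generic V" using leaf.IH by blast
    show ?thesis
      by (rule generic_leaf[OF irr leaf.hyps(2) cactus_finite[OF leaf.hyps(1)] _ u]) (rule leaf.hyps(3))
  qed
  ultimately show ?case by blast
next
  case (close W a b c d)
  have nba: "y = b \<or> y = c" if "y \<in> W" "adj a y" for y using close.hyps(9) that by auto
  have nbb: "y = a \<or> y = d" if "y \<in> W" "adj b y" for y using close.hyps(10) that by auto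
  have mem: "c \<in> W" "adj a c" "d \<in> W" "adj b d" using close.hyps(9,10) by auto
  have "generic W \<noteq> {}"
  \<comment> \<open>Exactly one of the adjacent vertices \<open>a\<close> and \<open>b\<close> is a
    line; that one is removed and restored by a cross product.\<close>
  proof (cases "pt a")
    case False
    obtain u where u: "u \<in> generic (W - {a})" using close.IH by blast
    have "u(a := ccross (u b) (u c)) \<in> generic W"
    proof (rule generic_close[OF _ False close.hyps(9) close.hyps(6) _ u])
      show False if l: "l \<in> W - {a}" "adj l b" "adj l c" for l
        using nbb[of l] l adj_sym close.hyps(8) by blast
    qed (rule close.hyps)
    then show ?thesis by blast
  next
    case True
    then have b: "\<not> pt b" using adj_pt[OF close.hyps(5)] by blast
    obtain u where u: "u \<in> generic (W - {b})" using close.IH by blast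
    have "u(b := ccross (u a) (u d)) \<in> generic W"
    proof (rule generic_close[OF _ b close.hyps(10) close.hyps(7) _ u])
      show False if l: "l \<in> W - {b}" "adj l a" "adj l d" for l
        using nba[of l] l adj_sym close.hyps(8) by blast
    qed (rule close.hyps)
    then show ?thesis by blast
  qed
  then obtain v where v: "v \<in> generic W" by blast
  have "ccross (v b) (v c) \<noteq> 0"
    using genericD(1)[OF v close.hyps(4) mem(1)] close.hyps(6) adj_pt[OF close.hyps(5)] adj_pt[OF mem(2)] by auto
  moreover have "ccross (v a) (v d) \<noteq> 0"
    using genericD(1)[OF v close.hyps(3) mem(3)] close.hyps(7) adj_pt[OF close.hyps(5)] adj_pt[OF mem(4)] by auto
  ultimately have "irred W (ortho W)"
    using irred_close[OF _ _ close.hyps(3,4,9,10) generic_ortho[OF v]] close.IH by blast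
  then show ?case using v by blast
qed

end

section \<open>The incidence graph of a cactus configuration\<close>

definition incident :: "'a + 'a set \<Rightarrow> 'a + 'a set \<Rightarrow> bool" where
  "incident x y \<longleftrightarrow> (\<exists>p L. p \<in> L \<and> (x = Inl p \<and> y = Inr L \<or> x = Inr L \<and> y = Inl p))"

lemma incident_simps [simp]:
  "incident (Inl p) (Inr L) \<longleftrightarrow> p \<in> L" "incident (Inr L) (Inl p) \<longleftrightarrow> p \<in> L"
  "\<not> incident (Inl p) (Inl q)" "\<not> incident (Inr L) (Inr L')"
  by (auto simp: incident_def)

interpretation incident: bipartite_graph incident isl
  by unfold_locales (auto simp: incident_def)

definition incidence_vertices :: "'a set \<Rightarrow> 'a set set \<Rightarrow> ('a + 'a set) set" where
  "incidence_vertices A \<L> = Inl ` A \<union> Inr ` \<L>"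

lemma incidence_vertices_simps [simp]:
  "Inl p \<in> incidence_vertices A \<L> \<longleftrightarrow> p \<in> A" "Inr L \<in> incidence_vertices A \<L> \<longleftrightarrow> L \<in> \<L>"
  by (auto simp: incidence_vertices_def)

text \<open>The axiom of a partial linear space: two points lie on at most one common line. In the
  incidence graph it excludes four-cycles.\<close>

definition linear_space :: "'a set set \<Rightarrow> bool" where
  "linear_space \<L> \<longleftrightarrow>
     (\<forall>L\<in>\<L>. \<forall>L'\<in>\<L>. \<forall>x y. x \<in> L \<and> y \<in> L \<and> x \<in> L' \<and> y \<in> L' \<and> x \<noteq> y \<longrightarrow> L = L')"

lemma linear_spaceD:
  "linear_space \<L> \<Longrightarrow> L \<in> \<L> \<Longrightarrow> L' \<in> \<L> \<Longrightarrow> x \<in> L \<Longrightarrow> y \<in> L \<Longrightarrow> x \<in> L' \<Longrightarrow> y \<in> L' \<Longrightarrow>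
    x \<noteq> y \<Longrightarrow> L = L'"
  unfolding linear_space_def by metis

section \<open>The building blocks as point-line geometries\<close>

definition ring_of_lines :: "'a set \<Rightarrow> 'a set set \<Rightarrow> nat \<Rightarrow> (nat \<Rightarrow> 'a set) \<Rightarrow> (nat \<Rightarrow> 'a) \<Rightarrow> bool" where
  "ring_of_lines G \<L> n l p \<longleftrightarrow> 3 \<le> n \<and> bij_betw l {..<n} \<L> \<and>
     (\<forall>i<n. p i \<in> G \<and> {L \<in> \<L>. p i \<in> L} = {l i, l (Suc i mod n)}) \<and>
     (\<forall>x\<in>G - p ` {..<n}. card {L \<in> \<L>. x \<in> L} = 1)"

text \<open>A line matroid or a cycle reduced to its points and lines, without its independent sets.
  In this form the renaming of a point in a gluing is easy to follow.\<close>

definition cactus_piece :: "'a set \<Rightarrow> 'a set set \<Rightarrow> bool" where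
  "cactus_piece G \<L> \<longleftrightarrow> finite G \<and> (\<forall>L\<in>\<L>. L \<subseteq> G \<and> 3 \<le> card L) \<and>
     (\<L> = {G} \<or> (\<exists>n l p. ring_of_lines G \<L> n l p))"

text \<open>Edges of a cycle are determined by their end points. This fails for
  \<open>n = 2\<close>, where both edges have the same ends.\<close>

lemma Suc_mod_cycle_inj:
  assumes "3 \<le> n" "i < n" "j < n" "{i, Suc i mod n} = {j, Suc j mod n}"
  shows "i = j"
proof -
  have "Suc i mod n = (if Suc i = n then 0 else Suc i)" "Suc j mod n = (if Suc j = n then 0 else Suc j)"
    using assms by auto
  then have "{i, if Suc i = n then 0 else Suc i} = {j, if Suc j = n then 0 else Suc j}"
    using assms(4) by simp
  then show ?thesis using assms(1) by (auto simp: doubleton_eq_iff split: if_splits)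
qed

lemma ring_of_linesD:
  assumes "ring_of_lines G \<L> n l p"
  shows "3 \<le> n" "bij_betw l {..<n} \<L>" "i < n \<Longrightarrow> p i \<in> G"
    and "i < n \<Longrightarrow> j < n \<Longrightarrow> l i = l j \<longleftrightarrow> i = j"
    and "i < n \<Longrightarrow> l i \<in> \<L>"
    and "i < n \<Longrightarrow> j < n \<Longrightarrow> p i \<in> l j \<longleftrightarrow> j = i \<or> j = Suc i mod n"
    and "i < n \<Longrightarrow> j < n \<Longrightarrow> p i = p j \<longleftrightarrow> i = j"
    and "i < n \<Longrightarrow> {L \<in> \<L>. p i \<in> L} = {l i, l (Suc i mod n)}"
    and "x \<in> G \<Longrightarrow> x \<notin> p ` {..<n} \<Longrightarrow> card {L \<in> \<L>. x \<in> L} = 1"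
proof -
  show n: "3 \<le> n" and bij: "bij_betw l {..<n} \<L>" using assms by (auto simp: ring_of_lines_def)
  show "i < n \<Longrightarrow> p i \<in> G" using assms by (auto simp: ring_of_lines_def)
  show eq: "{L \<in> \<L>. p i \<in> L} = {l i, l (Suc i mod n)}" if "i < n" for i
    using assms that by (auto simp: ring_of_lines_def)
  show leq: "l i = l j \<longleftrightarrow> i = j" if "i < n" "j < n" for i j
    using bij that by (auto simp: bij_betw_def inj_on_def)
  show lin: "l i \<in> \<L>" if "i < n" for i using bij that by (auto simp: bij_betw_def)
  show mem: "p i \<in> l j \<longleftrightarrow> j = i \<or> j = Suc i mod n" if "i < n" "j < n" for i j
  proof -
    have "p i \<in> l j \<longleftrightarrow> l j \<in> {L \<in> \<L>. p i \<in> L}" using lin[OF that(2)] by simp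
    also have "\<dots> \<longleftrightarrow> l j = l i \<or> l j = l (Suc i mod n)" unfolding eq[OF that(1)] by simp
    finally show ?thesis using leq[of j] that n by simp
  qed
  show "p i = p j \<longleftrightarrow> i = j" if "i < n" "j < n" for i j
  proof
    assume "p i = p j"
    \<comment> \<open>A joint determines the indices of its two lines, and this pair is an edge of
      the index cycle, which determines the index of the joint.\<close>
    then have "k = i \<or> k = Suc i mod n \<longleftrightarrow> k = j \<or> k = Suc j mod n" if "k < n" for k
      using mem[OF \<open>i < n\<close> that] mem[OF \<open>j < n\<close> that] by simp
    moreover have "Suc i mod n < n" "Suc j mod n < n" using n by auto
    ultimately have "{i, Suc i mod n} = {j, Suc j mod n}" using that by blast
    then show "i = j" using Suc_mod_cycle_inj n that by blast
  qed simp
  show "x \<in> G \<Longrightarrow> x \<notin> p ` {..<n} \<Longrightarrow> card {L \<in> \<L>. x \<in> L} = 1"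
    using assms by (auto simp: ring_of_lines_def)
qed

text \<open>A point on two lines of a ring must be a joint, since every other point lies on one line
  only. Two common points would thus be joints of the same pair of lines, hence equal.\<close>

lemma linear_space_piece:
  assumes "cactus_piece G \<L>"
  shows "linear_space \<L>"
proof (cases "\<L> = {G}")
  case True
  then show ?thesis by (auto simp: linear_space_def)
next
  case False
  then obtain n l p where R: "ring_of_lines G \<L> n l p" using assms by (auto simp: cactus_piece_def)
  note RD = ring_of_linesD[OF R]
  show ?thesis
    unfolding linear_space_def
  proof (intro ballI allI impI)
    fix L L' x y assume LL: "L \<in> \<L>" "L' \<in> \<L>" and xy: "x \<in> L \<and> y \<in> L \<and> x \<in> L' \<and> y \<in> L' \<and> x \<noteq> y"
    show "L = L'"
    proof (rule ccontr)
      assume ne: "L \<noteq> L'"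
      have G: "x \<in> G" "y \<in> G" using xy LL assms by (auto simp: cactus_piece_def)
      have *: "\<exists>i<n. z = p i \<and> {l i, l (Suc i mod n)} = {L, L'}" if z: "z \<in> G" "z \<in> L" "z \<in> L'" for z
      proof -
        have "z \<in> p ` {..<n}"
        proof (rule ccontr)
          assume "z \<notin> p ` {..<n}"
          then obtain K where "{L \<in> \<L>. z \<in> L} = {K}" using RD(9)[OF z(1)] card_1_singletonE by metis
          moreover have "L \<in> {L \<in> \<L>. z \<in> L}" "L' \<in> {L \<in> \<L>. z \<in> L}" using LL z by auto
          ultimately show False using ne by simp
        qed
        then obtain i where i: "i < n" "z = p i" by auto
        then have "L \<in> {l i, l (Suc i mod n)}" "L' \<in> {l i, l (Suc i mod n)}"
          using RD(8)[OF i(1)] LL z by auto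
        then show ?thesis using i ne by blast
      qed
      obtain i j where ij: "i < n" "x = p i" "{l i, l (Suc i mod n)} = {L, L'}"
          "j < n" "y = p j" "{l j, l (Suc j mod n)} = {L, L'}"
        using *[OF G(1)] *[OF G(2)] xy by blast
      have "l ` {i, Suc i mod n} = l ` {j, Suc j mod n}" using ij by simp
      moreover have "inj_on l {..<n}" using RD(2) by (simp add: bij_betw_def)
      moreover have "{i, Suc i mod n} \<subseteq> {..<n}" "{j, Suc j mod n} \<subseteq> {..<n}" using ij RD(1) by auto
      ultimately have "{i, Suc i mod n} = {j, Suc j mod n}" using inj_on_image_eq_iff by metis
      then show False using Suc_mod_cycle_inj[OF RD(1) ij(1,4)] ij xy by blast
    qed
  qed
qed

lemma cactus_piece_image:
  assumes f: "inj_on f G" and P: "cactus_piece G \<L>"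
  shows "cactus_piece (f ` G) ((`) f ` \<L>)"
proof -
  have sub: "L \<subseteq> G" if "L \<in> \<L>" for L using P that by (auto simp: cactus_piece_def)
  have inj: "inj_on ((`) f) \<L>"
    using inj_on_image[of f \<L>] f sub by (meson Sup_least inj_on_subset)
  have mem: "f x \<in> f ` L \<longleftrightarrow> x \<in> L" if "x \<in> G" "L \<in> \<L>" for x L
    using inj_on_image_mem_iff[OF f that(1) sub[OF that(2)]] .
  have set: "{K \<in> (`) f ` \<L>. f x \<in> K} = (`) f ` {L \<in> \<L>. x \<in> L}" if "x \<in> G" for x
    using mem[OF that] by blast
  have ring: "ring_of_lines (f ` G) ((`) f ` \<L>) n (\<lambda>i. f ` l i) (\<lambda>i. f (p i))"
    if R: "ring_of_lines G \<L> n l p" for n l p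
    unfolding ring_of_lines_def
  proof (intro conjI allI ballI impI)
    show "3 \<le> n" using ring_of_linesD(1)[OF R] .
    show "bij_betw (\<lambda>i. f ` l i) {..<n} ((`) f ` \<L>)"
      using bij_betw_trans[OF ring_of_linesD(2)[OF R] inj_on_imp_bij_betw[OF inj]] by (simp add: comp_def)
    fix i assume i: "i < n"
    then show "f (p i) \<in> f ` G" using ring_of_linesD(3)[OF R] by blast
    show "{L \<in> (`) f ` \<L>. f (p i) \<in> L} = {f ` l i, f ` l (Suc i mod n)}"
      using set[of "p i"] ring_of_linesD(3,8)[OF R i] by simp
  next
    fix y assume "y \<in> f ` G - (\<lambda>i. f (p i)) ` {..<n}"
    then obtain x where x: "x \<in> G" "y = f x" "x \<notin> p ` {..<n}" by blast
    have "card ((`) f ` {L \<in> \<L>. x \<in> L}) = card {L \<in> \<L>. x \<in> L}"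
      by (intro card_image inj_on_subset[OF inj]) auto
    then show "card {L \<in> (`) f ` \<L>. y \<in> L} = 1"
      using set[OF x(1)] ring_of_linesD(9)[OF R x(1,3)] x(2) by simp
  qed
  have "card (f ` L) = card L" if "L \<in> \<L>" for L
    by (intro card_image inj_on_subset[OF f] sub that)
  moreover have "f ` L \<subseteq> f ` G" if "L \<in> \<L>" for L using sub[OF that] by blast
  moreover have "(`) f ` \<L> = {f ` G} \<or> (\<exists>n l p. ring_of_lines (f ` G) ((`) f ` \<L>) n l p)"
  proof (cases "\<L> = {G}")
    case False
    then obtain n l p where "ring_of_lines G \<L> n l p" using P unfolding cactus_piece_def by auto
    then show ?thesis using ring by blast
  qed simp
  ultimately show ?thesis
    using P unfolding cactus_piece_def by simp
qed

lemma add_mod_cancel: "(x + k) mod m = (y + k) mod m \<longleftrightarrow> x mod m = y mod (m::nat)"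
  unfolding nat_mod_eq_iff by simp

text \<open>In the incidence graph a ring of \<open>n\<close> lines is a cycle of length
  \<open>2 * n\<close>, at least six. If \<open>r\<close> is a joint, this cycle is attached at
  \<open>r\<close>. Otherwise \<open>r\<close> lies on a single line of the ring; that line is added
  as a leaf of \<open>r\<close>, and the cycle is attached at the line. The remaining points become
  leaves.\<close>

lemma cactus_attach_piece:
  assumes V: "incident.cactus (incidence_vertices A \<B>)"
    and r: "r \<in> A" "A \<inter> G = {r}" and \<B>: "\<And>B. B \<in> \<B> \<Longrightarrow> B \<subseteq> A" and P: "cactus_piece G \<L>"
  shows "incident.cactus (incidence_vertices (A \<union> G) (\<B> \<union> \<L>))"
proof -
  let ?V = "incidence_vertices A \<B>"
  have fin: "finite G" and LG: "\<And>L. L \<in> \<L> \<Longrightarrow> L \<subseteq> G" "\<And>L. L \<in> \<L> \<Longrightarrow> 3 \<le> card L"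
    using P by (auto simp: cactus_piece_def)
  \<comment> \<open>A line on both sides would be contained in the one common point.\<close>
  have new_line: "L \<notin> \<B>" if "L \<in> \<L>" for L
  proof
    assume "L \<in> \<B>"
    then have "L \<subseteq> {r}" using LG[OF that] \<B> r by blast
    then have "card L \<le> 1" using card_mono[of "{r}" L] by simp
    then show False using LG(2)[OF that] by simp
  qed
  have line_nb: "y = Inl r \<and> r \<in> L" if "L \<in> \<L>" "y \<in> ?V" "incident (Inr L) y" for L y
    using that LG(1)[OF that(1)] r by (cases y) auto
  have point_nb: False if "x \<in> G" "x \<noteq> r" "y \<in> ?V" "incident (Inl x) y" for x y
    using that r \<B> by (cases y) auto
  show ?thesis
  proof (cases "\<L> = {G}")
    case True
    have "incident.cactus (insert (Inr G) ?V)"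
      by (rule incident.cactus_leaf[OF V]) (use line_nb True in blast)
    then have "incident.cactus (insert (Inr G) ?V \<union> Inl ` (G - {r}))"
    proof (rule incident.cactus_leaves[rotated])
      show "finite (Inl ` (G - {r}))" using fin by simp
      show "y = z" if "x \<in> Inl ` (G - {r})" "y \<in> insert (Inr G) ?V" "z \<in> insert (Inr G) ?V"
        "incident x y" "incident x z" for x y z
        using that point_nb by blast
      show "\<not> incident x y" if "x \<in> Inl ` (G - {r})" "y \<in> Inl ` (G - {r})" for x y
        using that by auto
    qed
    moreover have "insert (Inr G) ?V \<union> Inl ` (G - {r}) = incidence_vertices (A \<union> G) (\<B> \<union> \<L>)"
      using True r unfolding incidence_vertices_def by blast
    ultimately show ?thesis by simp
  next
    case False
    then obtain n l p where R: "ring_of_lines G \<L> n l p" using P by (auto simp: cactus_piece_def)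
    note RD = ring_of_linesD[OF R]
    define m where "m = 2 * n"
    \<comment> \<open>Lines at even and joints at odd positions; the joint \<open>p i\<close> sits
      between \<open>l i\<close> and its successor.\<close>
    define c where "c k = (if even k then Inr (l (k div 2)) else Inl (p (k div 2)))" for k
    have c_simps: "c (2 * i) = Inr (l i)" "c (Suc (2 * i)) = Inl (p i)" for i by (simp_all add: c_def)
    have idx: "(\<exists>i<n. k = 2 * i) \<or> (\<exists>i<n. k = Suc (2 * i))" if "k < m" for k
      using that unfolding m_def by (metis Suc_lessD nat_mult_less_cancel1 oddE evenE Suc_eq_plus1 zero_less_numeral)
    have c_image: "c ` {..<m} = Inr ` \<L> \<union> Inl ` p ` {..<n}"
    proof -
      have "\<L> = l ` {..<n}" using RD(2) by (simp add: bij_betw_def)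
      moreover have "c ` {..<m} = (\<lambda>i. Inr (l i)) ` {..<n} \<union> (\<lambda>i. Inl (p i)) ` {..<n}"
      proof (intro set_eqI iffI)
        fix x assume "x \<in> c ` {..<m}"
        then show "x \<in> (\<lambda>i. Inr (l i)) ` {..<n} \<union> (\<lambda>i. Inl (p i)) ` {..<n}"
          using idx c_simps by fastforce
      next
        fix x assume "x \<in> (\<lambda>i. Inr (l i)) ` {..<n} \<union> (\<lambda>i. Inl (p i)) ` {..<n}"
        then obtain i where "i < n" "x = c (2 * i) \<or> x = c (Suc (2 * i))" using c_simps by auto
        then show "x \<in> c ` {..<m}" unfolding m_def by auto
      qed
      ultimately show ?thesis by (simp add: image_image)
    qed
    have c_eq: "c a = c b \<longleftrightarrow> a = b" if "a < m" "b < m" for a b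
      using idx[OF that(1)] idx[OF that(2)] RD(4,7) by (auto simp: c_simps)
    have Suc_mod_even: "Suc (2 * i) mod m = Suc (2 * i)" if "i < n" for i
      using that by (simp add: m_def)
    \<comment> \<open>Doubling carries reduction modulo \<open>n\<close> to reduction modulo
      \<open>m\<close>, so the step from the last joint wraps around to the line
      \<open>l 0\<close>.\<close>
    have Suc_mod_odd: "Suc (Suc (2 * i)) mod m = 2 * (Suc i mod n)" for i
      using mult_mod_right[of 2 "Suc i" n] by (simp add: m_def)
    have c_adj: "incident (c a) (c b) \<longleftrightarrow> b = Suc a mod m \<or> a = Suc b mod m" if ab: "a < m" "b < m" for a b
    proof -
      have par: "2 * i \<noteq> Suc (2 * j)" "Suc (2 * j) \<noteq> 2 * i" for i j :: nat by presburger+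
      have 1: "2 * i = Suc (2 * j) mod m \<longleftrightarrow> False" if "j < n" for i j
        unfolding Suc_mod_even[OF that] by (simp add: par)
      have 2: "Suc (2 * i) = Suc (Suc (2 * j)) mod m \<longleftrightarrow> False" for i j
        unfolding Suc_mod_odd by (simp add: par)
      consider i j where "i < n" "j < n" "a = 2 * i" "b = 2 * j"
        | i j where "i < n" "j < n" "a = Suc (2 * i)" "b = Suc (2 * j)"
        | i j where "i < n" "j < n" "a = 2 * i" "b = Suc (2 * j)"
        | i j where "i < n" "j < n" "a = Suc (2 * i)" "b = 2 * j"
        using idx[OF ab(1)] idx[OF ab(2)] by blast
      then show ?thesis
      proof cases
        case 1
        then show ?thesis by (simp add: c_simps Suc_mod_even par)
      next
        case 2
        then show ?thesis by (simp add: c_simps Suc_mod_odd par)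
      next
        case 3
        then show ?thesis using RD(6)[of j i] by (auto simp: c_simps Suc_mod_even Suc_mod_odd)
      next
        case 4
        then show ?thesis using RD(6)[of i j] by (auto simp: c_simps Suc_mod_even Suc_mod_odd)
      qed
    qed
    \<comment> \<open>\<open>c k\<close> is the vertex where the ring meets the old graph: either
      \<open>r\<close>, or the line through \<open>r\<close>. \<open>W\<close> is the old graph with
      this vertex included, so both cases continue alike.\<close>
    obtain k W where W: "incident.cactus W" "?V \<subseteq> W" "W \<subseteq> ?V \<union> c ` {..<m}"
      and k: "k < m" "c k \<in> W"
      and new: "\<And>i. i < m \<Longrightarrow> i \<noteq> k \<Longrightarrow> c i \<notin> W"
      and old: "\<And>i y. i < m \<Longrightarrow> i \<noteq> k \<Longrightarrow> y \<in> W \<Longrightarrow> incident (c i) y \<Longrightarrow> y = c k"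
    proof (cases "r \<in> p ` {..<n}")
      case True
      then obtain i where i: "i < n" "r = p i" by auto
      show ?thesis
      proof (rule that[of ?V "Suc (2 * i)"])
        show "Suc (2 * i) < m" using i by (simp add: m_def)
        show "c (Suc (2 * i)) \<in> ?V" using r i by (simp add: c_simps)
        fix j assume j: "j < m" "j \<noteq> Suc (2 * i)"
        consider a where "a < n" "j = 2 * a" | a where "a < n" "j = Suc (2 * a)" "a \<noteq> i"
          using idx[OF j(1)] j(2) by blast
        note cs = this
        show "c j \<notin> ?V"
          using cs
        proof cases
          case 1
          then show ?thesis using new_line RD(5) by (simp add: c_simps)
        next
          case 2
          then have "p a \<noteq> r" using RD(7)[of a i] i by simp
          then show ?thesis using 2 r RD(3)[of a] by (auto simp: c_simps)
        qed
        fix y assume y: "y \<in> ?V" "incident (c j) y"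
        show "y = c (Suc (2 * i))"
          using cs
        proof cases
          case 1
          then show ?thesis using line_nb[OF RD(5)[of a] y(1)] y i by (simp add: c_simps)
        next
          case 2
          then have "p a \<noteq> r" using RD(7)[of a i] i by simp
          then show ?thesis using point_nb[OF RD(3)[of a] _ y(1)] y 2 by (simp add: c_simps)
        qed
      qed (use V in auto)
    next
      case r_new: False
      have rG: "r \<in> G" using r by blast
      obtain K where K: "{L \<in> \<L>. r \<in> L} = {K}" using RD(9)[OF rG r_new] card_1_singletonE by metis
      then have "K \<in> \<L>" "r \<in> K" by auto
      then obtain i where i: "i < n" "K = l i" using RD(2) by (auto simp: bij_betw_def)
      have uniq: "a = i" if "a < n" "r \<in> l a" for a
        proof -
        have "l a \<in> {L \<in> \<L>. r \<in> L}" using RD(5)[OF that(1)] that by simp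
        then show ?thesis using K i RD(4)[OF that(1) i(1)] by simp
      qed
      show ?thesis
      proof (rule that[of "insert (Inr (l i)) ?V" "2 * i"])
        show "incident.cactus (insert (Inr (l i)) ?V)"
          by (rule incident.cactus_leaf[OF V]) (use line_nb RD(5)[OF i(1)] in blast)
        show "insert (Inr (l i)) ?V \<subseteq> ?V \<union> c ` {..<m}"
          using c_image RD(5)[OF i(1)] by auto
        show "2 * i < m" using i by (simp add: m_def)
        show "c (2 * i) \<in> insert (Inr (l i)) ?V" by (simp add: c_simps)
        fix j assume j: "j < m" "j \<noteq> 2 * i"
        consider a where "a < n" "j = 2 * a" "a \<noteq> i" | a where "a < n" "j = Suc (2 * a)"
          using idx[OF j(1)] j(2) by blast
        note cs = this
        show "c j \<notin> insert (Inr (l i)) ?V"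
          using cs
        proof cases
          case 1
          then show ?thesis using new_line RD(5)[of a] RD(4)[of a i] i by (simp add: c_simps)
        next
          case 2
          then have "p a \<noteq> r" using r_new by auto
          then show ?thesis using 2 r RD(3)[of a] by (auto simp: c_simps)
        qed
        fix y assume y: "y \<in> insert (Inr (l i)) ?V" "incident (c j) y"
        show "y = c (2 * i)"
          using cs
        proof cases
          case 1
          then have "y \<noteq> Inr (l i)" using y(2) by (auto simp: c_simps)
          then have "r \<in> l a" using line_nb[OF RD(5)[of a], of y] y 1 by (simp add: c_simps)
          then show ?thesis using uniq 1 by blast
        next
          case 2
          then have "p a \<noteq> r" using r_new by auto
          then show ?thesis using point_nb[OF RD(3)[of a], of y] y 2 by (auto simp: c_simps)
        qed
      qed auto
    qed
    \<comment> \<open>\<open>cactus_cycle\<close> wants the attaching vertex at index 0, so the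
      numbering is rotated by \<open>k\<close>.\<close>
    define \<sigma> where "\<sigma> i = (i + k) mod m" for i
    have m: "5 \<le> m" using RD(1) by (simp add: m_def)
    have \<sigma>m: "\<sigma> i < m" for i using m by (simp add: \<sigma>_def)
    have \<sigma>_eq: "\<sigma> i = \<sigma> j \<longleftrightarrow> i = j" if "i < m" "j < m" for i j
      unfolding \<sigma>_def add_mod_cancel using that by simp
    have \<sigma>0: "\<sigma> 0 = k" using k by (simp add: \<sigma>_def)
    have Suc_\<sigma>: "Suc (\<sigma> i) mod m = \<sigma> (Suc i)" for i
      unfolding \<sigma>_def by (simp add: mod_Suc_eq)
    have \<sigma>_image: "\<sigma> ` {..<m} = {..<m}"
      using endo_inj_surj[of "{..<m}" \<sigma>] \<sigma>m \<sigma>_eq by (force simp: inj_on_def)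
    have \<sigma>0_iff: "\<sigma> i \<noteq> k" if "0 < i" "i < m" for i
      using \<sigma>_eq[of i 0] \<sigma>0 that by auto
    have "incident.cactus (W \<union> (\<lambda>i. c (\<sigma> i)) ` {..<m})"
    proof (rule incident.cactus_cycle[OF W(1) m])
      show "inj_on (\<lambda>i. c (\<sigma> i)) {..<m}" using c_eq \<sigma>m \<sigma>_eq by (auto simp: inj_on_def)
      show "c (\<sigma> 0) \<in> W" using \<sigma>0 k by simp
      show "c (\<sigma> i) \<notin> W" if "0 < i" "i < m" for i using new \<sigma>m \<sigma>0_iff[OF that] by blast
      show "y = c (\<sigma> 0)" if "0 < i" "i < m" "y \<in> W" "incident (c (\<sigma> i)) y" for i y
        using old[OF \<sigma>m \<sigma>0_iff[OF that(1,2)] that(3,4)] \<sigma>0 by simp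
      show "incident (c (\<sigma> i)) (c (\<sigma> j)) \<longleftrightarrow> j = Suc i \<or> i = 0 \<and> Suc j = m" if ij: "i < j" "j < m" for i j
      proof -
        have "incident (c (\<sigma> i)) (c (\<sigma> j)) \<longleftrightarrow> \<sigma> j = \<sigma> (Suc i) \<or> \<sigma> i = \<sigma> (Suc j)"
          using c_adj[OF \<sigma>m \<sigma>m, of i j] unfolding Suc_\<sigma> .
        also have "\<sigma> j = \<sigma> (Suc i) \<longleftrightarrow> j = Suc i" using ij by (intro \<sigma>_eq) auto
        also have "\<sigma> i = \<sigma> (Suc j) \<longleftrightarrow> i = 0 \<and> Suc j = m"
        proof -
          have "\<sigma> i = \<sigma> (Suc j) \<longleftrightarrow> i mod m = Suc j mod m" unfolding \<sigma>_def add_mod_cancel ..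
          then show ?thesis using ij by (cases "Suc j = m") auto
        qed
        finally show ?thesis .
      qed
    qed
    moreover have "(\<lambda>i. c (\<sigma> i)) ` {..<m} = c ` {..<m}"
      using \<sigma>_image by (metis image_image)
    ultimately have U: "incident.cactus (?V \<union> (Inr ` \<L> \<union> Inl ` p ` {..<n}))"
    proof -
      assume *: "incident.cactus (W \<union> (\<lambda>i. c (\<sigma> i)) ` {..<m})" "(\<lambda>i. c (\<sigma> i)) ` {..<m} = c ` {..<m}"
      have "W \<union> c ` {..<m} = ?V \<union> c ` {..<m}" using W by blast
      then show ?thesis using * c_image by simp
    qed
    let ?U = "?V \<union> (Inr ` \<L> \<union> Inl ` p ` {..<n})"
    \<comment> \<open>These points lie on exactly one line of the ring and on no old line.\<close>
    let ?X = "Inl ` (G - p ` {..<n} - {r}) :: ('a + 'a set) set"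
    have "incident.cactus (?U \<union> ?X)"
    proof (rule incident.cactus_leaves[OF _ U])
      show "finite ?X" using fin by simp
      show "\<not> incident x y" if "x \<in> ?X" "y \<in> ?X" for x y using that by auto
      fix x y z assume *: "x \<in> ?X" "y \<in> ?U" "z \<in> ?U" "incident x y" "incident x z"
      obtain q where q: "q \<in> G" "q \<notin> p ` {..<n}" "q \<noteq> r" "x = Inl q" using *(1) by auto
      obtain K where K: "{L \<in> \<L>. q \<in> L} = {K}" using RD(9)[OF q(1,2)] card_1_singletonE by metis
      have "w = Inr K" if w: "w \<in> ?U" "incident x w" for w
      proof -
        have "w \<notin> ?V" using point_nb[OF q(1,3)] w q by blast
        then show ?thesis using w q K by auto
      qed
      then show "y = z" using * by blast
    qed
    moreover have "?U \<union> ?X = incidence_vertices (A \<union> G) (\<B> \<union> \<L>)"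
      using r RD(3) unfolding incidence_vertices_def by blast
    ultimately show ?thesis by simp
  qed
qed

section \<open>Lines as maximal sets with dependent triples\<close>

lemma triples_dependent_iff:
  "triples_dependent M L \<longleftrightarrow>
     L \<subseteq> ground M \<and> 3 \<le> card L \<and> (\<forall>T\<subseteq>L. card T = 3 \<longrightarrow> T \<notin> indeps M)"
  unfolding triples_dependent_def dependent_sets_def by blast

lemma lineD:
  assumes "L \<in> lines M"
  shows "triples_dependent M L" "L \<subseteq> ground M" "3 \<le> card L"
  using assms by (auto simp: lines_def triples_dependent_iff)

lemma lineI:
  "triples_dependent M L \<Longrightarrow> (\<And>L'. triples_dependent M L' \<Longrightarrow> L \<subseteq> L' \<Longrightarrow> L' = L) \<Longrightarrow> L \<in> lines M"
  unfolding lines_def by blast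

lemma line_maximal: "L \<in> lines M \<Longrightarrow> triples_dependent M L' \<Longrightarrow> L \<subseteq> L' \<Longrightarrow> L' = L"
  unfolding lines_def by blast

lemma triples_dependent_extends:
  assumes "finite (ground M)" "triples_dependent M L"
  obtains L' where "L' \<in> lines M" "L \<subseteq> L'"
proof -
  have "{K. triples_dependent M K} \<subseteq> Pow (ground M)" by (auto simp: triples_dependent_iff)
  then have "finite {K. triples_dependent M K}" using assms(1) finite_subset by blast
  then obtain L' where L': "triples_dependent M L'" "L \<subseteq> L'"
    and max: "\<And>K. triples_dependent M K \<Longrightarrow> L' \<subseteq> K \<Longrightarrow> K = L'"
    using finite_has_maximal2[of "{K. triples_dependent M K}" L] assms(2) by auto
  show ?thesis by (rule that[OF lineI]) (use L' max in auto)
qed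

lemma two_common_points:
  assumes "3 \<le> card L" "L \<subseteq> K"
  obtains x y where "x \<in> L" "y \<in> L" "x \<in> K" "y \<in> K" "x \<noteq> y"
proof -
  have "2 \<le> card L" using assms(1) by simp
  then obtain T where "T \<subseteq> L" "card T = 2" using obtain_subset_with_card_n by metis
  then obtain x y where "x \<in> L" "y \<in> L" "x \<noteq> y" by (auto simp: card_2_iff)
  then show ?thesis using that[of x y] assms(2) by blast
qed

text \<open>In a set all of whose triples are collinear, fix two points: every triple containing
  them lies on the same line of the partial linear space, so that line contains the whole set. Lines
  of \<G> are maximal for the same reason.\<close>

lemma lines_of_linear_space:
  assumes E: "finite E" and \<G>: "\<And>L. L \<in> \<G> \<Longrightarrow> L \<subseteq> E" "\<And>L. L \<in> \<G> \<Longrightarrow> 3 \<le> card L"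
    and lin: "linear_space \<G>"
    and gr: "ground N = E"
    and ind: "\<And>T. T \<subseteq> E \<Longrightarrow> card T = 3 \<Longrightarrow> T \<in> indeps N \<longleftrightarrow> \<not> (\<exists>L\<in>\<G>. T \<subseteq> L)"
  shows "lines N = \<G>"
proof -
  have dep: "triples_dependent N L" if "L \<in> \<G>" for L
    using \<G>[OF that] that ind gr unfolding triples_dependent_iff by blast
  have sub: "\<exists>K\<in>\<G>. L \<subseteq> K" if L: "triples_dependent N L" for L
  proof -
    have LE: "L \<subseteq> E" "3 \<le> card L" and LT: "\<And>T. T \<subseteq> L \<Longrightarrow> card T = 3 \<Longrightarrow> \<exists>K\<in>\<G>. T \<subseteq> K"
      using L ind gr unfolding triples_dependent_iff by blast+
    obtain T where T: "T \<subseteq> L" "card T = 3" using obtain_subset_with_card_n[OF LE(2)] by auto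
    then obtain a b c where abc: "T = {a, b, c}" "a \<noteq> b" "a \<noteq> c" "b \<noteq> c" by (auto simp: card_3_iff)
    obtain K where K: "K \<in> \<G>" "T \<subseteq> K" using LT[OF T] by blast
    have "x \<in> K" if x: "x \<in> L" for x
    proof (cases "x \<in> T")
      case True
      then show ?thesis using K by blast
    next
      case False
      then have "card {a, b, x} = 3" "{a, b, x} \<subseteq> L" using abc T x by auto
      then obtain K' where K': "K' \<in> \<G>" "{a, b, x} \<subseteq> K'" using LT by blast
      then have "K = K'" using linear_spaceD[OF lin K(1) K'(1), of a b] K abc by auto
      then show ?thesis using K' by blast
    qed
    then show ?thesis using K by blast
  qed
  have eq: "K = L" if KL: "K \<in> \<G>" "L \<in> \<G>" "L \<subseteq> K" for K L
  proof -
    obtain x y where "x \<in> L" "y \<in> L" "x \<in> K" "y \<in> K" "x \<noteq> y"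
      using two_common_points[OF \<G>(2)[OF KL(2)] KL(3)] .
    then show ?thesis using linear_spaceD[OF lin KL(1,2), of x y] by simp
  qed
  show ?thesis
  proof (intro set_eqI iffI)
    fix L assume L: "L \<in> lines N"
    then obtain K where K: "K \<in> \<G>" "L \<subseteq> K" using sub lineD(1) by blast
    then show "L \<in> \<G>" using line_maximal[OF L dep[OF K(1)] K(2)] by simp
  next
    fix L assume L: "L \<in> \<G>"
    show "L \<in> lines N"
    proof (rule lineI[OF dep[OF L]])
      fix L' assume L': "triples_dependent N L'" "L \<subseteq> L'"
      then obtain K where K: "K \<in> \<G>" "L' \<subseteq> K" using sub by blast
      then have "K = L" using eq[OF K(1) L] L' by blast
      then show "L' = L" using K L' by blast
    qed
  qed
qed

section \<open>Incidence graphs of building blocks, gluings and components\<close>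

lemma cactus_piece_line_matroid:
  assumes "line_matroid N"
  shows "cactus_piece (ground N) (lines N)"
proof -
  obtain E where E: "finite E" "3 \<le> card E" "N = uniform_matroid 2 E"
    using assms by (auto simp: line_matroid_def)
  have "lines N = {E}"
    by (rule lines_of_linear_space[of E]) (use E in \<open>auto simp: uniform_matroid_def linear_space_def\<close>)
  then show ?thesis using E by (auto simp: cactus_piece_def uniform_matroid_def)
qed

lemma cactus_piece_cycle_matroid:
  assumes "cycle_matroid N"
  shows "cactus_piece (ground N) (lines N)"
proof -
  have "finite (ground N)" using assms by (auto simp: cycle_matroid_def simple_matroid_def matroid_def)
  moreover have "\<exists>n l p. ring_of_lines (ground N) (lines N) n l p"
    using assms unfolding cycle_matroid_def ring_of_lines_def lines_through_def by blast
  moreover have "L \<subseteq> ground N \<and> 3 \<le> card L" if "L \<in> lines N" for L using lineD[OF that] by blast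
  ultimately show ?thesis by (simp add: cactus_piece_def)
qed

text \<open>Linearity is part of the invariant because it is what identifies the lines of a free
  gluing with the glued lines.\<close>

definition cactus_incidence :: "'a set_system \<Rightarrow> bool" where
  "cactus_incidence M \<longleftrightarrow> finite (ground M) \<and> linear_space (lines M) \<and>
     incident.cactus (incidence_vertices (ground M) (lines M))"

text \<open>A piece standing alone is treated as attached to a graph consisting of one of its
  points.\<close>

lemma cactus_incidence_piece:
  assumes "cactus_piece (ground N) (lines N)" "ground N \<noteq> {}"
  shows "cactus_incidence N"
proof -
  obtain r where r: "r \<in> ground N" using assms(2) by blast
  have "incident.cactus {Inl r}"
    using incident.cactus_leaf[OF incident.cactus.empty] by simp
  then have "incident.cactus (incidence_vertices {r} {})" by (simp add: incidence_vertices_def)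
  then have "incident.cactus (incidence_vertices ({r} \<union> ground N) ({} \<union> lines N))"
    using assms(1) r by (intro cactus_attach_piece) auto
  moreover have "{r} \<union> ground N = ground N" using r by blast
  ultimately show ?thesis
    using linear_space_piece[OF assms(1)] assms(1) by (simp add: cactus_incidence_def cactus_piece_def)
qed

lemma connected_cactus_incidence:
  "connected_cactus M \<Longrightarrow> cactus_incidence M"
proof (induction rule: connected_cactus.induct)
  case (line N)
  moreover have "ground N \<noteq> {}" using line by (auto simp: line_matroid_def uniform_matroid_def)
  ultimately show ?case by (intro cactus_incidence_piece cactus_piece_line_matroid)
next
  case (cycle N)
  have "0 < card (lines N)"
  proof -
    obtain n :: nat and l where "3 \<le> n" "bij_betw l {..<n} (lines N)"
      using cycle by (auto simp: cycle_matroid_def)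
    then show ?thesis using bij_betw_same_card by fastforce
  qed
  then obtain L where "L \<in> lines N" by (metis card.empty equals0I less_irrefl)
  then have "ground N \<noteq> {}" using lineD[of L N] by (metis card.empty not_numeral_le_zero subset_empty)
  then show ?case by (intro cactus_incidence_piece cactus_piece_cycle_matroid cycle)
next
  case (glue M N p q)
  let ?f = "glue_map p q"
  have P: "cactus_piece (ground N) (lines N)"
    using glue.hyps(2) cactus_piece_line_matroid cactus_piece_cycle_matroid by blast
  have finM: "finite (ground M)" and linM: "linear_space (lines M)"
    and cacM: "incident.cactus (incidence_vertices (ground M) (lines M))"
    using glue.IH by (auto simp: cactus_incidence_def)
  have finN: "finite (ground N)" using P by (simp add: cactus_piece_def)
  have "p \<notin> ground N" using glue.hyps(3,4) by blast
  \<comment> \<open>Sending \<open>q\<close> to \<open>p\<close> merges no two points of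
    \<open>N\<close>, since \<open>p\<close> is not among them.\<close>
  then have inj: "inj_on ?f (ground N)" by (auto simp: inj_on_def glue_map_def split: if_splits)
  have P': "cactus_piece (?f ` ground N) ((`) ?f ` lines N)" by (rule cactus_piece_image[OF inj P])
  have linN: "linear_space ((`) ?f ` lines N)" by (rule linear_space_piece[OF P'])
  have subN: "L \<subseteq> ?f ` ground N" "3 \<le> card L" if "L \<in> (`) ?f ` lines N" for L
    using P' that by (auto simp: cactus_piece_def)
  have inter: "ground M \<inter> ?f ` ground N = {p}"
    using glue.hyps(3,4,5) by (auto simp: glue_map_def)
  let ?E = "ground M \<union> ?f ` ground N"
  let ?\<G> = "lines M \<union> (`) ?f ` lines N"
  \<comment> \<open>Lines from the two sides share at most the gluing point, so the union of the two
    line sets is again linear.\<close>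
  have mixed: False
    if "L \<in> lines M" "L' \<in> (`) ?f ` lines N" "x \<in> L" "y \<in> L" "x \<in> L'" "y \<in> L'" "x \<noteq> y" for L L' x y
  proof -
    have "x \<in> {p}" "y \<in> {p}"
      unfolding inter[symmetric] using lineD(2)[OF that(1)] subN(1)[OF that(2)] that by auto
    then show False using that by simp
  qed
  have lin: "linear_space ?\<G>"
    unfolding linear_space_def
  proof (intro ballI allI impI)
    fix L L' x y assume *: "L \<in> ?\<G>" "L' \<in> ?\<G>" "x \<in> L \<and> y \<in> L \<and> x \<in> L' \<and> y \<in> L' \<and> x \<noteq> y"
    consider "L \<in> lines M" "L' \<in> lines M" | "L \<in> (`) ?f ` lines N" "L' \<in> (`) ?f ` lines N"
      | "L \<in> lines M" "L' \<in> (`) ?f ` lines N" | "L' \<in> lines M" "L \<in> (`) ?f ` lines N"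
      using * by blast
    then show "L = L'"
    proof cases
      case 1
      then show ?thesis using linear_spaceD[OF linM, of L L' x y] * by simp
    next
      case 2
      then show ?thesis using linear_spaceD[OF linN, of L L' x y] * by simp
    next
      case 3
      then show ?thesis using mixed[of L L' x y] * by simp
    next
      case 4
      then show ?thesis using mixed[of L' L x y] * by simp
    qed
  qed
  have lines: "lines (free_gluing M p N q) = ?\<G>"
  proof (rule lines_of_linear_space[OF _ _ _ lin])
    show "finite ?E" using finM finN by simp
    show "L \<subseteq> ?E" "3 \<le> card L" if "L \<in> ?\<G>" for L
      using that lineD[of L M] subN[of L] by blast+
    show "ground (free_gluing M p N q) = ?E" by (simp add: free_gluing_def Let_def)
    show "T \<in> indeps (free_gluing M p N q) \<longleftrightarrow> \<not> (\<exists>L\<in>?\<G>. T \<subseteq> L)" if "T \<subseteq> ?E" "card T = 3" for T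
      using that unfolding free_gluing_def Let_def glued_lines_def by simp
  qed
  have "incident.cactus (incidence_vertices ?E ?\<G>)"
    by (rule cactus_attach_piece[OF cacM glue.hyps(4) inter _ P']) (rule lineD(2))
  then show ?case
    using lin finM finN by (simp add: cactus_incidence_def lines) (simp add: free_gluing_def Let_def)
qed

lemma triples_dependent_restriction:
  assumes "C \<subseteq> ground M"
  shows "triples_dependent (restriction M C) L \<longleftrightarrow> L \<subseteq> C \<and> triples_dependent M L"
proof -
  have "T \<in> indeps (restriction M C) \<longleftrightarrow> T \<in> indeps M" if "T \<subseteq> L" "L \<subseteq> C" for T
    using that by (auto simp: restriction_def)
  moreover have "ground (restriction M C) = C" by (simp add: restriction_def)
  ultimately show ?thesis using assms unfolding triples_dependent_iff by auto
qed

text \<open>Components partition the points, and each line lies in one component. The incidence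
  graph is thus a disjoint union without edges between its parts.\<close>

lemma cactus_configuration_incidence:
  assumes "cactus_configuration M"
  shows "incident.cactus (incidence_vertices (ground M) (lines M))"
proof -
  have fin: "finite (ground M)"
    using assms by (auto simp: cactus_configuration_def simple_matroid_def matroid_def)
  let ?R = "collinear_rel M"
  define C where "C x = ?R\<^sup>* `` {x}" for x
  have "sym ?R" by (auto simp: collinear_rel_def sym_def)
  then have sym: "sym (?R\<^sup>*)" by (rule sym_rtrancl)
  have C_eq: "C y = C x" if "y \<in> C x" for x y
  proof -
    have xy: "(x, y) \<in> ?R\<^sup>*" "(y, x) \<in> ?R\<^sup>*" using that sym by (auto simp: C_def sym_def)
    then show ?thesis unfolding C_def by (auto intro: rtrancl_trans)
  qed
  have self: "x \<in> C x" for x by (simp add: C_def)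
  have sub: "C x \<subseteq> ground M" if "x \<in> ground M" for x
  proof
    fix y assume "y \<in> C x"
    then have "(x, y) \<in> ?R\<^sup>*" by (simp add: C_def)
    then show "y \<in> ground M"
      by (induction rule: rtrancl_induct) (use that lineD(2) in \<open>auto simp: collinear_rel_def\<close>)
  qed
  have line_sub: "L \<subseteq> C x" if "L \<in> lines M" "x \<in> L" for L x
  proof
    fix y assume "y \<in> L"
    then have "(x, y) \<in> ?R" using that by (auto simp: collinear_rel_def)
    then show "y \<in> C x" by (auto simp: C_def)
  qed
  have line_ne: "L \<noteq> {}" if "L \<in> lines M" for L using lineD(3)[OF that] by auto
  \<comment> \<open>A line of \<open>M\<close> that meets a component stays inside it, so maximality
    in the restriction agrees with maximality in \<open>M\<close>.\<close>
  have lines_C: "lines (restriction M (C x)) = {L \<in> lines M. L \<subseteq> C x}" if x: "x \<in> ground M" for x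
  proof (intro set_eqI iffI)
    note td = triples_dependent_restriction[OF sub[OF x]]
    fix L assume L: "L \<in> lines (restriction M (C x))"
    then have LC: "L \<subseteq> C x" "triples_dependent M L" using lineD(1) td by blast+
    obtain L' where L': "L' \<in> lines M" "L \<subseteq> L'" using triples_dependent_extends[OF fin LC(2)] .
    obtain y where y: "y \<in> L" using lineD(3)[OF L] by fastforce
    then have "L' \<subseteq> C x" using line_sub[OF L'(1), of y] L' C_eq[of y x] LC by blast
    then have "L' = L" using line_maximal[OF L] td L' lineD(1) by blast
    then show "L \<in> {L \<in> lines M. L \<subseteq> C x}" using L' LC by blast
  next
    note td = triples_dependent_restriction[OF sub[OF x]]
    fix L assume L: "L \<in> {L \<in> lines M. L \<subseteq> C x}"
    show "L \<in> lines (restriction M (C x))"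
      by (rule lineI) (use L td lineD(1) line_maximal in blast)+
  qed
  have cac: "incident.cactus (incidence_vertices (C x) {L \<in> lines M. L \<subseteq> C x})" if "x \<in> ground M" for x
  proof -
    have "C x \<in> connected_components_of_matroid M"
      using that by (auto simp: connected_components_of_matroid_def C_def)
    then have "connected_cactus (restriction M (C x))" using assms by (simp add: cactus_configuration_def)
    then show ?thesis
      using connected_cactus_incidence lines_C[OF that] unfolding cactus_incidence_def
      by (fastforce simp: restriction_def)
  qed
  \<comment> \<open>Stated for any finite set of components, so that they can be added one at a
    time.\<close>
  have "incident.cactus (incidence_vertices (\<Union>\<D>) {L \<in> lines M. L \<subseteq> \<Union>\<D>})"
    if "finite \<D>" "\<D> \<subseteq> C ` ground M" for \<D>
    using that
  proof (induction \<D> rule: finite_induct)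
    case empty
    have "{L \<in> lines M. L \<subseteq> \<Union>{}} = {}" using line_ne by auto
    then have "incidence_vertices (\<Union>{}) {L \<in> lines M. L \<subseteq> \<Union>{}} = {}"
      unfolding incidence_vertices_def by simp
    then show ?case using incident.cactus.empty by metis
  next
    case (insert D \<D>)
    obtain x where x: "x \<in> ground M" "D = C x" using insert.prems by blast
    have disj: "D \<inter> \<Union>\<D> = {}"
    proof (rule ccontr)
      assume "D \<inter> \<Union>\<D> \<noteq> {}"
      then obtain y D' where y: "y \<in> D" "y \<in> D'" "D' \<in> \<D>" by blast
      then obtain x' where "D' = C x'" using insert.prems by blast
      then have "D' = D" using C_eq[of y x] C_eq[of y x'] x y by simp
      then show False using y insert.hyps by blast
    qed
    have split: "L \<subseteq> D \<or> L \<subseteq> \<Union>\<D>" if L: "L \<in> lines M" "L \<subseteq> \<Union>(insert D \<D>)" for L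
    proof -
      obtain y where y: "y \<in> L" using line_ne[OF L(1)] by blast
      then obtain D' where D': "D' \<in> insert D \<D>" "y \<in> D'" using L by blast
      then obtain x' where "D' = C x'" using insert.prems by blast
      then have "L \<subseteq> D'" using line_sub[OF L(1) y] C_eq[of y x'] D' by simp
      then show ?thesis using D' by blast
    qed
    let ?A = "incidence_vertices D {L \<in> lines M. L \<subseteq> D}"
    let ?B = "incidence_vertices (\<Union>\<D>) {L \<in> lines M. L \<subseteq> \<Union>\<D>}"
    have "incident.cactus (?A \<union> ?B)"
    proof (rule incident.cactus_disjoint_union)
      show "incident.cactus ?A" using cac[OF x(1)] x(2) by simp
      show "incident.cactus ?B" using insert by blast
      show "?A \<inter> ?B = {}"
      proof (rule equals0I)
        fix z assume z: "z \<in> ?A \<inter> ?B"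
        show False
        proof (cases z)
          case (Inl x)
          then show ?thesis using z disj by auto
        next
          case (Inr L)
          then have "L \<in> lines M" "L \<subseteq> D \<inter> \<Union>\<D>" using z by auto
          then show ?thesis using disj line_ne by auto
        qed
      qed
      show "\<not> incident a b" if "a \<in> ?A" "b \<in> ?B" for a b
        using that disj by (cases a; cases b) auto
    qed
    moreover have "?A \<union> ?B = incidence_vertices (\<Union>(insert D \<D>)) {L \<in> lines M. L \<subseteq> \<Union>(insert D \<D>)}"
    proof -
      have "{L \<in> lines M. L \<subseteq> \<Union>(insert D \<D>)} = {L \<in> lines M. L \<subseteq> D} \<union> {L \<in> lines M. L \<subseteq> \<Union>\<D>}"
        using split by blast
      then show ?thesis unfolding incidence_vertices_def by auto
    qed
    ultimately show ?case by simp
  qed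
  from this[of "C ` ground M"] have
    "incident.cactus (incidence_vertices (\<Union>(C ` ground M)) {L \<in> lines M. L \<subseteq> \<Union>(C ` ground M)})"
    using fin by simp
  moreover have "\<Union>(C ` ground M) = ground M" using self sub by blast
  moreover have "{L \<in> lines M. L \<subseteq> ground M} = lines M" using lineD(2) by blast
  ultimately show ?thesis by simp
qed

section \<open>Decomposition of the circuit variety\<close>

lemma poly_open_independent:
  assumes "finite S" "card S \<le> 3" "S \<subseteq> E"
  shows "poly_open E (\<lambda>\<gamma>. \<not> family_dependent \<gamma> S)"
proof -
  consider "card S = 0" | "card S = 1" | "card S = 2" | "card S = 3" using assms(2) by linarith
  then show ?thesis
  proof cases
    case 1
    then have "S = {}" using assms(1) by simp
    then show ?thesis using poly_openI[OF poly_functions.const[of 1]] by simp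
  next
    case 2
    then obtain a where "S = {a}" by (auto simp: card_1_singleton_iff)
    then show ?thesis
      using assms(3) by (auto simp: family_dependent_singleton intro!: poly_open_vec poly_functions.coord)
  next
    case 3
    then obtain a b where S: "S = {a, b}" "a \<noteq> b" by (auto simp: card_2_iff)
    show ?thesis
      unfolding S(1) family_dependent_pair[OF S(2)]
      by (intro poly_open_vec poly_functions_ccross poly_functions.coord) (use S assms(3) in auto)
  next
    case 4
    then obtain a b c where S: "S = {a, b, c}" "a \<noteq> b" "a \<noteq> c" "b \<noteq> c" by (auto simp: card_3_iff)
    show ?thesis
      unfolding S(1) family_dependent_triple[OF S(2,3,4)]
      by (intro poly_openI poly_functions_det3 poly_functions.coord) (use S assms(3) in auto)
  qed
qed

lemma dependent_triple_in_line:
  assumes "finite (ground M)" "T \<subseteq> ground M" "card T = 3" "T \<notin> indeps M"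
  obtains L where "L \<in> lines M" "T \<subseteq> L"
proof -
  have "T' = T" if "T' \<subseteq> T" "card T' = 3" for T'
    using that assms card_subset_eq[of T T'] finite_subset by metis
  then have "triples_dependent M T" using assms by (auto simp: triples_dependent_iff)
  then show ?thesis using triples_dependent_extends[OF assms(1)] that by blast
qed

lemma simple_rank_3_facts:
  assumes "simple_matroid M" "matroid_rank M = 3"
  shows "finite (ground M)" "S \<in> indeps M \<Longrightarrow> S \<subseteq> ground M" "S \<in> indeps M \<Longrightarrow> card S \<le> 3"
    and "S \<subseteq> ground M \<Longrightarrow> card S \<le> 2 \<Longrightarrow> S \<in> indeps M"
    and "finite (indeps M)"
proof -
  have M: "finite (ground M)" "indeps M \<subseteq> Pow (ground M)"
    using assms by (auto simp: simple_matroid_def matroid_def)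
  then show fin: "finite (indeps M)" using finite_subset by blast
  show "finite (ground M)" "S \<in> indeps M \<Longrightarrow> S \<subseteq> ground M" using M by auto
  have "card S \<le> Max (card ` indeps M)" if "S \<in> indeps M" using fin that by (intro Max_ge) auto
  then show "S \<in> indeps M \<Longrightarrow> card S \<le> 3" using assms(2) by (simp add: matroid_rank_def)
  show "S \<subseteq> ground M \<Longrightarrow> card S \<le> 2 \<Longrightarrow> S \<in> indeps M"
    using assms by (simp add: simple_matroid_def)
qed

definition lines_degenerate :: "'a set_system \<Rightarrow> ('a \<Rightarrow> complex ^ 3) \<Rightarrow> bool" where
  "lines_degenerate M \<gamma> \<longleftrightarrow>
     (\<forall>L\<in>lines M. \<forall>a\<in>L. \<forall>b\<in>L. \<forall>c\<in>L. det3 (\<gamma> a) (\<gamma> b) (\<gamma> c) = 0)"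

text \<open>Sets of at most two elements are independent by simplicity, and sets of more than three
  give dependent families in three-space anyway. Only dependent triples impose conditions, and these
  are the triples on lines.\<close>

lemma circuit_variety_eq:
  assumes "simple_matroid M" "matroid_rank M = 3"
  shows "circuit_variety M = {\<gamma> \<in> config_space (ground M). lines_degenerate M \<gamma>}"
proof -
  note M = simple_rank_3_facts[OF assms]
  have "(\<forall>S\<in>dependent_sets M. family_dependent \<gamma> S) \<longleftrightarrow> lines_degenerate M \<gamma>" for \<gamma>
  proof
    assume dep: "\<forall>S\<in>dependent_sets M. family_dependent \<gamma> S"
    show "lines_degenerate M \<gamma>"
      unfolding lines_degenerate_def
    proof (intro ballI)
      fix L a b c assume L: "L \<in> lines M" and abc: "a \<in> L" "b \<in> L" "c \<in> L"
      show "det3 (\<gamma> a) (\<gamma> b) (\<gamma> c) = 0"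
      proof (cases "a = b \<or> a = c \<or> b = c")
        case True
        then show ?thesis by auto
      next
        case False
        then have "card {a, b, c} = 3" "{a, b, c} \<subseteq> L" using abc by auto
        then have "{a, b, c} \<in> dependent_sets M"
          using lineD(1)[OF L] by (simp add: triples_dependent_def)
        then show ?thesis using dep family_dependent_triple[of a b c \<gamma>] False by blast
      qed
    qed
  next
    assume deg: "lines_degenerate M \<gamma>"
    show "\<forall>S\<in>dependent_sets M. family_dependent \<gamma> S"
    proof
      fix S assume "S \<in> dependent_sets M"
      then have S: "S \<subseteq> ground M" "S \<notin> indeps M" by (auto simp: dependent_sets_def)
      then have fin: "finite S" using M(1) finite_subset by blast
      have "\<not> card S \<le> 2" using M(4) S by blast
      then consider "3 < card S" | "card S = 3" by linarith
      then show "family_dependent \<gamma> S"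
      proof cases
        case 1
        then show ?thesis using family_dependent_card_gt_3 fin by blast
      next
        case 2
        obtain L where L: "L \<in> lines M" "S \<subseteq> L"
          using dependent_triple_in_line[OF M(1) S(1) 2 S(2)] .
        obtain a b c where abc: "S = {a, b, c}" "a \<noteq> b" "a \<noteq> c" "b \<noteq> c" using 2 by (auto simp: card_3_iff)
        then show ?thesis
          using deg L family_dependent_triple[of a b c \<gamma>] unfolding lines_degenerate_def by auto
      qed
    qed
  qed
  then show ?thesis unfolding circuit_variety_def by blast
qed

section \<open>Strata by vanishing locus\<close>

definition stratum :: "'a set_system \<Rightarrow> 'a set \<Rightarrow> ('a \<Rightarrow> complex ^ 3) set" where
  "stratum M J = {\<gamma> \<in> config_space (ground M). lines_degenerate M \<gamma> \<and>
     (\<forall>p\<in>ground M. \<gamma> p = 0 \<longleftrightarrow> p \<in> J)}"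

text \<open>The normals are dropped; restriction to \<open>E\<close> makes the family extensional,
  as \<open>config_space\<close> demands.\<close>

definition point_family :: "'a set \<Rightarrow> 'a set \<Rightarrow> ('a + 'a set \<Rightarrow> complex ^ 3) \<Rightarrow> 'a \<Rightarrow> complex ^ 3" where
  "point_family E J v = (\<lambda>i\<in>E. if i \<in> J then 0 else v (Inl i))"

lemma lines_degenerate_normals:
  assumes "lines_degenerate M \<gamma>"
  obtains n where "\<And>L. L \<in> lines M \<Longrightarrow> n L \<noteq> 0" "\<And>L i. L \<in> lines M \<Longrightarrow> i \<in> L \<Longrightarrow> cdot (\<gamma> i) (n L) = 0"
proof -
  have "\<exists>n. n \<noteq> 0 \<and> (\<forall>i\<in>L. cdot (\<gamma> i) n = 0)" if "L \<in> lines M" for L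
  proof -
    have "det3 x y z = 0" if "x \<in> \<gamma> ` L" "y \<in> \<gamma> ` L" "z \<in> \<gamma> ` L" for x y z
      using assms \<open>L \<in> lines M\<close> that unfolding lines_degenerate_def by auto
    then obtain n where "n \<noteq> 0" "\<And>x. x \<in> \<gamma> ` L \<Longrightarrow> cdot x n = 0" using exists_normal[of "\<gamma> ` L"] by blast
    then show ?thesis by blast
  qed
  then have "\<forall>L\<in>lines M. \<exists>n. n \<noteq> 0 \<and> (\<forall>i\<in>L. cdot (\<gamma> i) n = 0)" by blast
  then obtain n where "\<forall>L\<in>lines M. n L \<noteq> 0 \<and> (\<forall>i\<in>L. cdot (\<gamma> i) (n L) = 0)"
    using bchoice by metis
  then show ?thesis using that by blast
qed

text \<open>Vectors on a line are coplanar exactly when they have a nonzero common normal. Its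
  choice is not unique if they span less than a plane, but any choice gives a preimage. A line keeps
  its vertex even when all its points lie in \<open>J\<close>.\<close>

lemma stratum_eq_image:
  "stratum M J = point_family (ground M) J `
     incident.ortho (incidence_vertices (ground M - J) (lines M))"
proof (intro set_eqI iffI)
  fix \<gamma> assume \<gamma>: "\<gamma> \<in> stratum M J"
  then have deg: "lines_degenerate M \<gamma>" and ext: "\<gamma> \<in> ground M \<rightarrow>\<^sub>E UNIV"
    and zero: "\<And>p. p \<in> ground M \<Longrightarrow> \<gamma> p = 0 \<longleftrightarrow> p \<in> J"
    by (auto simp: stratum_def config_space_def)
  obtain n where n: "\<And>L. L \<in> lines M \<Longrightarrow> n L \<noteq> 0" "\<And>L i. L \<in> lines M \<Longrightarrow> i \<in> L \<Longrightarrow> cdot (\<gamma> i) (n L) = 0"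
    using lines_degenerate_normals[OF deg] by blast
  have "case_sum \<gamma> n \<in> incident.ortho (incidence_vertices (ground M - J) (lines M))"
    unfolding incident.ortho_def
  proof (intro CollectI conjI ballI impI)
    fix x assume x: "x \<in> incidence_vertices (ground M - J) (lines M)"
    show "case_sum \<gamma> n x \<noteq> 0" using x n(1) zero by (cases x) auto
    fix y assume y: "y \<in> incidence_vertices (ground M - J) (lines M)" "incident x y"
    show "cdot (case_sum \<gamma> n x) (case_sum \<gamma> n y) = 0"
      using x y n(2) by (cases x; cases y) (auto simp: cdot_commute)
  qed
  moreover have "\<gamma> = point_family (ground M) J (case_sum \<gamma> n)"
  proof
    fix i show "\<gamma> i = point_family (ground M) J (case_sum \<gamma> n) i"
      using ext zero[of i] by (cases "i \<in> ground M") (auto simp: point_family_def)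
  qed
  ultimately show "\<gamma> \<in> point_family (ground M) J `
      incident.ortho (incidence_vertices (ground M - J) (lines M))" by blast
next
  fix \<gamma> assume "\<gamma> \<in> point_family (ground M) J `
      incident.ortho (incidence_vertices (ground M - J) (lines M))"
  then obtain v where v: "v \<in> incident.ortho (incidence_vertices (ground M - J) (lines M))"
    and \<gamma>: "\<gamma> = point_family (ground M) J v" by blast
  have val: "\<gamma> i = (if i \<in> J then 0 else v (Inl i))" if "i \<in> ground M" for i
    using that by (simp add: \<gamma> point_family_def)
  have "lines_degenerate M \<gamma>"
    unfolding lines_degenerate_def
  proof (intro ballI)
    fix L a b c assume L: "L \<in> lines M" and abc: "a \<in> L" "b \<in> L" "c \<in> L"
    have "cdot (\<gamma> i) (v (Inr L)) = 0" if "i \<in> L" for i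
      using val[of i] lineD(2)[OF L] that incident.orthoD(2)[OF v, of "Inl i" "Inr L"] L by auto
    moreover have "v (Inr L) \<noteq> 0" using incident.orthoD(1)[OF v, of "Inr L"] L by simp
    ultimately show "det3 (\<gamma> a) (\<gamma> b) (\<gamma> c) = 0"
      using det3_eq_0_if_orthogonal abc by blast
  qed
  moreover have "\<gamma> p = 0 \<longleftrightarrow> p \<in> J" if "p \<in> ground M" for p
    using val[OF that] incident.orthoD(1)[OF v, of "Inl p"] that by auto
  moreover have "\<gamma> \<in> config_space (ground M)"
    by (simp add: \<gamma> point_family_def config_space_def)
  ultimately show "\<gamma> \<in> stratum M J" by (simp add: stratum_def)
qed

lemma irred_stratum:
  assumes "incident.cactus (incidence_vertices (ground M) (lines M))"
  shows "irred (ground M) (stratum M J)"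
proof -
  have "incidence_vertices (ground M) (lines M) - Inl ` J = incidence_vertices (ground M - J) (lines M)"
    by (auto simp: incidence_vertices_def)
  then have "incident.cactus (incidence_vertices (ground M - J) (lines M))"
    using incident.cactus_diff[OF assms, of "Inl ` J"] by simp
  then have "irred (incidence_vertices (ground M - J) (lines M))
    (incident.ortho (incidence_vertices (ground M - J) (lines M)))"
    using incident.cactus_irred_generic by blast
  then show ?thesis
    unfolding stratum_eq_image
  proof (rule irred_image)
    fix i k assume "i \<in> ground M"
    then show "(\<lambda>v. point_family (ground M) J v i $ k) \<in> poly_functions (incidence_vertices (ground M - J) (lines M))"
      by (cases "i \<in> J") (auto simp: point_family_def intro!: poly_functions.const poly_functions.coord)
  qed
qed

lemma realizations_make_loops:
  assumes "simple_matroid M" "matroid_rank M = 3" "J \<subseteq> ground M"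
  shows "realizations (make_loops M J) =
    {\<gamma> \<in> stratum M J. \<forall>S\<in>indeps M. S \<inter> J = {} \<longrightarrow> \<not> family_dependent \<gamma> S}"
proof -
  note M = simple_rank_3_facts[OF assms(1,2)]
  note circ = circuit_variety_eq[OF assms(1,2)]
  have dep: "S \<in> dependent_sets (make_loops M J) \<longleftrightarrow> S \<notin> indeps M \<or> S \<inter> J \<noteq> {}" if "S \<subseteq> ground M" for S
    using that by (auto simp: dependent_sets_def make_loops_def)
  have gr: "ground (make_loops M J) = ground M" by (simp add: make_loops_def)
  show ?thesis
  proof (intro set_eqI iffI)
    fix \<gamma> assume "\<gamma> \<in> realizations (make_loops M J)"
    then have conf: "\<gamma> \<in> config_space (ground M)"
      and *: "\<And>S. S \<subseteq> ground M \<Longrightarrow> family_dependent \<gamma> S \<longleftrightarrow> S \<notin> indeps M \<or> S \<inter> J \<noteq> {}"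
      using dep by (auto simp: realizations_def gr)
    have "family_dependent \<gamma> S" if "S \<in> dependent_sets M" for S
      using that * by (auto simp: dependent_sets_def)
    then have "lines_degenerate M \<gamma>" using circ conf by (auto simp: circuit_variety_def)
    moreover have "\<gamma> p = 0 \<longleftrightarrow> p \<in> J" if p: "p \<in> ground M" for p
    proof -
      have "{p} \<in> indeps M" using M(4)[of "{p}"] p by simp
      then show ?thesis using *[of "{p}"] p by (auto simp: family_dependent_singleton)
    qed
    ultimately show "\<gamma> \<in> {\<gamma> \<in> stratum M J. \<forall>S\<in>indeps M. S \<inter> J = {} \<longrightarrow> \<not> family_dependent \<gamma> S}"
      using conf * M(2) by (auto simp: stratum_def)
  next
    fix \<gamma> assume "\<gamma> \<in> {\<gamma> \<in> stratum M J. \<forall>S\<in>indeps M. S \<inter> J = {} \<longrightarrow> \<not> family_dependent \<gamma> S}"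
    then have conf: "\<gamma> \<in> config_space (ground M)" and deg: "lines_degenerate M \<gamma>"
      and zero: "\<And>p. p \<in> J \<Longrightarrow> \<gamma> p = 0"
      and ind: "\<And>S. S \<in> indeps M \<Longrightarrow> S \<inter> J = {} \<Longrightarrow> \<not> family_dependent \<gamma> S"
      using assms(3) by (auto simp: stratum_def)
    have "\<gamma> \<in> circuit_variety M" using circ conf deg by blast
    then have "family_dependent \<gamma> S" if "S \<subseteq> ground M" "S \<notin> indeps M" for S
      using that by (auto simp: circuit_variety_def dependent_sets_def)
    moreover have "family_dependent \<gamma> S" if SJ: "S \<inter> J \<noteq> {}" for S
    proof -
      obtain j where "j \<in> S" "j \<in> J" using SJ by blast
      then show ?thesis
        using zero family_dependent_singleton[of \<gamma> j] family_dependent_mono[of \<gamma> "{j}" S] by simp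
    qed
    ultimately have "S \<in> dependent_sets (make_loops M J) \<longleftrightarrow> family_dependent \<gamma> S" if "S \<subseteq> ground M" for S
      using dep[OF that] ind that by blast
    then show "\<gamma> \<in> realizations (make_loops M J)" using conf by (simp add: realizations_def gr)
  qed
qed

text \<open>Genericity is taken on the whole graph, and only then are the vectors on
  \<open>J\<close> set to zero. Independent sets avoiding \<open>J\<close> keep their vectors, and
  an independent triple lies on no line, so the determinant condition applies to it.\<close>

lemma exists_realization:
  assumes "simple_matroid M" "matroid_rank M = 3"
    and cac: "incident.cactus (incidence_vertices (ground M) (lines M))" and J: "J \<subseteq> ground M"
  shows "\<exists>\<gamma>. \<gamma> \<in> realizations (make_loops M J)"
proof -
  note M = simple_rank_3_facts[OF assms(1,2)]
  let ?V = "incidence_vertices (ground M) (lines M)"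
  obtain v where v: "v \<in> incident.generic ?V" using incident.cactus_irred_generic[OF cac] by blast
  define \<gamma> where "\<gamma> = point_family (ground M) J v"
  have "v \<in> incident.ortho (incidence_vertices (ground M - J) (lines M))"
    by (rule incident.ortho_mono[OF incident.generic_ortho[OF v]]) (auto simp: incidence_vertices_def)
  then have \<gamma>: "\<gamma> \<in> stratum M J" by (auto simp: stratum_eq_image \<gamma>_def)
  have val: "\<gamma> i = v (Inl i)" if "i \<in> ground M" "i \<notin> J" for i
    using that by (simp add: \<gamma>_def point_family_def)
  have "\<not> family_dependent \<gamma> S" if S: "S \<in> indeps M" "S \<inter> J = {}" for S
  proof -
    have fin: "finite S" using finite_subset[OF M(2)[OF S(1)] M(1)] .
    have mem: "i \<in> ground M" "i \<notin> J" "\<gamma> i = v (Inl i)" if "i \<in> S" for i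
      using M(2)[OF S(1)] S(2) that val by auto
    consider "card S = 0" | "card S = 1" | "card S = 2" | "card S = 3" using M(3)[OF S(1)] by linarith
    then show ?thesis
    proof cases
      case 1
      then show ?thesis using fin by simp
    next
      case 2
      then obtain a where a: "S = {a}" by (auto simp: card_1_singleton_iff)
      then show ?thesis
        using mem[of a] incident.orthoD(1)[OF incident.generic_ortho[OF v], of "Inl a"]
        by (simp add: family_dependent_singleton)
    next
      case 3
      then obtain a b where ab: "S = {a, b}" "a \<noteq> b" by (auto simp: card_2_iff)
      then show ?thesis
        using mem[of a] mem[of b] incident.genericD(1)[OF v, of "Inl a" "Inl b"]
        by (simp add: family_dependent_pair)
    next
      case 4
      then obtain a b c where abc: "S = {a, b, c}" "a \<noteq> b" "a \<noteq> c" "b \<noteq> c" by (auto simp: card_3_iff)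
      have nl: False if l: "l \<in> ?V" "incident l (Inl a)" "incident l (Inl b)" "incident l (Inl c)" for l
      proof -
        obtain L where "l = Inr L" "L \<in> lines M" using l by (cases l) auto
        then have "S \<subseteq> L" "L \<in> lines M" using l abc by auto
        then show False using lineD(1)[of L M] 4 S(1) by (auto simp: triples_dependent_iff)
      qed
      have "det3 (v (Inl a)) (v (Inl b)) (v (Inl c)) \<noteq> 0"
        by (rule incident.genericD(3)[OF v]) (use mem abc nl in auto)
      then show ?thesis
        using mem[of a] mem[of b] mem[of c] abc by (simp add: family_dependent_triple)
    qed
  qed
  then show ?thesis using \<gamma> realizations_make_loops[OF assms(1,2) J] by blast
qed

text \<open>Each independent set avoiding \<open>J\<close> contributes one open condition. There are
  finitely many, all met by a single realization, so realizations are dense in the irreducible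
  stratum.\<close>

lemma matroid_variety_make_loops:
  assumes "simple_matroid M" "matroid_rank M = 3"
    and cac: "incident.cactus (incidence_vertices (ground M) (lines M))" and J: "J \<subseteq> ground M"
  shows "matroid_variety (make_loops M J) = zariski_closure (ground M) (stratum M J)"
proof -
  note M = simple_rank_3_facts[OF assms(1,2)]
  let ?E = "ground M" and ?R = "realizations (make_loops M J)"
  let ?\<P> = "(\<lambda>S \<gamma>. \<not> family_dependent \<gamma> S) ` {S \<in> indeps M. S \<inter> J = {}}"
  have conf: "stratum M J \<subseteq> config_space ?E" by (auto simp: stratum_def)
  have R: "?R = {\<gamma> \<in> stratum M J. \<forall>P\<in>?\<P>. P \<gamma>}"
    unfolding realizations_make_loops[OF assms(1,2) J] by auto
  obtain \<gamma> where \<gamma>: "\<gamma> \<in> ?R" using exists_realization[OF assms] by blast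
  have "stratum M J \<subseteq> zero_locus_hull ?E ?R"
    unfolding R
  proof (rule open_dense_finite[OF irred_stratum[OF cac]])
    show "finite ?\<P>" using M(5) by simp
    show "poly_open ?E P" if "P \<in> ?\<P>" for P
      using that M(2,3) finite_subset[OF _ M(1)] by (auto intro!: poly_open_independent)
    show "\<gamma> \<in> stratum M J" using \<gamma> unfolding R by simp
    have "\<forall>P\<in>?\<P>. P \<gamma>" using \<gamma> unfolding R by simp
    then show "P \<gamma>" if "P \<in> ?\<P>" for P using that by (rule bspec)
  qed
  then have "zero_locus_hull ?E (stratum M J) \<subseteq> zero_locus_hull ?E ?R" by (rule zero_locus_hull_minimal)
  moreover have "?R \<subseteq> stratum M J" using R by blast
  then have "zero_locus_hull ?E ?R \<subseteq> zero_locus_hull ?E (stratum M J)"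
    by (intro zero_locus_hull_minimal order_trans[OF _ subset_zero_locus_hull])
  ultimately have "zero_locus_hull ?E ?R = zero_locus_hull ?E (stratum M J)" by blast
  moreover have "?R \<subseteq> config_space ?E" using R conf by blast
  moreover have "ground (make_loops M J) = ?E" by (simp add: make_loops_def)
  ultimately show ?thesis
    unfolding matroid_variety_def using zariski_closure_eq[of _ ?E] conf by metis
qed

text \<open>
  A vanishing vector at a point on at most two lines can be moved off zero, since the planes
  containing these lines intersect nontrivially.
\<close>

lemma circuit_variety_near_stratum:
  assumes fin: "finite (ground M)" and J: "J \<subseteq> ground M"
    and \<gamma>: "\<gamma> \<in> config_space (ground M)" "lines_degenerate M \<gamma>"
    and zero: "\<And>p. p \<in> J \<Longrightarrow> \<gamma> p = 0"
    and nz: "\<And>p. p \<in> multiple_points M \<Longrightarrow> p \<notin> J \<Longrightarrow> \<gamma> p \<noteq> 0"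
  shows "\<gamma> \<in> zero_locus_hull (ground M) (stratum M J)"
  using \<gamma> zero nz
proof (induction "card {p \<in> ground M - J. \<gamma> p = 0}" arbitrary: \<gamma> rule: less_induct)
  case less
  show ?case
  proof (cases "{p \<in> ground M - J. \<gamma> p = 0} = {}")
    case True
    then have "\<gamma> \<in> stratum M J" using less.prems by (auto simp: stratum_def)
    then show ?thesis using subset_zero_locus_hull by blast
  next
    case False
    then obtain p where p: "p \<in> ground M" "p \<notin> J" "\<gamma> p = 0" by blast
    have "p \<notin> multiple_points M" using less.prems(4) p by blast
    then have card: "card (lines_through M p) \<le> 2" using p by (simp add: multiple_points_def)
    have "lines_through M p \<subseteq> Pow (ground M)" using lineD(2) by (auto simp: lines_through_def)
    then have fin_p: "finite (lines_through M p)" using fin finite_subset by blast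
    have "\<exists>K L. lines_through M p \<subseteq> {K, L}"
    proof -
      consider "card (lines_through M p) = 0" | "card (lines_through M p) = 1"
        | "card (lines_through M p) = 2" using card by linarith
      then show ?thesis
      proof cases
        case 1
        then show ?thesis using fin_p by simp
      next
        case 2
        then obtain K where "lines_through M p = {K}" by (rule card_1_singletonE)
        then show ?thesis by blast
      next
        case 3
        then obtain K L where "lines_through M p = {K, L}" by (meson card_2_iff)
        then show ?thesis by blast
      qed
    qed
    then obtain K L where KL: "lines_through M p \<subseteq> {K, L}" by blast
    obtain n where n: "\<And>L. L \<in> lines M \<Longrightarrow> n L \<noteq> 0" "\<And>L i. L \<in> lines M \<Longrightarrow> i \<in> L \<Longrightarrow> cdot (\<gamma> i) (n L) = 0"
      using lines_degenerate_normals[OF less.prems(2)] by blast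
    \<comment> \<open>If fewer than two lines pass through \<open>p\<close>, one of
      \<open>K\<close>, \<open>L\<close> may fail to be such a line; the additional orthogonality
      condition is harmless.\<close>
    obtain s where s: "s \<noteq> 0" "cdot s (n K) = 0" "cdot s (n L) = 0" using exists_orthogonal_both by blast
    define u where "u = (\<lambda>i. if i = p then s else 0)"
    show ?thesis
    proof (rule zero_locus_hull_line[of \<gamma> u])
      fix t :: complex assume t: "t \<noteq> 0"
      let ?\<delta> = "\<lambda>i. \<gamma> i + t *s u i"
      have \<delta>: "?\<delta> i = (if i = p then t *s s else \<gamma> i)" for i using p by (simp add: u_def)
      have ts: "t *s s \<noteq> 0" using t s by simp
      \<comment> \<open>Exactly one zero outside \<open>J\<close> is removed, which is the decrease
        driving the induction.\<close>
      have eq: "{q \<in> ground M - J. ?\<delta> q = 0} = {q \<in> ground M - J. \<gamma> q = 0} - {p}"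
        unfolding \<delta> using ts by auto
      show "?\<delta> \<in> zero_locus_hull (ground M) (stratum M J)"
      proof (rule less.hyps)
        show "card {q \<in> ground M - J. ?\<delta> q = 0} < card {q \<in> ground M - J. \<gamma> q = 0}"
          unfolding eq using fin p by (intro card_Diff1_less) auto
        show "?\<delta> \<in> config_space (ground M)"
          using less.prems(1) p by (auto simp: config_space_def u_def PiE_iff extensional_def)
        show "lines_degenerate M ?\<delta>"
          unfolding lines_degenerate_def
        proof (intro ballI)
          fix N a b c assume N: "N \<in> lines M" and abc: "a \<in> N" "b \<in> N" "c \<in> N"
          \<comment> \<open>The old normals serve unchanged: \<open>s\<close> is orthogonal to those
            of the lines through \<open>p\<close>, and the other lines do not contain the moved
            point.\<close>
          have "cdot (?\<delta> i) (n N) = 0" if i: "i \<in> N" for i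
          proof (cases "i = p")
            case True
            then have "N = K \<or> N = L" using KL N i by (auto simp: lines_through_def)
            then show ?thesis unfolding \<delta> using True s by (auto simp: cdot_scale)
          next
            case False
            then show ?thesis unfolding \<delta> using n(2)[OF N i] by simp
          qed
          then show "det3 (?\<delta> a) (?\<delta> b) (?\<delta> c) = 0"
            using det3_eq_0_if_orthogonal[OF n(1)[OF N]] abc by blast
        qed
        show "?\<delta> q = 0" if "q \<in> J" for q unfolding \<delta> using less.prems(3) that p by auto
        show "?\<delta> q \<noteq> 0" if "q \<in> multiple_points M" "q \<notin> J" for q
          unfolding \<delta> using less.prems(4) that ts by auto
      qed
    qed
  qed
qed

text \<open>The varieties indexed by subsets of the multiple points are closed and irreducible, and
  they cover the circuit variety from inside. A component lies in one of them and equals it by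
  maximality. Some of them may be contained in others, hence a bound and not an exact count.
  Finiteness is stated separately because \<open>card\<close> of an infinite set is 0.\<close>

theorem theorem3p16:
  fixes d :: nat and M :: "nat set_system"
  assumes "cactus_configuration M"
    and "ground M = {1..d}"
  shows "(\<forall>Z\<in>irreducible_components {1..d} (circuit_variety M).
            \<exists>J\<subseteq>multiple_points M. Z = matroid_variety (make_loops M J)) \<and>
         finite (irreducible_components {1..d} (circuit_variety M)) \<and>
         card (irreducible_components {1..d} (circuit_variety M)) \<le> 2 ^ card (multiple_points M)"
proof -
  let ?E = "ground M" and ?Q = "multiple_points M"
  have M: "simple_matroid M" "matroid_rank M = 3"
    using assms(1) by (auto simp: cactus_configuration_def)
  have fin: "finite ?E" using assms(2) by simp
  have QE: "?Q \<subseteq> ?E" by (auto simp: multiple_points_def)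
  then have finQ: "finite ?Q" using fin finite_subset by blast
  note cac = cactus_configuration_incidence[OF assms(1)]
  note circ = circuit_variety_eq[OF M]
  define \<V> where "\<V> = (\<lambda>J. matroid_variety (make_loops M J)) ` Pow ?Q"
  have conf: "stratum M J \<subseteq> config_space ?E" for J by (auto simp: stratum_def)
  have var: "matroid_variety (make_loops M J) = zariski_closure ?E (stratum M J)" if "J \<subseteq> ?Q" for J
    using matroid_variety_make_loops[OF M cac] that QE by blast
  have closed: "zariski_closed ?E C" and irr: "zariski_irreducible ?E C" and sub: "C \<subseteq> circuit_variety M"
    if C: "C \<in> \<V>" for C
  proof -
    obtain J where J: "J \<subseteq> ?Q" "C = zariski_closure ?E (stratum M J)" using C var by (auto simp: \<V>_def)
    show "zariski_closed ?E C" unfolding J(2) by (rule zariski_closed_closure[OF conf])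
    show "zariski_irreducible ?E C"
      unfolding J(2) by (rule zariski_irreducible_closure[OF irred_stratum[OF cac] conf])
    show "C \<subseteq> circuit_variety M"
    proof
      fix \<gamma> assume "\<gamma> \<in> C"
      then have \<gamma>: "\<gamma> \<in> config_space ?E" "\<gamma> \<in> zero_locus_hull ?E (stratum M J)"
        using J(2) zariski_closure_eq[OF conf] by auto
      have "lines_degenerate M \<gamma>"
        unfolding lines_degenerate_def
      proof (intro ballI)
        fix L a b c assume L: "L \<in> lines M" and abc: "a \<in> L" "b \<in> L" "c \<in> L"
        then have "a \<in> ?E" "b \<in> ?E" "c \<in> ?E" using lineD(2) by blast+
        \<comment> \<open>Collinearity is a polynomial condition, so it passes from the stratum to
          its closure.\<close>
        then have "(\<lambda>\<gamma>. det3 (\<gamma> a) (\<gamma> b) (\<gamma> c)) \<in> poly_functions ?E"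
          by (intro poly_functions_det3 poly_functions.coord)
        moreover have "det3 (\<delta> a) (\<delta> b) (\<delta> c) = 0" if "\<delta> \<in> stratum M J" for \<delta>
          using that L abc by (auto simp: stratum_def lines_degenerate_def)
        ultimately show "det3 (\<gamma> a) (\<gamma> b) (\<gamma> c) = 0"
          using \<gamma>(2) unfolding zero_locus_hull_def by auto
      qed
      then show "\<gamma> \<in> circuit_variety M" using circ \<gamma>(1) by blast
    qed
  qed
  have cover: "circuit_variety M \<subseteq> \<Union>\<V>"
  proof
    fix \<gamma> assume "\<gamma> \<in> circuit_variety M"
    then have \<gamma>: "\<gamma> \<in> config_space ?E" "lines_degenerate M \<gamma>" using circ by auto
    \<comment> \<open>Only zeros at multiple points are recorded; those at other points are absorbed
      by the closure of the stratum.\<close>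
    define J where "J = {q \<in> ?Q. \<gamma> q = 0}"
    have J: "J \<subseteq> ?Q" by (auto simp: J_def)
    have "\<gamma> \<in> zero_locus_hull ?E (stratum M J)"
      by (rule circuit_variety_near_stratum[OF fin _ \<gamma>]) (use J QE in \<open>auto simp: J_def\<close>)
    then have "\<gamma> \<in> matroid_variety (make_loops M J)"
      unfolding var[OF J] zariski_closure_eq[OF conf] using \<gamma>(1) by blast
    then show "\<gamma> \<in> \<Union>\<V>" using J by (auto simp: \<V>_def)
  qed
  have fin\<V>: "finite \<V>" using finQ by (simp add: \<V>_def)
  have comp: "irreducible_components ?E (circuit_variety M) \<subseteq> \<V>"
  proof
    fix Z assume Z: "Z \<in> irreducible_components ?E (circuit_variety M)"
    then have Z1: "Z \<subseteq> circuit_variety M" "zariski_irreducible ?E Z"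
      by (auto simp: irreducible_components_def)
    have "Z \<subseteq> \<Union>\<V>" using Z1 cover by blast
    then obtain C where C: "C \<in> \<V>" "Z \<subseteq> C"
      using zariski_irreducible_finite_cover[OF fin\<V> Z1(2) closed] by blast
    \<comment> \<open>\<open>C\<close> is itself an irreducible subset of the circuit variety, so it
      cannot be strictly larger than the component \<open>Z\<close>.\<close>
    then have "C = Z" using Z irr[OF C(1)] sub[OF C(1)] unfolding irreducible_components_def by blast
    then show "Z \<in> \<V>" using C by simp
  qed
  have "card \<V> \<le> card (Pow ?Q)" unfolding \<V>_def using finQ by (intro card_image_le) simp
  then have "card (irreducible_components ?E (circuit_variety M)) \<le> 2 ^ card ?Q"
    using card_mono[OF fin\<V> comp] finQ by (simp add: card_Pow)
  moreover have "\<forall>Z\<in>irreducible_components ?E (circuit_variety M).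
      \<exists>J\<subseteq>?Q. Z = matroid_variety (make_loops M J)"
    using comp unfolding \<V>_def by blast
  ultimately show ?thesis
    using finite_subset[OF comp fin\<V>] assms(2) by simp
qed

end
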